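(* Let $f:(M^m,g)\to(N^n,h)$ be a holomorphic map between Hermitian manifolds of complex dimensions $m$ and $n$, with $M$ compact, $m\le n$, and let $1\le\ell\le m$. (a) Assume that the Chern scalar curvature of $(M,g)$ satisfies $S(x)\ge-K$ and the $m$-first Ricci curvature of $(N,h)$ satisfies $Ric^{(1)}_m(x)\le-\kappa$, for some constants $K\ge0$, $\kappa>0$. Then for all $x\in M$ $$\frac{(f^*h)^m}{g^m}(x)\le\Big(\frac{K}{m\kappa}\Big)^m.$$ (b) Assume that the metric $g$ on $M$ is Kähler and $1\le\ell<m$. Assume that the $\ell$-scalar curvature of $(M,g)$ satisfies $S_\ell(x)\ge-K$ and the $\ell$-first Ricci curvature of $(N,h)$ satisfies $Ric^{(1)}_\ell(x)\le-\kappa$, for some constants $K\ge0$, $\kappa>0$. Then for all $x\in M$ $$\|\wedge^\ell\partial f\|_0^2(x)\le\Big(\frac{K}{\ell\kappa}\Big)^\ell.$$ (c) Assume that the $\ell$-second Ricci curvature of $(M,g)$ satisfies $Ric^{(2)}_\ell\ge-K$ and the real bisectional curvature of $(N,h)$ satisfies $\widetilde B(x)\le-\kappa$, for some constants $K\ge0$, $\kappa>0$. Then for all $x\in M$ $$\sigma_\ell(x)\le\frac{\ell K}{\kappa},$$ where $\sigma_\ell(x)=\sum_{\alpha=1}^\ell|\lambda_\alpha|^2(x)$ and $|\lambda_1|(x)\ge\cdots\ge|\lambda_m|(x)$ are the singular values of $\partial f:(T'_xM,g)\to(T'_{f(x)}N,h)$.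
   Context: $T'$ denotes the holomorphic tangent bundle and $\partial f:T'M\to T'N$ the tangent map. The metric $g$ is identified with its $(1,1)$-form, $f^*h$ is the pull-back form, and $\frac{(f^*h)^m}{g^m}$ is the ratio of the top-degree forms (equivalently $\det(A_{\alpha\overline\beta})/\det(g_{\alpha\overline\beta})$ with $A_{\alpha\overline\beta}=\sum_{i,j}\frac{\partial f^i}{\partial z^\alpha}\overline{\frac{\partial f^j}{\partial z^\beta}}h_{i\overline j}$). $\wedge^\ell\partial f:\wedge^\ell T'_xM\to\wedge^\ell T'_{f(x)}N$ is defined by $\wedge^\ell\partial f(v_1\wedge\cdots\wedge v_\ell)=\partial f(v_1)\wedge\cdots\wedge\partial f(v_\ell)$, and $$\|\wedge^\ell\partial f\|_0(x)=\sup_{\mathbf a=v_1\wedge\cdots\wedge v_\ell\ne0,\ \mathbf a\in\wedge^\ell T'_xM}\frac{|\wedge^\ell\partial f(\mathbf a)|}{|\mathbf a|},$$ which equals $|\lambda_1\cdots\lambda_\ell|$ in terms of the largest $\ell$ singular values of $\partial f$ at $x$. Curvatures. The Chern curvature tensor of a Hermitian metric $g$ is $R_{i\overline{j}k\overline{l}}=-\frac{\partial^{2}g_{k\overline{l}}}{\partial z^{i}\partial \overline{z}^{j}}+g^{p\overline{q}}\frac{\partial g_{k\overline{q}}}{\partial z^{i}}\frac{\partial g_{p\overline{l}}}{\partial \overline{z}^{j}}$. The Chern scalar curvature is $S=\sum g^{i\overline j}g^{k\overline l}R_{i\overline jk\overline l}$. For an $\ell$-dimensional complex subspace $\Sigma$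 of the holomorphic tangent space at a point $q$, with unitary basis $E_1,\dots,E_\ell$, and $v\in\Sigma$, define $$Ric^{(1)}_\ell(q,\Sigma)(v,\overline v)=\sum_{i=1}^\ell R(v,\overline v,E_i,\overline{E_i}),\quad Ric^{(2)}_\ell(q,\Sigma)(v,\overline v)=\sum_{i=1}^\ell R(E_i,\overline{E_i},v,\overline v),\quad S_\ell(q,\Sigma)=\sum_{i,j=1}^\ell R(E_i,\overline{E_i},E_j,\overline{E_j}).$$ These are the $\ell$-first Ricci curvature, $\ell$-second Ricci curvature and $\ell$-scalar curvature. A bound such as $Ric^{(1)}_\ell\le-\kappa$ means $Ric^{(1)}_\ell(q,\Sigma)(v,\overline v)\le-\kappa|v|^2$ for all points $q$, all $\ell$-dimensional $\Sigma$ and all $v\in\Sigma$; similarly for $Ric^{(2)}_\ell\ge-K$; and $S_\ell\ge-K$ means $S_\ell(q,\Sigma)\ge-K$ for all $q$ and $\Sigma$. Real bisectional curvature of an $n$-dimensional Hermitian manifold $(N,h)$: for a unitary frame $e=\{e_1,\dots,e_n\}$ of the holomorphic tangent space at a point and nonnegative constants $a=\{a_1,\dots,a_n\}$ with $|a|^2=\sum a_i^2>0$, $$\widetilde B(e,a)=\frac1{|a|^2}\sum_{i,j=1}^nR_{i\overline ij\overline j}a_ia_j,$$ with components of the Chern curvature in the frame $e$. $\widetilde B\le-\kappa$ means $\widetilde B(e,a)\le-\kappa$ for all points, all unitary frames $e$ and all such $a$. *)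

theory Defs
  imports "HOL-Analysis.Analysis" "HOL-Computational_Algebra.Polynomial"
begin

section \<open>Calculus on open subsets of complex coordinate space\<close>

text \<open>Both notions are meant for open sets \<open>S\<close>.\<close>

fun Ck_on :: "nat \<Rightarrow> ('a::real_normed_vector \<Rightarrow> 'b::real_normed_vector) \<Rightarrow> 'a set \<Rightarrow> bool" where
  "Ck_on 0 F S \<longleftrightarrow> continuous_on S F"
| "Ck_on (Suc k) F S \<longleftrightarrow> (\<forall>x\<in>S. F differentiable (at x)) \<and>
     (\<forall>v. Ck_on k (\<lambda>x. frechet_derivative F (at x) v) S)"

definition smooth_on :: "('a::real_normed_vector \<Rightarrow> 'b::real_normed_vector) \<Rightarrow> 'a set \<Rightarrow> bool" where
  "smooth_on F S \<longleftrightarrow> (\<forall>k. Ck_on k F S)"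

definition mholomorphic_on :: "(complex^'m \<Rightarrow> complex^'n) \<Rightarrow> (complex^'m) set \<Rightarrow> bool" where
  "mholomorphic_on F S \<longleftrightarrow>
     (\<forall>z\<in>S. \<exists>D. (F has_derivative D) (at z) \<and> (\<forall>c v. D (c *s v) = c *s D v))"

text \<open>The Wirtinger operators
  \<open>\<partial>/\<partial>z\<^sup>i = (\<partial>/\<partial>x\<^sup>i - \<i> \<partial>/\<partial>y\<^sup>i) / 2\<close> and
  \<open>\<partial>/\<partial>zbar\<^sup>i = (\<partial>/\<partial>x\<^sup>i + \<i> \<partial>/\<partial>y\<^sup>i) / 2\<close>.\<close>

definition dz :: "'m::finite \<Rightarrow> (complex^'m \<Rightarrow> complex) \<Rightarrow> complex^'m \<Rightarrow> complex" where
  "dz i u z = (frechet_derivative u (at z) (axis i 1)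
               - \<i> * frechet_derivative u (at z) (axis i \<i>)) / 2"

definition dzbar :: "'m::finite \<Rightarrow> (complex^'m \<Rightarrow> complex) \<Rightarrow> complex^'m \<Rightarrow> complex" where
  "dzbar i u z = (frechet_derivative u (at z) (axis i 1)
                  + \<i> * frechet_derivative u (at z) (axis i \<i>)) / 2"

definition jacobian :: "(complex^'m \<Rightarrow> complex^'n) \<Rightarrow> complex^'m \<Rightarrow> complex^'m^'n" where
  "jacobian F z = (\<chi> i \<alpha>. dz \<alpha> (\<lambda>w. F w $ i) z)"

section \<open>Complex manifolds and holomorphic maps\<close>

text \<open>The underlying space of a complex manifold is the whole of a second countable Hausdorff
  type, and the complex structure is given by a (not necessarily maximal) holomorphic atlas.
  A chart \<open>(U, \<phi>)\<close> at \<open>x\<close> identifies the holomorphic tangent space at \<open>x\<close> with the complex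
  coordinate space, through the basis \<open>\<partial>/\<partial>z\<^sup>i\<close>; all pointwise
  objects below are given by their components with respect to this basis.\<close>

type_synonym ('a, 'm) chart = "'a set \<times> ('a \<Rightarrow> complex^'m)"

definition chart_inv :: "('a, 'm::finite) chart \<Rightarrow> complex^'m \<Rightarrow> 'a" where
  "chart_inv c = inv_into (fst c) (snd c)"

definition is_chart :: "('a::topological_space, 'm::finite) chart \<Rightarrow> bool" where
  "is_chart c \<longleftrightarrow> open (fst c) \<and> open (snd c ` fst c) \<and>
     homeomorphism (fst c) (snd c ` fst c) (snd c) (chart_inv c)"

definition local_rep ::
  "('a, 'm::finite) chart \<Rightarrow> ('b, 'n::finite) chart \<Rightarrow> ('a \<Rightarrow> 'b) \<Rightarrow> complex^'m \<Rightarrow> complex^'n" where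
  "local_rep c d f = snd d \<circ> f \<circ> chart_inv c"

definition complex_manifold :: "('a::{t2_space,second_countable_topology}, 'm::finite) chart set \<Rightarrow> bool" where
  "complex_manifold \<A> \<longleftrightarrow> (\<Union>c\<in>\<A>. fst c) = UNIV \<and> (\<forall>c\<in>\<A>. is_chart c) \<and>
     (\<forall>c\<in>\<A>. \<forall>d\<in>\<A>. mholomorphic_on (local_rep c d id) (snd c ` (fst c \<inter> fst d)))"

definition holomorphic_map ::
  "('a::{t2_space,second_countable_topology}, 'm::finite) chart set \<Rightarrow>
   ('b::{t2_space,second_countable_topology}, 'n::finite) chart set \<Rightarrow> ('a \<Rightarrow> 'b) \<Rightarrow> bool" where
  "holomorphic_map \<A> \<B> f \<longleftrightarrow> continuous_on UNIV f \<and>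
     (\<forall>c\<in>\<A>. \<forall>d\<in>\<B>. mholomorphic_on (local_rep c d f) (snd c ` (fst c \<inter> f -` fst d)))"

text \<open>The tangent map \<open>\<partial>f\<close> at \<open>x\<close>, as a matrix: component \<open>(i, \<alpha>)\<close> is
  \<open>\<partial>f\<^sup>i/\<partial>z\<^sup>\<alpha>\<close>.\<close>

definition tangent_map ::
  "('a, 'm::finite) chart \<Rightarrow> ('b, 'n::finite) chart \<Rightarrow> ('a \<Rightarrow> 'b) \<Rightarrow> 'a \<Rightarrow> complex^'m^'n" where
  "tangent_map c d f x = jacobian (local_rep c d f) (snd c x)"

section \<open>Hermitian metrics\<close>

text \<open>A matrix \<open>H\<close> with entries \<open>H $ i $ j\<close> (the second index being the barred one) is identified
  with the sesquilinear form \<open>\<Sum> H\<^bsub>ij\<^esub> v\<^sup>i cnj (w\<^sup>j)\<close>.\<close>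

definition herm :: "complex^'m^'m \<Rightarrow> complex^'m \<Rightarrow> complex^'m \<Rightarrow> complex" where
  "herm H v w = (\<Sum>i\<in>UNIV. \<Sum>j\<in>UNIV. H $ i $ j * v $ i * cnj (w $ j))"

definition herm_norm :: "complex^'m^'m \<Rightarrow> complex^'m \<Rightarrow> real" where
  "herm_norm H v = sqrt (Re (herm H v v))"

definition hermitian_posdef :: "complex^'m^'m \<Rightarrow> bool" where
  "hermitian_posdef H \<longleftrightarrow> (\<forall>i j. H $ j $ i = cnj (H $ i $ j)) \<and> (\<forall>v. v \<noteq> 0 \<longrightarrow> Re (herm H v v) > 0)"

definition pullback_form :: "complex^'m^'n \<Rightarrow> complex^'n^'n \<Rightarrow> complex^'m^'m" where
  "pullback_form J H =
     (\<chi> \<alpha> \<beta>. \<Sum>i\<in>UNIV. \<Sum>j\<in>UNIV. J $ i $ \<alpha> * cnj (J $ j $ \<beta>) * H $ i $ j)"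

text \<open>\<open>g c z\<close> is the matrix of components of the metric in the chart \<open>c\<close> at the point with
  coordinates \<open>z\<close>.  The last conjunct is the transformation law under a change of chart.\<close>

type_synonym ('a, 'm) metric = "('a, 'm) chart \<Rightarrow> complex^'m \<Rightarrow> complex^'m^'m"

definition hermitian_metric ::
  "('a::{t2_space,second_countable_topology}, 'm::finite) chart set \<Rightarrow> ('a, 'm) metric \<Rightarrow> bool" where
  "hermitian_metric \<A> g \<longleftrightarrow>
     (\<forall>c\<in>\<A>. smooth_on (g c) (snd c ` fst c) \<and> (\<forall>x\<in>fst c. hermitian_posdef (g c (snd c x)))) \<and>
     (\<forall>c\<in>\<A>. \<forall>d\<in>\<A>. \<forall>x\<in>fst c \<inter> fst d.
        g c (snd c x) = pullback_form (tangent_map c d id x) (g d (snd d x)))"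

definition hermitian_manifold ::
  "('a::{t2_space,second_countable_topology}, 'm::finite) chart set \<Rightarrow> ('a, 'm) metric \<Rightarrow> bool" where
  "hermitian_manifold \<A> g \<longleftrightarrow> complex_manifold \<A> \<and> hermitian_metric \<A> g"

text \<open>Closedness of the form \<open>\<i> \<Sum> g\<^bsub>kl\<^esub> dz\<^sup>k \<and> dzbar\<^sup>l\<close>, in components.
  The vanishing of the \<open>(1,2)\<close>-part of the differential is the conjugate equation.\<close>

definition kaehler ::
  "('a, 'm::finite) chart set \<Rightarrow> ('a, 'm) metric \<Rightarrow> bool" where
  "kaehler \<A> g \<longleftrightarrow> (\<forall>c\<in>\<A>. \<forall>z\<in>snd c ` fst c. \<forall>i k l.
     dz i (\<lambda>w. g c w $ k $ l) z = dz k (\<lambda>w. g c w $ i $ l) z)"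

section \<open>Chern curvature\<close>

text \<open>The coefficients \<open>g\<^sup>p\<^sup>q\<close> with upper indices satisfy
  \<open>\<Sum>q. g\<^sup>p\<^sup>q g\<^bsub>kq\<^esub> = \<delta>\<^bsub>pk\<^esub>\<close> (second index barred), so they
  form the transpose of the inverse matrix.\<close>

definition ginv :: "complex^'m^'m \<Rightarrow> complex^'m^'m" where
  "ginv H = transpose (matrix_inv H)"

definition chern_comp ::
  "(complex^'m \<Rightarrow> complex^'m^'m) \<Rightarrow> complex^'m \<Rightarrow> 'm \<Rightarrow> 'm \<Rightarrow> 'm \<Rightarrow> 'm \<Rightarrow> complex" where
  "chern_comp G z i j k l =
     - dz i (\<lambda>w. dzbar j (\<lambda>u. G u $ k $ l) w) z
     + (\<Sum>p\<in>UNIV. \<Sum>q\<in>UNIV. ginv (G z) $ p $ q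
          * dz i (\<lambda>w. G w $ k $ q) z * dzbar j (\<lambda>w. G w $ p $ l) z)"

text \<open>\<open>chern_R G z u v w x\<close> is the curvature \<open>R(u, cnj v, w, cnj x)\<close>.\<close>

definition chern_R ::
  "(complex^'m \<Rightarrow> complex^'m^'m) \<Rightarrow> complex^'m \<Rightarrow>
   complex^'m \<Rightarrow> complex^'m \<Rightarrow> complex^'m \<Rightarrow> complex^'m \<Rightarrow> complex" where
  "chern_R G z u v w x = (\<Sum>i\<in>UNIV. \<Sum>j\<in>UNIV. \<Sum>k\<in>UNIV. \<Sum>l\<in>UNIV.
     chern_comp G z i j k l * u $ i * cnj (v $ j) * w $ k * cnj (x $ l))"

text \<open>The complex numbers whose real parts are taken below are real whenever \<open>G\<close> is a
  Hermitian metric.\<close>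

definition chern_scalar :: "(complex^'m \<Rightarrow> complex^'m^'m) \<Rightarrow> complex^'m \<Rightarrow> real" where
  "chern_scalar G z = Re (\<Sum>i\<in>UNIV. \<Sum>j\<in>UNIV. \<Sum>k\<in>UNIV. \<Sum>l\<in>UNIV.
     ginv (G z) $ i $ j * ginv (G z) $ k $ l * chern_comp G z i j k l)"

definition unitary_basis :: "complex^'m^'m \<Rightarrow> nat \<Rightarrow> (complex^'m) set \<Rightarrow> (nat \<Rightarrow> complex^'m) \<Rightarrow> bool" where
  "unitary_basis H l \<Sigma> E \<longleftrightarrow>
     (\<forall>i<l. \<forall>j<l. herm H (E i) (E j) = (if i = j then 1 else 0)) \<and> vec.span (E ` {..<l}) = \<Sigma>"

text \<open>The following three are independent of the unitary basis \<open>E\<close> of the \<open>l\<close>-dimensional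
  subspace.\<close>

definition ric1 ::
  "(complex^'m \<Rightarrow> complex^'m^'m) \<Rightarrow> complex^'m \<Rightarrow> nat \<Rightarrow> (nat \<Rightarrow> complex^'m) \<Rightarrow> complex^'m \<Rightarrow> real" where
  "ric1 G z l E v = Re (\<Sum>i<l. chern_R G z v v (E i) (E i))"

definition ric2 ::
  "(complex^'m \<Rightarrow> complex^'m^'m) \<Rightarrow> complex^'m \<Rightarrow> nat \<Rightarrow> (nat \<Rightarrow> complex^'m) \<Rightarrow> complex^'m \<Rightarrow> real" where
  "ric2 G z l E v = Re (\<Sum>i<l. chern_R G z (E i) (E i) v v)"

definition l_scalar ::
  "(complex^'m \<Rightarrow> complex^'m^'m) \<Rightarrow> complex^'m \<Rightarrow> nat \<Rightarrow> (nat \<Rightarrow> complex^'m) \<Rightarrow> real" where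
  "l_scalar G z l E = Re (\<Sum>i<l. \<Sum>j<l. chern_R G z (E i) (E i) (E j) (E j))"

definition real_bisectional ::
  "(complex^'m \<Rightarrow> complex^'m^'m) \<Rightarrow> complex^'m \<Rightarrow> ('m \<Rightarrow> complex^'m) \<Rightarrow> ('m \<Rightarrow> real) \<Rightarrow> real" where
  "real_bisectional G z e a =
     1 / (\<Sum>i\<in>UNIV. (a i)\<^sup>2) *
     Re (\<Sum>i\<in>UNIV. \<Sum>j\<in>UNIV. chern_R G z (e i) (e i) (e j) (e j) * of_real (a i) * of_real (a j))"

definition chern_scalar_ge :: "('a, 'm::finite) chart set \<Rightarrow> ('a, 'm) metric \<Rightarrow> real \<Rightarrow> bool" where
  "chern_scalar_ge \<A> g C \<longleftrightarrow> (\<forall>c\<in>\<A>. \<forall>z\<in>snd c ` fst c. chern_scalar (g c) z \<ge> C)"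

definition ric1_le :: "('a, 'm::finite) chart set \<Rightarrow> ('a, 'm) metric \<Rightarrow> nat \<Rightarrow> real \<Rightarrow> bool" where
  "ric1_le \<A> g l C \<longleftrightarrow> (\<forall>c\<in>\<A>. \<forall>z\<in>snd c ` fst c. \<forall>\<Sigma> E.
     vec.subspace \<Sigma> \<and> vec.dim \<Sigma> = l \<and> unitary_basis (g c z) l \<Sigma> E \<longrightarrow>
     (\<forall>v\<in>\<Sigma>. ric1 (g c) z l E v \<le> C * (herm_norm (g c z) v)\<^sup>2))"

definition ric2_ge :: "('a, 'm::finite) chart set \<Rightarrow> ('a, 'm) metric \<Rightarrow> nat \<Rightarrow> real \<Rightarrow> bool" where
  "ric2_ge \<A> g l C \<longleftrightarrow> (\<forall>c\<in>\<A>. \<forall>z\<in>snd c ` fst c. \<forall>\<Sigma> E.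
     vec.subspace \<Sigma> \<and> vec.dim \<Sigma> = l \<and> unitary_basis (g c z) l \<Sigma> E \<longrightarrow>
     (\<forall>v\<in>\<Sigma>. ric2 (g c) z l E v \<ge> C * (herm_norm (g c z) v)\<^sup>2))"

definition l_scalar_ge :: "('a, 'm::finite) chart set \<Rightarrow> ('a, 'm) metric \<Rightarrow> nat \<Rightarrow> real \<Rightarrow> bool" where
  "l_scalar_ge \<A> g l C \<longleftrightarrow> (\<forall>c\<in>\<A>. \<forall>z\<in>snd c ` fst c. \<forall>\<Sigma> E.
     vec.subspace \<Sigma> \<and> vec.dim \<Sigma> = l \<and> unitary_basis (g c z) l \<Sigma> E \<longrightarrow>
     l_scalar (g c) z l E \<ge> C)"

definition real_bisectional_le :: "('a, 'm::finite) chart set \<Rightarrow> ('a, 'm) metric \<Rightarrow> real \<Rightarrow> bool" where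
  "real_bisectional_le \<A> g C \<longleftrightarrow> (\<forall>c\<in>\<A>. \<forall>z\<in>snd c ` fst c. \<forall>e a.
     (\<forall>i j. herm (g c z) (e i) (e j) = (if i = j then 1 else 0)) \<and>
     (\<forall>i. a i \<ge> 0) \<and> (\<Sum>i\<in>UNIV. (a i)\<^sup>2) > 0 \<longrightarrow>
     real_bisectional (g c) z e a \<le> C)"

section \<open>Exterior powers of the tangent map\<close>

text \<open>An \<open>l\<close>-vector is given by its components as an antisymmetric tensor of degree \<open>l\<close>;
  only the values \<open>I 0, \<dots>, I (l-1)\<close> of a multi-index \<open>I\<close> matter.
  \<open>wedge l v\<close> is \<open>v 0 \<and> \<dots> \<and> v (l-1)\<close>.\<close>

type_synonym 'm tensor = "(nat \<Rightarrow> 'm) \<Rightarrow> complex"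

definition wedge :: "nat \<Rightarrow> (nat \<Rightarrow> complex^'m) \<Rightarrow> 'm tensor" where
  "wedge l v = (\<lambda>I. \<Sum>p | p permutes {..<l}. of_int (sign p) * (\<Prod>a<l. v (p a) $ I a))"

definition multi_indices :: "nat \<Rightarrow> (nat \<Rightarrow> 'm) set" where
  "multi_indices l = {..<l} \<rightarrow>\<^sub>E UNIV"

definition wedge_map :: "nat \<Rightarrow> complex^'m^'n \<Rightarrow> 'm tensor \<Rightarrow> 'n tensor" where
  "wedge_map l J a = (\<lambda>I. \<Sum>K\<in>multi_indices l. (\<Prod>b<l. J $ I b $ K b) * a K)"

text \<open>The norm induced by \<open>H\<close>; the factor \<open>1/l!\<close> makes the inner product of
  \<open>v\<^sub>1 \<and> \<dots> \<and> v\<^sub>l\<close> and \<open>w\<^sub>1 \<and> \<dots> \<and> w\<^sub>l\<close> equal to the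
  determinant of the matrix \<open>herm H v\<^sub>i w\<^sub>j\<close>.\<close>

definition wedge_norm :: "nat \<Rightarrow> complex^'m^'m \<Rightarrow> 'm tensor \<Rightarrow> real" where
  "wedge_norm l H a = sqrt (Re (\<Sum>I\<in>multi_indices l. \<Sum>K\<in>multi_indices l.
     (\<Prod>b<l. H $ I b $ K b) * a I * cnj (a K)) / fact l)"

definition wedge_comass :: "nat \<Rightarrow> complex^'m^'m \<Rightarrow> complex^'n^'n \<Rightarrow> complex^'m^'n \<Rightarrow> real" where
  "wedge_comass l G H J =
     Sup {wedge_norm l H (wedge_map l J a) / wedge_norm l G a | a.
            (\<exists>v. a = wedge l v) \<and> a \<noteq> (\<lambda>I. 0)}"

lemma wedge_map_wedge:
  fixes J :: "complex^'m^'n"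
  shows "wedge_map l J (wedge l v) = wedge l (\<lambda>i. J *v v i)"
proof
  fix I :: "nat \<Rightarrow> 'n"
  have "wedge l (\<lambda>i. J *v v i) I =
      (\<Sum>p | p permutes {..<l}. of_int (sign p) * (\<Prod>a<l. \<Sum>k\<in>UNIV. J $ I a $ k * v (p a) $ k))"
    by (simp add: wedge_def matrix_vector_mult_def)
  also have "\<dots> = (\<Sum>p | p permutes {..<l}. of_int (sign p) *
      (\<Sum>K\<in>multi_indices l. \<Prod>a<l. J $ I a $ K a * v (p a) $ K a))"
    by (subst prod_sum_PiE) (auto simp: multi_indices_def)
  also have "\<dots> = (\<Sum>K\<in>multi_indices l. \<Sum>p | p permutes {..<l}. of_int (sign p) *
      (\<Prod>a<l. J $ I a $ K a * v (p a) $ K a))"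
    by (simp add: sum_distrib_left) (rule sum.swap)
  also have "\<dots> = wedge_map l J (wedge l v) I"
    by (simp add: wedge_map_def wedge_def sum_distrib_left prod.distrib mult_ac)
  finally show "wedge_map l J (wedge l v) I = wedge l (\<lambda>i. J *v v i) I" ..
qed

section \<open>Singular values and volume ratio\<close>

text \<open>The adjoint of \<open>J\<close> with respect to the inner products \<open>herm G\<close> and \<open>herm H\<close>.\<close>

definition adjoint_mat :: "complex^'m^'m \<Rightarrow> complex^'n^'n \<Rightarrow> complex^'m^'n \<Rightarrow> complex^'n^'m" where
  "adjoint_mat G H J = map_matrix cnj (matrix_inv G ** transpose J ** H)"

lemma herm_conv: "herm H v w = (\<Sum>i\<in>UNIV. v $ i * (H *v (\<chi> j. cnj (w $ j))) $ i)"
  by (simp add: herm_def matrix_vector_mult_def sum_distrib_left mult_ac)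

lemma hermitian_posdef_invertible:
  fixes H :: "complex^'m^'m"
  assumes "hermitian_posdef H"
  shows "invertible H"
proof -
  have "y = 0" if "H *v y = 0" for y
  proof (rule ccontr)
    assume "y \<noteq> 0"
    define w where "w = (\<chi> j. cnj (y $ j))"
    have "w \<noteq> 0"
      using \<open>y \<noteq> 0\<close> by (auto simp: w_def vec_eq_iff)
    then have "Re (herm H w w) > 0"
      using assms by (simp add: hermitian_posdef_def)
    moreover have "(\<chi> j. cnj (w $ j)) = y"
      by (simp add: w_def vec_eq_iff)
    ultimately show False
      using that by (simp add: herm_conv)
  qed
  then show ?thesis
    by (simp add: invertible_left_inverse matrix_left_invertible_ker)
qed

lemma herm_adjoint_mat:
  assumes "hermitian_posdef G"
  shows "herm H (J *v v) w = herm G v (adjoint_mat G H J *v w)"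
proof -
  let ?y = "\<chi> j. cnj (w $ j)"
  have *: "(\<chi> j. cnj ((adjoint_mat G H J *v w) $ j)) = (matrix_inv G ** transpose J ** H) *v ?y"
    by (simp add: adjoint_mat_def matrix_vector_mult_def vec_eq_iff)
  have "G ** matrix_inv G = mat 1"
    using hermitian_posdef_invertible[OF assms] unfolding invertible_def matrix_inv_def
    by (rule someI2_ex) simp
  then have "G *v ((matrix_inv G ** transpose J ** H) *v ?y) = transpose J *v (H *v ?y)"
    by (simp add: matrix_vector_mul_assoc matrix_mul_assoc)
  then have "herm G v (adjoint_mat G H J *v w) =
      (\<Sum>i\<in>UNIV. v $ i * (\<Sum>k\<in>UNIV. J $ k $ i * (H *v ?y) $ k))"
    unfolding herm_conv * by (simp add: matrix_vector_mult_def transpose_def)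
  also have "\<dots> = (\<Sum>k\<in>UNIV. (\<Sum>i\<in>UNIV. J $ k $ i * v $ i) * (H *v ?y) $ k)"
    unfolding sum_distrib_left sum_distrib_right
    by (subst sum.swap) (simp add: mult_ac)
  also have "\<dots> = herm H (J *v v) w"
    by (simp add: herm_conv matrix_vector_mult_def[of J])
  finally show ?thesis ..
qed

definition charpoly :: "complex^'m^'m \<Rightarrow> complex poly" where
  "charpoly A = det (\<chi> i j. (if i = j then [:0, 1:] else 0) - [:A $ i $ j:])"

text \<open>The square roots of the eigenvalues of \<open>J\<^sup>* J\<close>, in decreasing order and
  repeated according to multiplicity.\<close>

definition singular_values :: "complex^'m^'m \<Rightarrow> complex^'n^'n \<Rightarrow> complex^'m^'n \<Rightarrow> real list" where
  "singular_values G H J =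
     rev (sorted_list_of_multiset
       (image_mset (\<lambda>t. sqrt (Re t)) (proots (charpoly (adjoint_mat G H J ** J)))))"

definition sigma_l :: "nat \<Rightarrow> complex^'m^'m \<Rightarrow> complex^'n^'n \<Rightarrow> complex^'m^'n \<Rightarrow> real" where
  "sigma_l l G H J = (\<Sum>\<alpha><l. (singular_values G H J ! \<alpha>)\<^sup>2)"

text \<open>The top power of the \<open>(1,1)\<close>-form with coefficient matrix \<open>A\<close> is a fixed multiple,
  not depending on \<open>A\<close>, of \<open>det A\<close> times the coordinate volume form.  This is the resulting
  ratio; both determinants are real.\<close>

definition volume_ratio :: "complex^'m^'m \<Rightarrow> complex^'n^'n \<Rightarrow> complex^'m^'n \<Rightarrow> real" where
  "volume_ratio G H J = Re (det (pullback_form J H) / det G)"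

end

theory Submission
  imports Defs "HOL-Complex_Analysis.Complex_Analysis"
begin

text \<open>All three parts are maximum principles on the compact bundle of unitary \<open>l\<close>-frames of the
  source. The function is the determinant (a, b) or the trace (c) of the Gram matrix of the image
  frame. At a maximum point, rotate the frame \<open>E\<close> so that this Gram matrix is diagonal with entries
  \<open>\<mu>\<^sub>i\<close>. For each \<open>v\<close>, move along the complex line \<open>z + t v\<close> in a chart and extend the frame
  holomorphically in \<open>t\<close> so that it is parallel at \<open>t = 0\<close> in the direction \<open>v\<close>. The mixed
  \<open>t\<close>-derivative of the Gram matrices then gives minus the curvature on the source, and minus the
  curvature plus a nonnegative term on the target, and maximality compares the two. Summing over
  \<open>v = E\<^sub>1, \<dots>, E\<^sub>l\<close> yields the scalar curvature (the second Ricci curvature weighted by \<open>\<mu>\<close>) on the source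
  and the first Ricci curvature (the real bisectional curvature) on the target; the estimates
  follow from the inequalities between the means of the \<open>\<mu>\<^sub>i\<close>. Part (a) is the case \<open>l = m\<close> of the
  determinant argument. Frames chosen along one line at a time replace holomorphic normal
  coordinates.\<close>

text \<open>A frame moved along \<open>z + t v\<close> is parallel only to first order, hence not
  unitary away from \<open>t = 0\<close>, whereas the maximum is taken over unitary frames. Each
  functional is therefore replaced by one that is defined on all \<open>l\<close>-tuples, with Gram
  matrices \<open>G\<close> in the source and \<open>B\<close> in the target. For the determinant
  this is the inequality \<open>det B \<le> \<Lambda> det G\<close>, whose sides scale alike. For
  the trace, where the invariant \<open>tr (G^-1 B)\<close> would bring in an inverse, it is
  \<open>2 tr B - tr (G B)\<close>, which equals \<open>tr B\<close> on unitary frames and never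
  exceeds the maximum elsewhere. In the determinant case the first order terms of \<open>B\<close>
  survive the choice of frame and would spoil the sign; a further change of frame and Bessel's
  inequality absorb them. Being parallel in one direction is a condition on one derivative, so a
  frame affine in \<open>t\<close> suffices. Degeneracy of the pull-back is harmless: a vanishing
  maximal determinant satisfies the bound already, and the real bisectional curvature admits zero
  weights.\<close>

no_notation fps_nth (infixl "$" 75)

section \<open>Determinants\<close>

text \<open>The size is a number rather than a type, because the length of a frame varies
  independently of the dimensions of the manifolds.\<close>

definition ndet :: "nat \<Rightarrow> (nat \<Rightarrow> nat \<Rightarrow> complex) \<Rightarrow> complex" where
  "ndet l A = (\<Sum>p | p permutes {..<l}. of_int (sign p) * (\<Prod>i<l. A i (p i)))"

lemma ndet_cong:
  assumes "\<And>i j. i < l \<Longrightarrow> j < l \<Longrightarrow> A i j = B i j"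
  shows "ndet l A = ndet l B"
  unfolding ndet_def
proof (intro sum.cong refl arg_cong2[where f = "(*)"] prod.cong)
  fix p i assume "p \<in> {p. p permutes {..<l}}" "i \<in> {..<l}"
  then show "A i (p i) = B i (p i)"
    using permutes_in_image[of p "{..<l}" i] by (intro assms) auto
qed

text \<open>If rows \<open>k a\<close> and \<open>k b\<close> coincide, composing \<open>p\<close>
  with the transposition of \<open>a\<close> and \<open>b\<close> reverses the sign and preserves
  the product, so the sum is its own negative.\<close>

lemma ndet_rows_not_inj:
  fixes l :: nat
  assumes "\<not> inj_on k {..<l}"
  shows "(\<Sum>p | p permutes {..<l}. of_int (sign p) * (\<Prod>i<l. B (k i) (p i))) = (0::complex)"
proof -
  obtain a b where ab: "a < l" "b < l" "a \<noteq> b" "k a = k b"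
    using assms by (auto simp: inj_on_def)
  let ?t = "Transposition.transpose a b"
  let ?f = "\<lambda>p. of_int (sign p) * (\<Prod>i<l. B (k i) (p i)) :: complex"
  have t: "?t permutes {..<l}"
    using ab by (simp add: permutes_swap_id)
  have kt: "k (?t i) = k i" for i
    using ab(4) by (auto simp: Transposition.transpose_def)
  have "?f (p \<circ> ?t) = - ?f p" if p: "p permutes {..<l}" for p
  proof -
    have "(\<Prod>i<l. B (k i) (p (?t i))) = (\<Prod>i<l. B (k (?t i)) (p (?t i)))"
      by (simp add: kt)
    also have "\<dots> = (\<Prod>i<l. B (k i) (p i))"
      using permutes_imp_bij[OF t] by (rule prod.reindex_bij_betw)
    finally show ?thesis
      using sign_compose[of p ?t] permutes_imp_permutation[OF finite_lessThan p]
        permutes_imp_permutation[OF finite_lessThan t] ab(3)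
      by (simp add: sign_swap_id)
  qed
  moreover have "(\<Sum>p | p permutes {..<l}. ?f p) = (\<Sum>p | p permutes {..<l}. ?f (p \<circ> ?t))"
    by (rule sum.reindex_bij_betw[symmetric])
      (rule bij_betwI[where g = "\<lambda>p. p \<circ> ?t"], auto simp: permutes_compose[OF t] comp_assoc)
  ultimately have "(\<Sum>p | p permutes {..<l}. ?f p) = - (\<Sum>p | p permutes {..<l}. ?f p)"
    by (simp add: sum_negf)
  then show ?thesis
    by simp
qed

lemma ndet_permute_rows:
  assumes k: "k permutes {..<l}"
  shows "(\<Sum>p | p permutes {..<l}. of_int (sign p) * (\<Prod>i<l. B (k i) (p i))) = of_int (sign k) * ndet l B"
proof -
  have "(\<Sum>p | p permutes {..<l}. of_int (sign p) * (\<Prod>i<l. B (k i) (p i))) =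
      (\<Sum>q | q permutes {..<l}. of_int (sign (q \<circ> k)) * (\<Prod>i<l. B (k i) ((q \<circ> k) i)))"
    by (rule sum.reindex_bij_betw[symmetric])
      (rule bij_betwI[where g = "\<lambda>p. p \<circ> inv k"],
        auto simp: permutes_compose[OF k] permutes_compose[OF permutes_inv[OF k]] comp_assoc
          permutes_inv_o[OF k])
  also have "\<dots> = (\<Sum>q | q permutes {..<l}. of_int (sign k) * (of_int (sign q) * (\<Prod>i<l. B i (q i))))"
  proof (rule sum.cong)
    fix q assume "q \<in> {q. q permutes {..<l}}"
    then have "sign (q \<circ> k) = sign q * sign k"
      using k by (auto simp: sign_compose permutes_imp_permutation[OF finite_lessThan])
    moreover have "(\<Prod>i<l. B (k i) (q (k i))) = (\<Prod>i<l. B i (q i))"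
      using permutes_imp_bij[OF k] by (rule prod.reindex_bij_betw)
    ultimately show "of_int (sign (q \<circ> k)) * (\<Prod>i<l. B (k i) ((q \<circ> k) i)) =
        of_int (sign k) * (of_int (sign q) * (\<Prod>i<l. B i (q i)))"
      by simp
  qed simp
  finally show ?thesis
    by (simp add: ndet_def sum_distrib_left)
qed

text \<open>Multiplying out gives one term for each choice \<open>k\<close> of a row of
  \<open>B\<close> for every row of \<open>A\<close>. Choices with a repetition cancel; the
  remaining ones are permutations of the rows of \<open>B\<close>.\<close>

lemma ndet_mult: "ndet l (\<lambda>i j. \<Sum>k<l. A i k * B k j) = ndet l A * ndet l B"
proof -
  let ?F = "{..<l} \<rightarrow>\<^sub>E {..<l}"
  let ?R = "\<lambda>k. \<Sum>p | p permutes {..<l}. of_int (sign p) * (\<Prod>i<l. B (k i) (p i))"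
  have "ndet l (\<lambda>i j. \<Sum>k<l. A i k * B k j) =
      (\<Sum>p | p permutes {..<l}. of_int (sign p) * (\<Sum>k\<in>?F. \<Prod>i<l. A i (k i) * B (k i) (p i)))"
    unfolding ndet_def by (subst prod_sum_PiE) auto
  also have "\<dots> = (\<Sum>k\<in>?F. (\<Prod>i<l. A i (k i)) * ?R k)"
    unfolding sum_distrib_left by (subst sum.swap) (simp add: prod.distrib mult_ac)
  also have "\<dots> = (\<Sum>k\<in>{k\<in>?F. inj_on k {..<l}}. (\<Prod>i<l. A i (k i)) * ?R k)"
    by (rule sum.mono_neutral_right) (auto simp: finite_PiE ndet_rows_not_inj)
  also have "\<dots> = (\<Sum>p | p permutes {..<l}. (\<Prod>i<l. A i (p i)) * ?R p)"
  \<comment> \<open>Elements of \<open>?F\<close> are \<open>undefined\<close> outside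
    \<open>{..<l}\<close> while permutations are the identity there; the two witnesses translate
    between these conventions.\<close>
  proof (rule sum.reindex_bij_witness[where i = "\<lambda>p. restrict p {..<l}"
        and j = "\<lambda>k i. if i < l then k i else i"])
    fix k assume k: "k \<in> {k\<in>?F. inj_on k {..<l}}"
    show "restrict (\<lambda>i. if i < l then k i else i) {..<l} = k"
      using k by (auto simp: fun_eq_iff PiE_def extensional_def)
    have "bij_betw k {..<l} {..<l}"
      using k by (intro bij_betw_imageI endo_inj_surj) auto
    then have "bij_betw (\<lambda>i. if i < l then k i else i) {..<l} {..<l}"
      by (subst bij_betw_cong[where g = k]) auto
    then show "(\<lambda>i. if i < l then k i else i) \<in> {p. p permutes {..<l}}"
      by (intro CollectI bij_imp_permutes) auto
  next
    fix p assume p: "p \<in> {p. p permutes {..<l}}"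
    show "(\<lambda>i. if i < l then restrict p {..<l} i else i) = p"
      using p by (auto simp: fun_eq_iff permutes_def)
    show "restrict p {..<l} \<in> {k\<in>?F. inj_on k {..<l}}"
      using p permutes_in_image[of p "{..<l}"] permutes_inj_on[of p "{..<l}"] by auto
  qed simp
  also have "\<dots> = (\<Sum>p | p permutes {..<l}. of_int (sign p) * (\<Prod>i<l. A i (p i)) * ndet l B)"
    by (rule sum.cong) (auto simp: ndet_permute_rows mult_ac)
  finally show ?thesis
    by (simp add: ndet_def sum_distrib_right)
qed

lemma ndet_transpose: "ndet l (\<lambda>i j. A j i) = ndet l A"
proof -
  have "ndet l (\<lambda>i j. A j i) =
      (\<Sum>p | p permutes {..<l}. of_int (sign (inv p)) * (\<Prod>i<l. A (inv p i) i))"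
    unfolding ndet_def
    by (rule sum.reindex_bij_betw[symmetric, of inv])
      (rule bij_betwI[where g = inv], auto simp: permutes_inv permutes_inv_inv)
  also have "\<dots> = ndet l A"
    unfolding ndet_def
  proof (rule sum.cong)
    fix p assume "p \<in> {p. p permutes {..<l}}"
    then have p: "p permutes {..<l}" by simp
    have "(\<Prod>i<l. A (inv p i) i) = (\<Prod>i<l. A (inv p (p i)) (p i))"
      using permutes_imp_bij[OF p] by (rule prod.reindex_bij_betw[symmetric])
    then show "of_int (sign (inv p)) * (\<Prod>i<l. A (inv p i) i) = of_int (sign p) * (\<Prod>i<l. A i (p i))"
      using p by (simp add: permutes_inverses sign_inverse permutes_imp_permutation[OF finite_lessThan])
  qed simp
  finally show ?thesis .
qed

lemma ndet_cnj: "ndet l (\<lambda>i j. cnj (A i j)) = cnj (ndet l A)"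
  by (simp add: ndet_def)

lemma ndet_diag:
  assumes "\<And>i j. i < l \<Longrightarrow> j < l \<Longrightarrow> i \<noteq> j \<Longrightarrow> A i j = 0"
  shows "ndet l A = (\<Prod>i<l. A i i)"
proof -
  have "(\<Prod>i<l. A i (p i)) = 0" if p: "p permutes {..<l}" and "p \<noteq> id" for p
  proof -
    obtain i where i: "p i \<noteq> i"
      using \<open>p \<noteq> id\<close> by (auto simp: fun_eq_iff)
    then have "i < l" "p i < l"
      using p permutes_in_image[of p "{..<l}" i] by (auto simp: permutes_def)
    then show ?thesis
      using i assms[of i "p i"] by (auto intro!: prod_zero bexI[of _ i])
  qed
  then have "ndet l A = (\<Sum>p\<in>{id}. of_int (sign p) * (\<Prod>i<l. A i (p i)))"
    unfolding ndet_def
    by (intro sum.mono_neutral_right) (auto simp: finite_permutations permutes_id)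
  then show ?thesis
    by (simp add: sign_id)
qed

text \<open>The matrix is \<open>C\<close> times \<open>A\<close> times the conjugate transpose of
  \<open>C\<close>. The scalar in front depends on the change of frame only, hence is common to all
  forms measured in that frame.\<close>

lemma ndet_congruence:
  "ndet l (\<lambda>i j. \<Sum>a<l. \<Sum>b<l. C i a * A a b * cnj (C j b)) = of_real ((cmod (ndet l C))\<^sup>2) * ndet l A"
proof -
  have "ndet l (\<lambda>i j. \<Sum>a<l. \<Sum>b<l. C i a * A a b * cnj (C j b)) =
      ndet l (\<lambda>i j. \<Sum>a<l. C i a * (\<Sum>b<l. A a b * cnj (C j b)))"
    by (simp add: sum_distrib_left mult_ac)
  also have "\<dots> = ndet l C * (ndet l A * cnj (ndet l C))"
    using ndet_mult[of l C "\<lambda>a j. \<Sum>b<l. A a b * cnj (C j b)"]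
      ndet_mult[of l A "\<lambda>b j. cnj (C j b)"] ndet_transpose[of l "\<lambda>j b. cnj (C j b)"]
    by (simp add: ndet_cnj)
  finally show ?thesis
    by (simp add: complex_norm_square[symmetric] mult_ac del: of_real_power)
qed

section \<open>Hermitian linear algebra\<close>

lemma herm_add_left: "herm H (v + w) x = herm H v x + herm H w x"
  by (simp add: herm_def algebra_simps sum.distrib)

lemma herm_add_right: "herm H x (v + w) = herm H x v + herm H x w"
  by (simp add: herm_def algebra_simps sum.distrib)

lemma herm_scale_left: "herm H (c *s v) x = c * herm H v x"
  by (simp add: herm_def sum_distrib_left mult_ac)

lemma herm_scale_right: "herm H x (c *s v) = cnj c * herm H x v"
  by (simp add: herm_def sum_distrib_left mult_ac)

lemma herm_zero [simp]: "herm H 0 x = 0" "herm H x 0 = 0"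
  by (simp_all add: herm_def)

lemma herm_minus_left: "herm H (- v) x = - herm H v x"
  by (simp add: herm_def sum_negf)

lemma herm_minus_right: "herm H x (- v) = - herm H x v"
  by (simp add: herm_def sum_negf)

lemma herm_diff_left: "herm H (v - w) x = herm H v x - herm H w x"
  by (simp add: herm_def algebra_simps sum_subtractf)

lemma herm_diff_right: "herm H x (v - w) = herm H x v - herm H x w"
  by (simp add: herm_def algebra_simps sum_subtractf)

lemma herm_sum_left: "herm H (\<Sum>i\<in>A. f i) x = (\<Sum>i\<in>A. herm H (f i) x)"
  by (induction A rule: infinite_finite_induct) (simp_all add: herm_add_left)

lemma herm_sum_right: "herm H x (\<Sum>i\<in>A. f i) = (\<Sum>i\<in>A. herm H x (f i))"
  by (induction A rule: infinite_finite_induct) (simp_all add: herm_add_right)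

lemmas herm_linear = herm_add_left herm_add_right herm_scale_left herm_scale_right
  herm_minus_left herm_minus_right herm_diff_left herm_diff_right herm_sum_left herm_sum_right

lemma pullback_form_nth: "pullback_form J H $ a $ b = herm H (column a J) (column b J)"
  by (simp only: pullback_form_def herm_def column_def vec_lambda_beta mult_ac)

lemma herm_pullback_form: "herm (pullback_form J H) v w = herm H (J *v v) (J *v w)"
proof -
  have l: "herm H (J *v v) x = (\<Sum>a\<in>UNIV. v $ a * herm H (column a J) x)" for x
    by (simp only: matrix_mult_sum herm_sum_left herm_scale_left)
  have r: "herm H x (J *v w) = (\<Sum>b\<in>UNIV. cnj (w $ b) * herm H x (column b J))" for x
    by (simp only: matrix_mult_sum herm_sum_right herm_scale_right)
  show ?thesis
    unfolding herm_def[of "pullback_form J H"] pullback_form_nth l r sum_distrib_left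
    by (simp only: mult_ac) (rule sum.swap)
qed

text \<open>Positivity is dropped because a pull-back is only semidefinite where the tangent map has
  a kernel.\<close>

definition hermitian_mat :: "complex^'m^'m \<Rightarrow> bool" where
  "hermitian_mat H \<longleftrightarrow> (\<forall>i j. H $ j $ i = cnj (H $ i $ j))"

lemma hermitian_posdef_imp_hermitian_mat: "hermitian_posdef H \<Longrightarrow> hermitian_mat H"
  unfolding hermitian_posdef_def hermitian_mat_def by blast

lemma cnj_herm:
  assumes "hermitian_mat H"
  shows "cnj (herm H v w) = herm H w v"
proof -
  have "cnj (H $ i $ j) = H $ j $ i" for i j
    using assms unfolding hermitian_mat_def by metis
  then have "cnj (herm H v w) = (\<Sum>i\<in>UNIV. \<Sum>j\<in>UNIV. H $ j $ i * w $ j * cnj (v $ i))"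
    by (simp add: herm_def mult_ac)
  also have "\<dots> = herm H w v"
    unfolding herm_def by (rule sum.swap)
  finally show ?thesis .
qed

lemma herm_self_real: "hermitian_mat H \<Longrightarrow> herm H v v = of_real (Re (herm H v v))"
  using cnj_herm[of H v v] by (simp add: complex_eq_iff)

lemma hermitian_mat_pullback_form: "hermitian_mat H \<Longrightarrow> hermitian_mat (pullback_form J H)"
  unfolding hermitian_mat_def[of "pullback_form J H"] pullback_form_nth by (simp add: cnj_herm)

lemma herm_self_pos: "hermitian_posdef H \<Longrightarrow> v \<noteq> 0 \<Longrightarrow> Re (herm H v v) > 0"
  by (simp add: hermitian_posdef_def)

lemma herm_self_nonneg: "hermitian_posdef H \<Longrightarrow> Re (herm H v v) \<ge> 0"
  using herm_self_pos[of H v] by (cases "v = 0") (auto intro: less_imp_le)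

lemma herm_norm_power2: "hermitian_posdef H \<Longrightarrow> (herm_norm H v)\<^sup>2 = Re (herm H v v)"
  by (simp add: herm_norm_def herm_self_nonneg)

lemma herm_nondegenerate:
  assumes "hermitian_posdef H" and "\<And>x. herm H v x = herm H w x"
  shows "v = w"
proof -
  have "herm H (v - w) (v - w) = 0"
    by (subst herm_diff_left) (simp only: assms(2) diff_self)
  then show ?thesis
    using herm_self_pos[OF assms(1), of "v - w"] by auto
qed

lemma continuous_on_herm [continuous_intros]:
  assumes "continuous_on S G" "continuous_on S v" "continuous_on S w"
  shows "continuous_on S (\<lambda>x. herm (G x) (v x) (w x))"
  unfolding herm_def by (intro continuous_intros assms)

lemma scaleR_eq_scale: "r *\<^sub>R (v :: complex^'m) = complex_of_real r *s v"
  unfolding vec_eq_iff vector_scaleR_component vector_smult_component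
  by (intro allI scaleR_conv_of_real)

lemma vec_subspace_imp_subspace: "vec.subspace S \<Longrightarrow> subspace (S :: (complex^'m) set)"
  unfolding subspace_def vec.subspace_def scaleR_eq_scale by blast

definition ortho_frame :: "complex^'m^'m \<Rightarrow> nat \<Rightarrow> (nat \<Rightarrow> complex^'m) \<Rightarrow> bool" where
  "ortho_frame G l E \<longleftrightarrow> (\<forall>i<l. \<forall>j<l. herm G (E i) (E j) = (if i = j then 1 else 0))"

lemma ortho_frameD: "ortho_frame G l E \<Longrightarrow> i < l \<Longrightarrow> j < l \<Longrightarrow> herm G (E i) (E j) = (if i = j then 1 else 0)"
  by (simp add: ortho_frame_def)

lemma ortho_frame_coeff:
  assumes "ortho_frame G l E" "i < l"
  shows "herm G (\<Sum>a<l. c a *s E a) (E i) = c i"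
proof -
  have "herm G (\<Sum>a<l. c a *s E a) (E i) = (\<Sum>a<l. if a = i then c a else 0)"
    unfolding herm_linear by (rule sum.cong) (use assms in \<open>auto simp: ortho_frame_def\<close>)
  then show ?thesis
    using assms(2) by simp
qed

lemma ortho_frame_expand:
  assumes E: "ortho_frame G l E" and v: "v \<in> vec.span (E ` {..<l})"
  shows "v = (\<Sum>a<l. herm G v (E a) *s E a)"
proof -
  have "\<exists>c. v = (\<Sum>a<l. c a *s E a)"
    using v
  proof (induction rule: vec.span_induct_alt)
    case base
    then show ?case by (intro exI[of _ "\<lambda>_. 0"]) simp
  next
    case (step c x y)
    obtain i d where i: "i < l" "x = E i" and d: "y = (\<Sum>a<l. d a *s E a)"
      using step by blast
    have "c *s x + y = (\<Sum>a<l. (if a = i then c *s x else 0) + d a *s E a)"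
      using i(1) by (simp add: sum.distrib d)
    also have "\<dots> = (\<Sum>a<l. ((if a = i then c else 0) + d a) *s E a)"
      using i(2) by (intro sum.cong refl) (simp add: vec.scale_left_distrib)
    finally show ?case by (rule exI[where x = "\<lambda>a. (if a = i then c else 0) + d a"])
  qed
  then obtain c where c: "v = (\<Sum>a<l. c a *s E a)" by blast
  then have "c a = herm G v (E a)" if "a < l" for a
    using ortho_frame_coeff[OF E that] by simp
  then have "(\<Sum>a<l. c a *s E a) = (\<Sum>a<l. herm G v (E a) *s E a)"
    by (intro sum.cong refl) simp
  from trans[OF c this] show ?thesis .
qed

lemma ortho_frame_zero_expand:
  assumes "ortho_frame G l E" "(\<Sum>a<l. c a *s E a) = 0" "a < l"
  shows "c a = 0"
  using ortho_frame_coeff[OF assms(1,3), of c] assms(2) by simp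

lemma ortho_frame_inj: "ortho_frame G l E \<Longrightarrow> inj_on E {..<l}"
  by (auto simp: inj_on_def ortho_frame_def) (metis zero_neq_one)

lemma ortho_frame_independent:
  assumes "ortho_frame G l E"
  shows "vec.independent (E ` {..<l})"
proof (rule vec.independent_if_scalars_zero)
  fix c x assume sum0: "(\<Sum>x\<in>E ` {..<l}. c x *s x) = 0" and x: "x \<in> E ` {..<l}"
  have "(\<Sum>a<l. c (E a) *s E a) = 0"
    using sum0 by (simp add: sum.reindex[OF ortho_frame_inj[OF assms]])
  then show "c x = 0"
    using ortho_frame_zero_expand[OF assms, of "\<lambda>a. c (E a)"] x by auto
qed simp

lemma ortho_frame_dim: "ortho_frame G l E \<Longrightarrow> vec.dim (vec.span (E ` {..<l})) = l"
  by (simp add: vec.dim_eq_card_independent ortho_frame_independent card_image ortho_frame_inj)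

lemma ortho_frame_span_eq:
  assumes "ortho_frame G l E" "E ` {..<l} \<subseteq> \<Sigma>" "vec.subspace \<Sigma>" "vec.dim \<Sigma> = l"
  shows "vec.span (E ` {..<l}) = \<Sigma>"
proof (rule vec.subspace_dim_equal)
  show "vec.span (E ` {..<l}) \<subseteq> \<Sigma>"
    using assms by (simp add: vec.span_minimal)
  show "vec.dim \<Sigma> \<le> vec.dim (vec.span (E ` {..<l}))"
    unfolding ortho_frame_dim[OF assms(1)] by (simp add: assms(4))
qed (use assms in auto)

text \<open>The difference of the two sides is the squared length of \<open>v\<close> minus its
  orthogonal projection. This inequality later pays for removing first order terms in the
  target.\<close>

lemma bessel:
  assumes G: "hermitian_posdef G" and E: "ortho_frame G l E"
  shows "(\<Sum>i<l. (cmod (herm G v (E i)))\<^sup>2) \<le> Re (herm G v v)"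
proof -
  let ?p = "\<Sum>i<l. herm G v (E i) *s E i"
  have c: "cnj (herm G x y) = herm G y x" for x y
    using G by (simp add: cnj_herm hermitian_posdef_imp_hermitian_mat)
  have 1: "herm G v ?p = of_real (\<Sum>i<l. (cmod (herm G v (E i)))\<^sup>2)"
    by (simp add: herm_linear complex_norm_square mult_ac del: of_real_power)
  have 2: "herm G ?p ?p = of_real (\<Sum>i<l. (cmod (herm G v (E i)))\<^sup>2)"
    unfolding herm_sum_right[of _ ?p] herm_scale_right
    by (subst sum.cong[OF refl], subst ortho_frame_coeff[OF E])
      (auto simp: complex_norm_square mult_ac simp del: of_real_power)
  have "herm G (v - ?p) (v - ?p) = herm G v v - herm G v ?p - (herm G ?p v - herm G ?p ?p)"
    unfolding herm_diff_left herm_diff_right by (simp only: algebra_simps)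
  also have "herm G ?p v = of_real (\<Sum>i<l. (cmod (herm G v (E i)))\<^sup>2)"
    unfolding c[of v, symmetric] 1 by simp
  finally have "Re (herm G (v - ?p) (v - ?p)) = Re (herm G v v) - (\<Sum>i<l. (cmod (herm G v (E i)))\<^sup>2)"
    using 1 2 by simp
  then show ?thesis
    using herm_self_nonneg[OF G, of "v - ?p"] by linarith
qed

lemma parseval:
  assumes G: "hermitian_posdef G" and E: "ortho_frame G l E" and v: "v \<in> vec.span (E ` {..<l})"
  shows "herm G v w = (\<Sum>i<l. herm G v (E i) * herm G (E i) w)"
proof -
  have "herm G v w = herm G (\<Sum>i<l. herm G v (E i) *s E i) w"
    by (rule arg_cong[OF ortho_frame_expand[OF E v], where f = "\<lambda>x. herm G x w"])
  also have "\<dots> = (\<Sum>i<l. herm G v (E i) * herm G (E i) w)"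
    by (simp add: herm_sum_left herm_scale_left)
  finally show ?thesis .
qed

text \<open>A term linear in \<open>s\<close> cannot stay below a quadratic one unless it vanishes;
  this turns maximality of a Rayleigh quotient into orthogonality.\<close>

lemma linear_le_quadratic_zero:
  fixes b :: complex and M :: real
  assumes "\<And>s. 2 * Re (cnj s * b) \<le> (cmod s)\<^sup>2 * M"
  shows "b = 0"
proof (rule ccontr)
  assume "b \<noteq> 0"
  \<comment> \<open>Small enough that \<open>e * M \<le> 1\<close>: testing with
    \<open>s = e * b\<close> then bounds \<open>2 * e * (cmod b)\<^sup>2\<close> by half of
    itself.\<close>
  define e where "e = 1 / (1 + \<bar>M\<bar>)"
  have e: "e > 0" "e * M \<le> 1"
    by (auto simp: e_def divide_simps)
  have "2 * (e * (cmod b)\<^sup>2) \<le> e\<^sup>2 * (cmod b)\<^sup>2 * M"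
  proof -
    have "Re (cnj (of_real e * b) * b) = e * (cmod b)\<^sup>2"
      unfolding cmod_power2 by (simp add: power2_eq_square algebra_simps)
    then show ?thesis
      using assms[of "of_real e * b"] e(1) by (simp add: norm_mult power_mult_distrib)
  qed
  also have "\<dots> = (e * M) * (e * (cmod b)\<^sup>2)"
    by (simp add: power2_eq_square)
  also have "\<dots> \<le> 1 * (e * (cmod b)\<^sup>2)"
    using e by (intro mult_right_mono) auto
  finally show False
    using e(1) \<open>b \<noteq> 0\<close> by simp
qed

text \<open>One step of Gram-Schmidt: a vector of \<open>\<Sigma>\<close> outside the span exists by
  dimension, and its projection is subtracted.\<close>

lemma exists_orthogonal_vector:
  assumes G: "hermitian_posdef G" and E: "ortho_frame G k E" and "E ` {..<k} \<subseteq> \<Sigma>"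
    and S: "vec.subspace \<Sigma>" and "k < vec.dim \<Sigma>"
  obtains v where "v \<in> \<Sigma>" "v \<noteq> 0" "\<And>i. i < k \<Longrightarrow> herm G v (E i) = 0"
proof -
  have "\<not> \<Sigma> \<subseteq> vec.span (E ` {..<k})"
  proof
    assume "\<Sigma> \<subseteq> vec.span (E ` {..<k})"
    then have "vec.dim \<Sigma> \<le> k"
      by (metis E ortho_frame_dim vec.dim_subset)
    then show False using assms by simp
  qed
  then obtain w where w: "w \<in> \<Sigma>" "w \<notin> vec.span (E ` {..<k})"
    by blast
  let ?p = "\<Sum>a<k. herm G w (E a) *s E a"
  have p: "?p \<in> vec.span (E ` {..<k})"
    by (intro vec.span_sum vec.span_scale vec.span_base) auto
  have "?p \<in> \<Sigma>"
    using assms(3) S by (intro vec.subspace_sum vec.subspace_scale) auto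
  show thesis
  proof
    show "w - ?p \<in> \<Sigma>"
      using w(1) \<open>?p \<in> \<Sigma>\<close> S by (rule vec.subspace_diff[rotated])
    show "w - ?p \<noteq> 0"
      using w(2) p by auto
    show "herm G (w - ?p) (E i) = 0" if "i < k" for i
      using ortho_frame_coeff[OF E that] by (simp add: herm_diff_left)
  qed
qed

text \<open>For nonempty \<open>K\<close> the constant is the minimum over the compact product of
  \<open>K\<close> and the unit sphere. Its uniformity in \<open>x\<close> later bounds all unitary
  frames over a coordinate ball at once.\<close>

lemma herm_coercive:
  fixes G :: "'x::topological_space \<Rightarrow> complex^'m^'m"
  assumes K: "compact K" and G: "continuous_on K G" "\<And>x. x \<in> K \<Longrightarrow> hermitian_posdef (G x)"
  obtains c where "c > 0" "\<And>x v. x \<in> K \<Longrightarrow> c * (norm v)\<^sup>2 \<le> Re (herm (G x) v v)"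
proof (cases "K = {}")
  case True
  then show ?thesis using that[of 1] by auto
next
  case False
  let ?K = "K \<times> sphere (0 :: complex^'m) 1"
  obtain v0 :: "complex^'m" where "norm v0 = 1"
    by (rule vector_choose_size[of 1]) simp
  then have ne: "?K \<noteq> {}"
    using False by (auto simp: sphere_def)
  have "continuous_on ?K (\<lambda>y. Re (herm (G (fst y)) (snd y) (snd y)))"
    by (intro continuous_intros continuous_on_compose2[OF G(1)]) auto
  from continuous_attains_inf[OF compact_Times[OF K compact_sphere] ne this]
  obtain y where y: "y \<in> ?K"
      "\<forall>x\<in>?K. Re (herm (G (fst y)) (snd y) (snd y)) \<le> Re (herm (G (fst x)) (snd x) (snd x))"
    by (rule bexE)
  let ?c = "Re (herm (G (fst y)) (snd y) (snd y))"
  show ?thesis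
  proof (rule that[of ?c])
    show "?c > 0"
      using y(1) G(2)[of "fst y"] by (intro herm_self_pos) auto
    fix x :: 'x and v :: "complex^'m"
    assume x: "x \<in> K"
    show "?c * (norm v)\<^sup>2 \<le> Re (herm (G x) v v)"
    proof (cases "v = 0")
      case False
      let ?u = "complex_of_real (inverse (norm v)) *s v"
      have "norm ?u = 1"
        using False unfolding scaleR_eq_scale[symmetric] by simp
      then have "?c \<le> Re (herm (G x) ?u ?u)"
        using bspec[OF y(2), of "(x, ?u)"] x by simp
      also have "\<dots> = Re (herm (G x) v v) / (norm v)\<^sup>2"
        by (simp add: herm_linear power2_eq_square divide_simps)
      finally show ?thesis
        using False by (simp add: divide_simps)
    qed simp
  qed
qed

text \<open>Spectral theorem by Rayleigh quotients: each vector maximizes \<open>B\<close> among the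
  \<open>G\<close>-unit vectors of \<open>\<Sigma>\<close> orthogonal to its predecessors. The
  greedy choice also gives the decreasing order, which singular values and the trace estimate
  need.\<close>

lemma diagonal_frame:
  fixes G B :: "complex^'m^'m"
  assumes G: "hermitian_posdef G" and B: "hermitian_mat B"
    and S: "vec.subspace \<Sigma>" "vec.dim \<Sigma> = l"
  obtains E where "ortho_frame G l E" "vec.span (E ` {..<l}) = \<Sigma>"
    "\<And>i j. i < l \<Longrightarrow> j < l \<Longrightarrow> i \<noteq> j \<Longrightarrow> herm B (E i) (E j) = 0"
    "\<And>i j. i \<le> j \<Longrightarrow> j < l \<Longrightarrow> Re (herm B (E j) (E j)) \<le> Re (herm B (E i) (E i))"
proof -
  let ?P = "\<lambda>E i v. v \<in> \<Sigma> \<and> (\<forall>j<i. herm G v (E j) = 0)"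
  have cG: "cnj (herm G x y) = herm G y x" and cB: "cnj (herm B x y) = herm B y x" for x y
    using G B by (simp_all add: cnj_herm hermitian_posdef_imp_hermitian_mat)
  have ex: "\<exists>E. ortho_frame G k E \<and> (\<forall>i<k. ?P E i (E i) \<and>
      (\<forall>v. ?P E i v \<longrightarrow> Re (herm B v v) \<le> Re (herm B (E i) (E i)) * Re (herm G v v)))" if "k \<le> l" for k
    using that
  proof (induction k)
    case 0
    then show ?case by (simp add: ortho_frame_def)
  next
    case (Suc k)
    then obtain E where E: "ortho_frame G k E" "\<And>i. i < k \<Longrightarrow> ?P E i (E i)"
      "\<And>i v. i < k \<Longrightarrow> ?P E i v \<Longrightarrow> Re (herm B v v) \<le> Re (herm B (E i) (E i)) * Re (herm G v v)"
      by (metis Suc_leD)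
    let ?C = "{v. ?P E k v \<and> Re (herm G v v) = 1}"
    have "E ` {..<k} \<subseteq> \<Sigma>"
      using E(2) by blast
    then obtain w where w: "w \<noteq> 0" "?P E k w"
      using exists_orthogonal_vector[OF G E(1) _ S(1)] Suc.prems S(2) by (metis Suc_le_lessD)
    \<comment> \<open>Normalization to \<open>G\<close>-length 1, by which the maximum on the
      compact set \<open>?C\<close> becomes the homogeneous inequality \<open>max\<close>.\<close>
    define u where "u x = complex_of_real (1 / sqrt (Re (herm G x x))) *s x" for x :: "complex^'m"
    have u: "Re (herm B (u x) (u x)) = Re (herm B x x) / Re (herm G x x)"
        "Re (herm G (u x) (u x)) = 1" if "x \<noteq> 0" for x
      using herm_self_pos[OF G that] by (simp_all add: u_def herm_linear real_div_sqrt field_simps)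
    have uP: "?P E k (u x)" if "?P E k x" for x
      using that S(1) unfolding u_def by (auto simp: herm_linear intro!: vec.subspace_scale)
    have "?C \<noteq> {}"
      using uP[OF w(2)] u(2)[OF w(1)] by blast
    obtain c where c: "c > 0" "\<And>v. c * (norm v)\<^sup>2 \<le> Re (herm G v v)"
      using herm_coercive[of "{0::real}" "\<lambda>_. G"] G
      by (metis compact_sing continuous_on_const singletonI)
    have "closed (\<Sigma> \<inter> (\<Inter>j\<in>{..<k}. {v. herm G v (E j) = 0}) \<inter> {v. Re (herm G v v) = 1})"
      by (intro closed_Int closed_INT closed_subspace vec_subspace_imp_subspace S ballI
          closed_Collect_eq continuous_intros)
    moreover have "\<Sigma> \<inter> (\<Inter>j\<in>{..<k}. {v. herm G v (E j) = 0}) \<inter> {v. Re (herm G v v) = 1} = ?C"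
      by auto
    moreover have "norm v \<le> sqrt (1 / c)" if "v \<in> ?C" for v
      using c(2)[of v] c(1) that by (intro real_le_rsqrt) (simp add: pos_le_divide_eq mult.commute)
    then have "bounded ?C"
      unfolding bounded_iff by blast
    ultimately have "compact ?C"
      by (simp add: compact_eq_bounded_closed)
    moreover have "continuous_on ?C (\<lambda>v. Re (herm B v v))"
      by (intro continuous_intros)
    note continuous_attains_sup[OF calculation \<open>?C \<noteq> {}\<close> this]
    then obtain e where e: "e \<in> ?C" "\<forall>v\<in>?C. Re (herm B v v) \<le> Re (herm B e e)"
      by (rule bexE)
    have max: "Re (herm B v v) \<le> Re (herm B e e) * Re (herm G v v)" if v: "?P E k v" for v
    proof (cases "v = 0")
      case False
      then have "Re (herm B v v) / Re (herm G v v) \<le> Re (herm B e e)"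
        using bspec[OF e(2), of "u v"] uP[OF v] u[OF False] by simp
      then show ?thesis
        using herm_self_pos[OF G False] by (simp add: field_simps)
    qed simp
    let ?E = "E(k := e)"
    have "ortho_frame G (Suc k) ?E"
      using E(1) e(1) cG[of e] herm_self_real[OF hermitian_posdef_imp_hermitian_mat[OF G], of e]
      unfolding ortho_frame_def by (auto simp: less_Suc_eq) (metis complex_cnj_zero)
    moreover have "?P ?E i (?E i) \<and>
        (\<forall>v. ?P ?E i v \<longrightarrow> Re (herm B v v) \<le> Re (herm B (?E i) (?E i)) * Re (herm G v v))" if "i < Suc k" for i
      using that E(2,3)[of i] e(1) max by (cases "i = k") auto
    ultimately show ?case by blast
  qed
  obtain E where E: "ortho_frame G l E" "\<And>i. i < l \<Longrightarrow> ?P E i (E i)"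
      "\<And>i v. i < l \<Longrightarrow> ?P E i v \<Longrightarrow> Re (herm B v v) \<le> Re (herm B (E i) (E i)) * Re (herm G v v)"
    using ex[of l] by auto
  have span: "vec.span (E ` {..<l}) = \<Sigma>"
    using E(2) S by (intro ortho_frame_span_eq[OF E(1)]) auto
  \<comment> \<open>For \<open>i < j\<close> the vector \<open>E i + s *s E j\<close> still competes
    with \<open>E i\<close>, so its gain of first order in \<open>s\<close>, namely the off-diagonal
    entry, must vanish.\<close>
  have diag: "herm B (E i) (E j) = 0" if "i < j" "j < l" for i j
  proof (rule linear_le_quadratic_zero)
    fix s :: complex
    let ?v = "E i + s *s E j"
    let ?\<beta> = "Re (herm B (E i) (E i))"
    have ij: "herm G (E i) (E j) = 0" "herm G (E j) (E i) = 0" "herm G (E i) (E i) = 1" "herm G (E j) (E j) = 1"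
      using E(1) that by (auto simp: ortho_frame_def)
    have "?P E i ?v"
      using E(1,2) that S(1) by (auto simp: herm_linear ortho_frame_def intro!: vec.subspace_add vec.subspace_scale)
    then have "Re (herm B ?v ?v) \<le> ?\<beta> * Re (herm G ?v ?v)"
      using E(3)[of i ?v] that by simp
    moreover have "Re (herm G ?v ?v) = 1 + (cmod s)\<^sup>2"
      unfolding cmod_power2 by (simp add: herm_linear ij power2_eq_square)
    moreover have "Re (herm B ?v ?v) = ?\<beta> + 2 * Re (cnj s * herm B (E i) (E j)) + (cmod s)\<^sup>2 * Re (herm B (E j) (E j))"
    proof -
      have "herm B ?v ?v = herm B (E i) (E i) + cnj s * herm B (E i) (E j)
          + cnj (cnj s * herm B (E i) (E j)) + of_real ((cmod s)\<^sup>2) * herm B (E j) (E j)"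
        unfolding complex_norm_square by (simp add: herm_linear cB algebra_simps)
      then show ?thesis
        by (simp del: of_real_power complex_cnj_mult)
    qed
    ultimately show "2 * Re (cnj s * herm B (E i) (E j)) \<le> (cmod s)\<^sup>2 * (?\<beta> - Re (herm B (E j) (E j)))"
      by (simp add: algebra_simps)
  qed
  show thesis
  proof (rule that[OF E(1) span])
    show "herm B (E i) (E j) = 0" if "i < l" "j < l" "i \<noteq> j" for i j
      using that diag[of i j] diag[of j i] cB[of "E j" "E i"] by (cases "i < j") auto
    show "Re (herm B (E j) (E j)) \<le> Re (herm B (E i) (E i))" if "i \<le> j" "j < l" for i j
    proof -
      have "?P E i (E j)"
        using E(1,2) that by (auto simp: ortho_frame_def)
      then have "Re (herm B (E j) (E j)) \<le> Re (herm B (E i) (E i)) * Re (herm G (E j) (E j))"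
        using that by (intro E(3)) auto
      then show ?thesis
        using E(1) that by (simp add: ortho_frame_def)
    qed
  qed
qed

section \<open>Exterior powers, singular values and volume ratio\<close>

abbreviation gram :: "complex^'m^'m \<Rightarrow> (nat \<Rightarrow> complex^'m) \<Rightarrow> nat \<Rightarrow> nat \<Rightarrow> complex" where
  "gram H V \<equiv> (\<lambda>i j. herm H (V i) (V j))"

lemma ndet_gram_combination:
  assumes "\<And>i. i < l \<Longrightarrow> V i = (\<Sum>a<l. C i a *s E a)"
  shows "ndet l (gram H V) = of_real ((cmod (ndet l C))\<^sup>2) * ndet l (gram H E)"
proof -
  have "ndet l (gram H V) = ndet l (\<lambda>i j. \<Sum>a<l. \<Sum>b<l. C i a * gram H E a b * cnj (C j b))"
  proof (rule ndet_cong)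
    fix i j assume ij: "i < l" "j < l"
    show "gram H V i j = (\<Sum>a<l. \<Sum>b<l. C i a * gram H E a b * cnj (C j b))"
      unfolding assms[OF ij(1)] assms[OF ij(2)] herm_sum_left herm_sum_right herm_scale_left
        herm_scale_right sum_distrib_left
      by (subst sum.swap) (simp only: mult_ac)
  qed
  then show ?thesis
    by (simp only: ndet_congruence)
qed

section \<open>Norms of decomposable multivectors\<close>

lemma sum_swap_3: "(\<Sum>i\<in>A. \<Sum>j\<in>B. \<Sum>k\<in>C. f i j k) = (\<Sum>k\<in>C. \<Sum>i\<in>A. \<Sum>j\<in>B. f i j k)"
proof -
  have "(\<Sum>i\<in>A. \<Sum>j\<in>B. \<Sum>k\<in>C. f i j k) = (\<Sum>i\<in>A. \<Sum>k\<in>C. \<Sum>j\<in>B. f i j k)"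
    by (rule sum.cong[OF refl], rule sum.swap)
  also have "\<dots> = (\<Sum>k\<in>C. \<Sum>i\<in>A. \<Sum>j\<in>B. f i j k)"
    by (rule sum.swap)
  finally show ?thesis .
qed

lemma prod_herm_expand:
  "(\<Prod>b<l. herm H (v b) (w b)) = (\<Sum>I\<in>multi_indices l. \<Sum>K\<in>multi_indices l.
     (\<Prod>b<l. H $ I b $ K b) * (\<Prod>b<l. v b $ I b) * cnj (\<Prod>b<l. w b $ K b))"
proof -
  have "(\<Prod>b<l. herm H (v b) (w b)) = (\<Sum>I\<in>multi_indices l. \<Prod>b<l. \<Sum>j\<in>UNIV. H $ I b $ j * v b $ I b * cnj (w b $ j))"
    unfolding herm_def multi_indices_def by (rule prod_sum_PiE) auto
  also have "\<dots> = (\<Sum>I\<in>multi_indices l. \<Sum>K\<in>multi_indices l. \<Prod>b<l. H $ I b $ K b * v b $ I b * cnj (w b $ K b))"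
    unfolding multi_indices_def by (rule sum.cong[OF refl], rule prod_sum_PiE) auto
  finally show ?thesis
    by (simp add: prod.distrib)
qed

text \<open>Expanding both wedges gives a double sum over permutations \<open>p\<close> and
  \<open>q\<close> of products of pairings. For each fixed \<open>p\<close> the sum over
  \<open>q\<close> is, up to \<open>sign p\<close>, the same determinant, and there are
  \<open>l!\<close> choices of \<open>p\<close>; this accounts for the factor \<open>1/l!\<close> in
  \<open>wedge_norm\<close>.\<close>

lemma wedge_inner:
  "(\<Sum>I\<in>multi_indices l. \<Sum>K\<in>multi_indices l. (\<Prod>b<l. H $ I b $ K b) * wedge l v I * cnj (wedge l w K)) =
     fact l * ndet l (\<lambda>i j. herm H (v i) (w j))"
proof -
  let ?P = "{p. p permutes {..<l}}"
  let ?f = "\<lambda>I K p q. of_int (sign p) * of_int (sign q) *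
      ((\<Prod>b<l. H $ I b $ K b) * (\<Prod>b<l. v (p b) $ I b) * cnj (\<Prod>b<l. w (q b) $ K b))"
  have "(\<Sum>I\<in>multi_indices l. \<Sum>K\<in>multi_indices l. (\<Prod>b<l. H $ I b $ K b) * wedge l v I * cnj (wedge l w K)) =
      (\<Sum>I\<in>multi_indices l. \<Sum>K\<in>multi_indices l. \<Sum>q\<in>?P. \<Sum>p\<in>?P. ?f I K p q)"
    unfolding wedge_def cnj_sum sum_distrib_left sum_distrib_right
    by (intro sum.cong refl) (simp add: mult_ac)
  also have "\<dots> = (\<Sum>q\<in>?P. \<Sum>p\<in>?P. \<Sum>I\<in>multi_indices l. \<Sum>K\<in>multi_indices l. ?f I K p q)"
    by (subst sum_swap_3, rule sum.cong[OF refl], rule sum_swap_3)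
  also have "\<dots> = (\<Sum>p\<in>?P. \<Sum>q\<in>?P. \<Sum>I\<in>multi_indices l. \<Sum>K\<in>multi_indices l. ?f I K p q)"
    by (rule sum.swap)
  also have "\<dots> = (\<Sum>p\<in>?P. \<Sum>q\<in>?P. of_int (sign p) * of_int (sign q) * (\<Prod>b<l. herm H (v (p b)) (w (q b))))"
    by (simp only: prod_herm_expand sum_distrib_left)
  also have "\<dots> = (\<Sum>p\<in>?P. of_int (sign p) * (\<Sum>q\<in>?P. of_int (sign q) * (\<Prod>b<l. herm H (v (p b)) (w (q b)))))"
    by (simp only: sum_distrib_left mult_ac)
  also have "\<dots> = (\<Sum>p\<in>?P. ndet l (\<lambda>i j. herm H (v i) (w j)))"
  proof (rule sum.cong[OF refl])
    fix p assume "p \<in> ?P"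
    then have "(\<Sum>q\<in>?P. of_int (sign q) * (\<Prod>b<l. herm H (v (p b)) (w (q b)))) =
        of_int (sign p) * ndet l (\<lambda>i j. herm H (v i) (w j))"
      using ndet_permute_rows[of p l "\<lambda>i j. herm H (v i) (w j)"] by simp
    then show "of_int (sign p) * (\<Sum>q\<in>?P. of_int (sign q) * (\<Prod>b<l. herm H (v (p b)) (w (q b)))) =
        ndet l (\<lambda>i j. herm H (v i) (w j))"
      by (simp add: mult.assoc[symmetric] of_int_mult[symmetric] del: of_int_mult)
  qed
  also have "\<dots> = fact l * ndet l (\<lambda>i j. herm H (v i) (w j))"
    by (simp add: card_permutations)
  finally show ?thesis .
qed

lemma wedge_norm_wedge: "wedge_norm l H (wedge l v) = sqrt (Re (ndet l (gram H v)))"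
proof -
  have "Re (complex_of_real (fact l) * z) = fact l * Re z" for z
    by (simp del: of_real_fact)
  then have "Re (fact l * z) = fact l * Re z" for z :: complex
    by simp
  then show ?thesis
    unfolding wedge_norm_def wedge_inner by simp
qed

text \<open>The vectors \<open>V i\<close> may be linearly dependent, so a basis of their span is
  first enlarged to exactly \<open>l\<close> independent vectors. Degenerate tuples thus need no
  separate treatment.\<close>

lemma exists_span_frame:
  fixes G :: "complex^'m^'m" and V :: "nat \<Rightarrow> complex^'m"
  assumes G: "hermitian_posdef G" and B: "hermitian_mat B" and l: "l \<le> CARD('m)"
  obtains E where "ortho_frame G l E" "\<And>i. i < l \<Longrightarrow> V i \<in> vec.span (E ` {..<l})"
    "\<And>i j. i < l \<Longrightarrow> j < l \<Longrightarrow> i \<noteq> j \<Longrightarrow> herm B (E i) (E j) = 0"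
proof -
  obtain b where b: "b \<subseteq> V ` {..<l}" "vec.independent b" "V ` {..<l} \<subseteq> vec.span b"
    by (rule vec.maximal_independent_subset)
  obtain c where c: "b \<subseteq> c" "vec.independent c" "UNIV \<subseteq> vec.span c"
    using vec.maximal_independent_subset_extend[OF subset_UNIV b(2)] by auto
  have "card c = CARD('m)"
    using c(2,3) by (metis top.extremum_uniqueI vec.dim_eq_card vec_dim_card vec.dim_UNIV vec.span_UNIV)
  moreover have "card b \<le> l"
    using card_mono[OF _ b(1)] card_image_le[of "{..<l}" V] by simp
  moreover have "finite c"
    using c(2) by (rule vec.finiteI_independent)
  ultimately obtain d where d: "b \<subseteq> d" "d \<subseteq> c" "card d = l"
    using exists_subset_between[of b l c] c(1) l by auto
  have "vec.independent d"
    using c(2) d(2) by (rule vec.independent_mono)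
  then have dim: "vec.dim (vec.span d) = l"
    by (simp add: vec.dim_eq_card_independent d(3))
  obtain E where "ortho_frame G l E" "vec.span (E ` {..<l}) = vec.span d"
    "\<And>i j. i < l \<Longrightarrow> j < l \<Longrightarrow> i \<noteq> j \<Longrightarrow> herm B (E i) (E j) = 0"
    using diagonal_frame[OF G B vec.subspace_span dim] by metis
  moreover have "V i \<in> vec.span d" if "i < l" for i
    using b(3) that vec.span_mono[OF d(1)] by blast
  ultimately show thesis
    using that by simp
qed

text \<open>The coefficients are taken with respect to \<open>G\<close>, so the factor is the same
  for every form \<open>H\<close> and cancels between the source and the target Gram
  determinants.\<close>

lemma gram_combination_ortho:
  assumes E: "ortho_frame G l E" and V: "\<And>i. i < l \<Longrightarrow> V i \<in> vec.span (E ` {..<l})"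
  shows "ndet l (gram H V) = of_real ((cmod (ndet l (\<lambda>i a. herm G (V i) (E a))))\<^sup>2) * ndet l (gram H E)"
  by (rule ndet_gram_combination, rule ortho_frame_expand[OF E V])

lemma ndet_gram_ortho: "ortho_frame G l E \<Longrightarrow> ndet l (gram G E) = 1"
  by (subst ndet_diag) (auto simp: ortho_frame_def)

text \<open>In a diagonalizing frame the determinant is a product of squared lengths. The frame
  supplies a nonnegative element of the set whose supremum is \<open>wedge_comass\<close>.\<close>

lemma ndet_pullback_nonneg_frame:
  fixes G :: "complex^'m^'m"
  assumes "hermitian_posdef G" "hermitian_posdef H" "l \<le> CARD('m)"
  obtains E where "ortho_frame G l E" "Re (ndet l (gram (pullback_form J H) E)) \<ge> 0"
proof -
  obtain E where E: "ortho_frame G l E" "\<And>i j. i < l \<Longrightarrow> j < l \<Longrightarrow> i \<noteq> j \<Longrightarrow> herm (pullback_form J H) (E i) (E j) = 0"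
    using exists_span_frame[OF assms(1) _ assms(3), of "pullback_form J H"] assms(2)
    by (metis hermitian_mat_pullback_form hermitian_posdef_imp_hermitian_mat)
  have "herm (pullback_form J H) v v = of_real (Re (herm (pullback_form J H) v v))" for v
    by (rule herm_self_real) (simp add: assms(2) hermitian_mat_pullback_form hermitian_posdef_imp_hermitian_mat)
  then have "ndet l (gram (pullback_form J H) E) = of_real (\<Prod>i<l. Re (herm (pullback_form J H) (E i) (E i)))"
    unfolding of_real_prod by (subst ndet_diag) (use E(2) in \<open>auto intro: prod.cong\<close>)
  then have "Re (ndet l (gram (pullback_form J H) E)) \<ge> 0"
    using assms(2) by (simp add: herm_pullback_form herm_self_nonneg prod_nonneg flip: of_real_prod)
  then show thesis
    using that E(1) by blast
qed

text \<open>For \<open>v\<close> expressed in a unitary frame, numerator and denominator carry the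
  same factor, so every quotient with a nonzero factor equals that of a unitary frame.\<close>

lemma wedge_comass_le:
  fixes G :: "complex^'m^'m" and H :: "complex^'n^'n"
  assumes G: "hermitian_posdef G" and H: "hermitian_posdef H" and l: "l \<le> CARD('m)"
    and bound: "\<And>E. ortho_frame G l E \<Longrightarrow> Re (ndet l (gram (pullback_form J H) E)) \<le> L"
  shows "(wedge_comass l G H J)\<^sup>2 \<le> L"
proof -
  let ?X = "{wedge_norm l H (wedge_map l J a) / wedge_norm l G a | a. (\<exists>v. a = wedge l v) \<and> a \<noteq> (\<lambda>I. 0)}"
  have wn: "wedge_norm l H (wedge_map l J (wedge l v)) = sqrt (Re (ndet l (gram (pullback_form J H) v)))" for v
    by (simp add: wedge_map_wedge wedge_norm_wedge herm_pullback_form)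
  have hm: "hermitian_mat (pullback_form J H)"
    using H by (simp add: hermitian_mat_pullback_form hermitian_posdef_imp_hermitian_mat)
  obtain E where E: "ortho_frame G l E" "Re (ndet l (gram (pullback_form J H) E)) \<ge> 0"
    using ndet_pullback_nonneg_frame[OF G H l] by blast
  have E1: "wedge_norm l G (wedge l E) = 1"
    by (simp add: wedge_norm_wedge ndet_gram_ortho[OF E(1)])
  have "wedge_norm l G (\<lambda>I. 0) = 0"
    by (simp add: wedge_norm_def)
  with E1 have "wedge l E \<noteq> (\<lambda>I. 0)"
    by auto
  with E1 have mem: "sqrt (Re (ndet l (gram (pullback_form J H) E))) \<in> ?X"
    unfolding wn[symmetric] by (intro CollectI exI[of _ "wedge l E"]) auto
  have L: "L \<ge> 0"
    using E bound by force
  have le: "x \<le> sqrt L" if "x \<in> ?X" for x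
  proof -
    from that obtain v where "x = wedge_norm l H (wedge_map l J (wedge l v)) / wedge_norm l G (wedge l v)"
      by blast
    then have x: "x = sqrt (Re (ndet l (gram (pullback_form J H) v))) / sqrt (Re (ndet l (gram G v)))"
      by (simp only: wn wedge_norm_wedge)
    obtain F where F: "ortho_frame G l F" "\<And>i. i < l \<Longrightarrow> v i \<in> vec.span (F ` {..<l})"
      by (rule exists_span_frame[OF G hm l, of v]) blast
    define c where "c = (cmod (ndet l (\<lambda>i a. herm G (v i) (F a))))\<^sup>2"
    have "ndet l (gram (pullback_form J H) v) = of_real c * ndet l (gram (pullback_form J H) F)"
         "ndet l (gram G v) = of_real c * ndet l (gram G F)"
      unfolding c_def by (rule gram_combination_ortho[OF F], simp)+
    then have "x = sqrt c * sqrt (Re (ndet l (gram (pullback_form J H) F))) / sqrt c"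
      by (simp add: x ndet_gram_ortho[OF F(1)] real_sqrt_mult)
    moreover have "sqrt (Re (ndet l (gram (pullback_form J H) F))) \<le> sqrt L"
      using bound[OF F(1)] by simp
    \<comment> \<open>If \<open>c = 0\<close>, division by zero makes \<open>x\<close> equal to 0;
      the bound then rests on \<open>0 \<le> L\<close>.\<close>
    ultimately show ?thesis
      using L by (cases "c = 0") auto
  qed
  have "wedge_comass l G H J \<le> sqrt L"
    unfolding wedge_comass_def by (rule cSup_least) (use mem le in auto)
  moreover have "wedge_comass l G H J \<ge> 0"
    unfolding wedge_comass_def
    using cSup_upper[OF mem] le E(2) by (meson bdd_aboveI order_trans real_sqrt_ge_zero)
  ultimately have "(wedge_comass l G H J)\<^sup>2 \<le> (sqrt L)\<^sup>2"
    by (rule power_mono)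
  then show ?thesis
    using L by simp
qed

section \<open>Determinants and contractions in a full unitary frame\<close>

lemma frame_matrix:
  fixes G :: "complex^'m^'m" and \<iota> :: "'m \<Rightarrow> nat"
  assumes E: "ortho_frame G CARD('m) E" and \<iota>: "bij_betw \<iota> UNIV {..<CARD('m)}"
  defines "P \<equiv> (\<chi> k a. E (\<iota> a) $ k)"
  shows "transpose P ** (G ** map_matrix cnj P) = mat 1"
    and "\<And>B. transpose P ** (B ** map_matrix cnj P) = (\<chi> a b. herm B (E (\<iota> a)) (E (\<iota> b)))"
proof -
  show *: "transpose P ** (B ** map_matrix cnj P) = (\<chi> a b. herm B (E (\<iota> a)) (E (\<iota> b)))" for B
    by (simp add: P_def vec_eq_iff matrix_matrix_mult_def transpose_def herm_def sum_distrib_left mult_ac)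
  have "\<iota> a < CARD('m)" for a
    using bij_betwE[OF \<iota>] by simp
  moreover have "\<iota> a = \<iota> b \<longleftrightarrow> a = b" for a b
    using \<iota> by (auto simp: bij_betw_def inj_def)
  ultimately show "transpose P ** (G ** map_matrix cnj P) = mat 1"
    using E unfolding * by (simp add: vec_eq_iff mat_def ortho_frame_def)
qed

lemma det_map_cnj: "det (map_matrix cnj A) = cnj (det A)"
  by (simp add: det_def)

lemma matrix_inv_eqI:
  fixes A B :: "'a::field^'m^'m"
  assumes "A ** B = mat 1"
  shows "matrix_inv A = B"
proof -
  have BA: "B ** A = mat 1"
    using assms by (rule matrix_left_right_inverse1)
  have "A ** matrix_inv A = mat 1"
    unfolding matrix_inv_def by (rule someI2[of _ B]) (simp_all add: assms BA)
  then have "B ** (A ** matrix_inv A) = B"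
    by (simp add: matrix_mul_rid)
  then show ?thesis
    by (simp add: matrix_mul_assoc BA matrix_mul_lid)
qed

lemma exists_index: obtains \<iota> :: "'m::finite \<Rightarrow> nat" where "bij_betw \<iota> UNIV {..<CARD('m)}"
  using ex_bij_betw_finite_nat[of "UNIV :: 'm set"] by (auto simp: lessThan_atLeast0)

text \<open>With the frame vectors as columns of a matrix \<open>P\<close>, unitarity reads
  \<open>transpose P ** (G ** map_matrix cnj P) = mat 1\<close>; moving one factor across inverts
  \<open>G\<close>.\<close>

lemma ginv_frame:
  fixes G :: "complex^'m^'m"
  assumes G: "ortho_frame G CARD('m) E"
  shows "ginv G $ p $ q = (\<Sum>a<CARD('m). E a $ p * cnj (E a $ q))"
proof -
  obtain \<iota> :: "'m \<Rightarrow> nat" where \<iota>: "bij_betw \<iota> UNIV {..<CARD('m)}"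
    by (rule exists_index)
  let ?P = "\<chi> k a. E (\<iota> a) $ k"
  have "(G ** map_matrix cnj ?P) ** transpose ?P = mat 1"
    using frame_matrix(1)[OF G \<iota>] by (rule matrix_left_right_inverse1)
  then have "matrix_inv G = map_matrix cnj ?P ** transpose ?P"
    by (intro matrix_inv_eqI) (simp add: matrix_mul_assoc)
  then have "ginv G $ p $ q = (\<Sum>a\<in>UNIV. E (\<iota> a) $ p * cnj (E (\<iota> a) $ q))"
    by (simp add: ginv_def transpose_def matrix_matrix_mult_def mult_ac)
  also have "\<dots> = (\<Sum>a<CARD('m). E a $ p * cnj (E a $ q))"
    by (rule sum.reindex_bij_betw[OF \<iota>])
  finally show ?thesis .
qed

lemma sum_swap_outer5:
  "(\<Sum>i\<in>A. \<Sum>j\<in>B. \<Sum>k\<in>C. \<Sum>l\<in>D. \<Sum>a\<in>S. f i j k l a) = (\<Sum>a\<in>S. \<Sum>i\<in>A. \<Sum>j\<in>B. \<Sum>k\<in>C. \<Sum>l\<in>D. f i j k l a)"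
proof -
  have "(\<Sum>i\<in>A. \<Sum>j\<in>B. \<Sum>k\<in>C. \<Sum>l\<in>D. \<Sum>a\<in>S. f i j k l a) = (\<Sum>i\<in>A. \<Sum>j\<in>B. \<Sum>a\<in>S. \<Sum>k\<in>C. \<Sum>l\<in>D. f i j k l a)"
    by (rule sum.cong[OF refl], rule sum.cong[OF refl], rule sum_swap_3)
  also have "\<dots> = (\<Sum>a\<in>S. \<Sum>i\<in>A. \<Sum>j\<in>B. \<Sum>k\<in>C. \<Sum>l\<in>D. f i j k l a)"
    by (rule sum_swap_3)
  finally show ?thesis .
qed

text \<open>Each \<open>ginv\<close> factor becomes a sum over the frame, so contracting with it is
  evaluation on frame vectors. This lets the Chern scalar curvature enter as the case of full
  frames.\<close>

lemma chern_scalar_eq_l_scalar: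
  fixes G :: "complex^'m \<Rightarrow> complex^'m^'m"
  assumes E: "ortho_frame (G z) CARD('m) E"
  shows "chern_scalar G z = l_scalar G z CARD('m) E"
proof -
  let ?R = "chern_comp G z"
  have "(\<Sum>i\<in>UNIV. \<Sum>j\<in>UNIV. \<Sum>k\<in>UNIV. \<Sum>l\<in>UNIV. ginv (G z) $ i $ j * ginv (G z) $ k $ l * ?R i j k l) =
      (\<Sum>i\<in>UNIV. \<Sum>j\<in>UNIV. \<Sum>k\<in>UNIV. \<Sum>l\<in>UNIV. \<Sum>a<CARD('m). \<Sum>b<CARD('m).
        ?R i j k l * E a $ i * cnj (E a $ j) * E b $ k * cnj (E b $ l))"
    unfolding ginv_frame[where G = "G z", OF E] sum_product
    unfolding sum_distrib_right by (simp only: mult_ac)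
  also have "\<dots> = (\<Sum>a<CARD('m). \<Sum>b<CARD('m). chern_R G z (E a) (E a) (E b) (E b))"
    unfolding chern_R_def by (subst sum_swap_outer5, rule sum.cong[OF refl], rule sum_swap_outer5)
  finally show ?thesis
    unfolding chern_scalar_def l_scalar_def by (rule arg_cong)
qed

text \<open>Passing to a unitary frame multiplies both determinants by the squared modulus of
  \<open>det ?P\<close>, which normalizes the denominator to 1.\<close>

lemma volume_ratio_eq:
  fixes G :: "complex^'m^'m" and H :: "complex^'n^'n"
  assumes G: "hermitian_posdef G" and H: "hermitian_posdef H"
  obtains E where "ortho_frame G CARD('m) E"
    "volume_ratio G H J = Re (ndet CARD('m) (gram (pullback_form J H) E))"
proof -
  let ?B = "pullback_form J H"
  have "hermitian_mat ?B"
    using H by (simp add: hermitian_mat_pullback_form hermitian_posdef_imp_hermitian_mat)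
  moreover have "vec.dim (UNIV :: (complex^'m) set) = CARD('m)"
    by (rule vec_dim_card)
  ultimately obtain E where E: "ortho_frame G CARD('m) E"
      "\<And>i j. i < CARD('m) \<Longrightarrow> j < CARD('m) \<Longrightarrow> i \<noteq> j \<Longrightarrow> herm ?B (E i) (E j) = 0"
    using diagonal_frame[OF G, of ?B UNIV "CARD('m)"] vec.subspace_UNIV by metis
  obtain \<iota> :: "'m \<Rightarrow> nat" where \<iota>: "bij_betw \<iota> UNIV {..<CARD('m)}"
    by (rule exists_index)
  let ?P = "\<chi> k a. E (\<iota> a) $ k"
  have \<iota>': "\<iota> a < CARD('m)" "\<iota> a = \<iota> b \<longleftrightarrow> a = b" for a b
    using \<iota> bij_betwE[OF \<iota>] by (auto simp: bij_betw_def inj_def)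
  have 1: "det ?P * (det G * cnj (det ?P)) = 1"
    using arg_cong[OF frame_matrix(1)[OF E(1) \<iota>], of det]
    by (simp add: det_mul det_transpose det_map_cnj)
  have "det ?P * (det ?B * cnj (det ?P)) = det (\<chi> a b. herm ?B (E (\<iota> a)) (E (\<iota> b)))"
    using arg_cong[OF frame_matrix(2)[OF E(1) \<iota>], of det ?B]
    by (simp add: det_mul det_transpose det_map_cnj)
  also have "\<dots> = (\<Prod>a\<in>UNIV. herm ?B (E (\<iota> a)) (E (\<iota> a)))"
    by (subst det_diagonal) (use E(2) \<iota>' in auto)
  also have "\<dots> = (\<Prod>a<CARD('m). herm ?B (E a) (E a))"
    by (rule prod.reindex_bij_betw[OF \<iota>])
  also have "\<dots> = ndet CARD('m) (gram ?B E)"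
    by (rule ndet_diag[symmetric]) (use E(2) in auto)
  finally have "det ?P * (det ?B * cnj (det ?P)) = ndet CARD('m) (gram ?B E)" .
  moreover have "det ?P \<noteq> 0" "det G \<noteq> 0"
    using 1 by auto
  then have "det ?B / det G = det ?P * (det ?B * cnj (det ?P)) / (det ?P * (det G * cnj (det ?P)))"
    by simp
  ultimately have "det ?B / det G = ndet CARD('m) (gram ?B E)"
    using 1 by (simp only: div_by_1)
  then show thesis
    using that E(1) by (simp add: volume_ratio_def)
qed

section \<open>Characteristic polynomials and singular values\<close>

lemma det_const_poly: "det (\<chi> i j. [:A $ i $ j:]) = [:det A:]" for A :: "complex^'m^'m"
proof -
  have prod: "(\<Prod>i\<in>S. [:f i:]) = [:\<Prod>i\<in>S. f i:]" for S :: "'m set" and f :: "'m \<Rightarrow> complex"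
    by (induction S rule: infinite_finite_induct) (simp_all add: one_pCons)
  have sum: "(\<Sum>i\<in>S. [:f i:]) = [:\<Sum>i\<in>S. f i:]" for S :: "('m \<Rightarrow> 'm) set" and f :: "('m \<Rightarrow> 'm) \<Rightarrow> complex"
    by (induction S rule: infinite_finite_induct) simp_all
  have "of_int k * [:c:] = [:of_int k * c:]" for k and c :: complex
    by (simp add: of_int_poly)
  then show ?thesis
    by (simp add: det_def prod sum)
qed

text \<open>The columns of \<open>P\<close> are eigenvectors. The relation
  \<open>?M ** ?P = ?P ** ?D\<close> holds over polynomials, and after taking determinants the
  nonzero constant \<open>det ?P\<close> cancels.\<close>

lemma charpoly_similar_diagonal:
  fixes A P :: "complex^'m^'m"
  assumes AP: "\<And>i j. (A ** P) $ i $ j = P $ i $ j * d j" and P: "det P \<noteq> 0"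
  shows "charpoly A = (\<Prod>j\<in>UNIV. [:- d j, 1:])"
proof -
  let ?M = "\<chi> i j. (if i = j then [:0, 1:] else 0) - [:A $ i $ j:]"
  let ?P = "\<chi> i j. [:P $ i $ j:]"
  let ?D = "(\<chi> i j. if i = j then [:- d j, 1:] else 0) :: complex poly^'m^'m"
  have sum: "(\<Sum>i\<in>S. [:f i:]) = [:\<Sum>i\<in>S. f i:]" for S :: "'m set" and f :: "'m \<Rightarrow> complex"
    by (induction S rule: infinite_finite_induct) simp_all
  have "?M ** ?P = ?P ** ?D"
  proof -
    have "(?M ** ?P) $ i $ j = (?P ** ?D) $ i $ j" for i j
    proof -
      have "(?M ** ?P) $ i $ j = (\<Sum>k\<in>UNIV. (if i = k then [:0, 1:] * [:P $ k $ j:] else 0) - [:A $ i $ k * P $ k $ j:])"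
        by (simp add: matrix_matrix_mult_def left_diff_distrib if_distrib[of "\<lambda>x. x * _"] cong: if_cong)
           (intro sum.cong refl, simp)
      also have "\<dots> = [:0, 1:] * [:P $ i $ j:] - [:(A ** P) $ i $ j:]"
        unfolding sum_subtractf sum by (simp add: matrix_matrix_mult_def)
      also have "\<dots> = [:P $ i $ j:] * [:- d j, 1:]"
        by (simp add: AP)
      also have "\<dots> = (?P ** ?D) $ i $ j"
        by (simp add: matrix_matrix_mult_def if_distrib[of "\<lambda>x. _ * x"] cong: if_cong)
      finally show ?thesis .
    qed
    then show ?thesis
      unfolding vec_eq_iff by blast
  qed
  then have "det ?M * det ?P = det ?P * det ?D"
    unfolding det_mul[symmetric] by (rule arg_cong)
  moreover have "det ?P \<noteq> 0"
    using P by (simp add: det_const_poly)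
  ultimately have "det ?M = det ?D"
    by (simp add: mult.commute)
  also have "det ?D = (\<Prod>j\<in>UNIV. [:- d j, 1:])"
    by (subst det_diagonal) auto
  finally show ?thesis
    by (simp add: charpoly_def)
qed

text \<open>A unitary frame diagonalizing the pull-back form consists of eigenvectors of the adjoint
  times \<open>J\<close>, and the diagonal entries are the eigenvalues. A frame chosen with
  decreasing entries therefore lists the singular values in the order required.\<close>

lemma sigma_l_eq:
  fixes G :: "complex^'m^'m" and H :: "complex^'n^'n"
  assumes G: "hermitian_posdef G" and H: "hermitian_posdef H" and l: "l \<le> CARD('m)"
  obtains E where "ortho_frame G l E"
    "sigma_l l G H J = (\<Sum>i<l. Re (herm (pullback_form J H) (E i) (E i)))"
proof -
  let ?B = "pullback_form J H" and ?A = "adjoint_mat G H J ** J"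
  have hB: "hermitian_mat ?B"
    using H by (simp add: hermitian_mat_pullback_form hermitian_posdef_imp_hermitian_mat)
  have hG: "hermitian_mat G"
    using G by (rule hermitian_posdef_imp_hermitian_mat)
  have "vec.dim (UNIV :: (complex^'m) set) = CARD('m)"
    by (rule vec_dim_card)
  then obtain E where E: "ortho_frame G CARD('m) E" "vec.span (E ` {..<CARD('m)}) = UNIV"
      "\<And>i j. i < CARD('m) \<Longrightarrow> j < CARD('m) \<Longrightarrow> i \<noteq> j \<Longrightarrow> herm ?B (E i) (E j) = 0"
      "\<And>i j. i \<le> j \<Longrightarrow> j < CARD('m) \<Longrightarrow> Re (herm ?B (E j) (E j)) \<le> Re (herm ?B (E i) (E i))"
    using diagonal_frame[OF G hB, of UNIV "CARD('m)"] vec.subspace_UNIV by metis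
  define \<mu> where "\<mu> i = Re (herm ?B (E i) (E i))" for i
  have \<mu>0: "\<mu> i \<ge> 0" for i
    using H by (simp add: \<mu>_def herm_pullback_form herm_self_nonneg)
  obtain \<iota> :: "'m \<Rightarrow> nat" where \<iota>: "bij_betw \<iota> UNIV {..<CARD('m)}"
    by (rule exists_index)
  have \<iota>': "\<iota> a < CARD('m)" for a
    using bij_betwE[OF \<iota>] by simp
  let ?P = "\<chi> k a. E (\<iota> a) $ k"
  have "det ?P * (det G * cnj (det ?P)) = 1"
    using arg_cong[OF frame_matrix(1)[OF E(1) \<iota>], of det]
    by (simp add: det_mul det_transpose det_map_cnj)
  then have P: "det ?P \<noteq> 0"
    by auto
  have eig: "?A *v E i = of_real (\<mu> i) *s E i" if i: "i < CARD('m)" for i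
  proof -
    have "herm G (?A *v E i) x = herm G (of_real (\<mu> i) *s E i) x" for x
    proof -
      have "herm G x (?A *v E i) = herm ?B x (E i)"
        using herm_adjoint_mat[OF G, of H J x "J *v E i"]
        by (simp add: herm_pullback_form matrix_vector_mul_assoc)
      also have "\<dots> = herm ?B (\<Sum>a<CARD('m). herm G x (E a) *s E a) (E i)"
        using ortho_frame_expand[OF E(1), of x] E(2) by (intro arg_cong[where f = "\<lambda>y. herm ?B y (E i)"]) simp
      also have "\<dots> = (\<Sum>a<CARD('m). if a = i then herm G x (E i) * herm ?B (E i) (E i) else 0)"
        unfolding herm_sum_left herm_scale_left by (rule sum.cong) (use E(3) i in auto)
      also have "\<dots> = herm G x (of_real (\<mu> i) *s E i)"
        using i by (simp add: herm_scale_right \<mu>_def cnj_herm[OF hB] flip: herm_self_real[OF hB])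
      finally have "cnj (herm G x (?A *v E i)) = cnj (herm G x (of_real (\<mu> i) *s E i))"
        by simp
      then show ?thesis
        by (simp only: cnj_herm[OF hG])
    qed
    then show ?thesis
      by (rule herm_nondegenerate[OF G])
  qed
  have "(?A ** ?P) $ i $ j = ?P $ i $ j * of_real (\<mu> (\<iota> j))" for i j
  proof -
    have "(?A ** ?P) $ i $ j = (?A *v E (\<iota> j)) $ i"
      by (simp add: matrix_matrix_mult_def[of ?A] matrix_vector_mult_def[of ?A])
    then show ?thesis
      by (simp add: eig[OF \<iota>'])
  qed
  then have "charpoly ?A = (\<Prod>j\<in>UNIV. [:- of_real (\<mu> (\<iota> j)), 1:])"
    using P by (rule charpoly_similar_diagonal)
  then have "proots (charpoly ?A) = (\<Sum>j\<in>UNIV. {#of_real (\<mu> (\<iota> j))#})"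
    by (simp add: proots_prod)
  also have "\<dots> = (\<Sum>j<CARD('m). {#of_real (\<mu> j)#})"
    by (rule sum.reindex_bij_betw[OF \<iota>])
  also have "\<dots> = mset (map (\<lambda>j. of_real (\<mu> j)) [0..<CARD('m)])"
    by (simp add: sum_unfold_sum_mset lessThan_atLeast0 mset_upt[symmetric] sum_mset_sum_list
        del: mset_upt flip: sum_mset.singleton)
  finally have "image_mset (\<lambda>t. sqrt (Re t)) (proots (charpoly ?A)) = mset (map (\<lambda>j. sqrt (\<mu> j)) [0..<CARD('m)])"
    by (simp add: image_mset.compositionality comp_def)
  \<comment> \<open>A multiset forgets order; reversing the decreasing list makes it ascending, so
    that \<open>sort\<close> leaves it alone.\<close>
  also have "\<dots> = mset (rev (map (\<lambda>j. sqrt (\<mu> j)) [0..<CARD('m)]))"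
    by (simp only: mset_rev)
  finally have "singular_values G H J = rev (sort (rev (map (\<lambda>j. sqrt (\<mu> j)) [0..<CARD('m)])))"
    unfolding singular_values_def by (simp only: sorted_list_of_multiset_mset)
  also have "sort (rev (map (\<lambda>j. sqrt (\<mu> j)) [0..<CARD('m)])) = rev (map (\<lambda>j. sqrt (\<mu> j)) [0..<CARD('m)])"
    by (rule sorted_sort_id) (use E(4) in \<open>auto simp: sorted_rev_iff_nth_mono \<mu>_def\<close>)
  finally have "singular_values G H J = map (\<lambda>j. sqrt (\<mu> j)) [0..<CARD('m)]"
    by simp
  then have "sigma_l l G H J = (\<Sum>i<l. \<mu> i)"
    using l \<mu>0 by (simp add: sigma_l_def)
  moreover have "ortho_frame G l E"
    using E(1) l by (simp add: ortho_frame_def)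
  ultimately show thesis
    using that by (simp add: \<mu>_def)
qed

section \<open>Gram determinants and traces under a change of tuple\<close>

lemma herm_axis_sum:
  "herm G v x = (\<Sum>k\<in>UNIV. v $ k * herm G (axis k 1) x)"
  "herm G x v = (\<Sum>k\<in>UNIV. cnj (v $ k) * herm G x (axis k 1))"
proof -
  have v: "v = (\<Sum>k\<in>UNIV. v $ k *s axis k 1)"
    by (rule basis_expansion[symmetric])
  show "herm G v x = (\<Sum>k\<in>UNIV. v $ k * herm G (axis k 1) x)"
    by (subst v) (simp only: herm_sum_left herm_scale_left)
  show "herm G x v = (\<Sum>k\<in>UNIV. cnj (v $ k) * herm G x (axis k 1))"
    by (subst v) (simp only: herm_sum_right herm_scale_right)
qed

text \<open>Diagonalizing the frame operator \<open>\<Sum>\<^sub>i \<langle>\<cdot>, V\<^sub>i\<rangle> V\<^sub>i\<close>, with eigenvalues \<open>\<gamma>\<^sub>a\<close>,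
  reduces the estimate to \<open>2 \<gamma> - \<gamma>\<^sup>2 \<le> 1\<close>.\<close>

lemma trace_le_ortho_frame:
  fixes G H :: "complex^'m^'m"
  assumes G: "hermitian_posdef G" and H: "\<And>v. Re (herm H v v) \<ge> 0" and l: "l \<le> CARD('m)"
  obtains E where "ortho_frame G l E"
    "Re ((\<Sum>i<l. 2 * herm H (V i) (V i)) - (\<Sum>i<l. \<Sum>j<l. herm G (V i) (V j) * herm H (V j) (V i)))
       \<le> (\<Sum>a<l. Re (herm H (E a) (E a)))"
proof -
  \<comment> \<open>The frame operator with an index lowered by \<open>G\<close>, written as a
    matrix so that \<open>exists_span_frame\<close> can diagonalize it.\<close>
  define B :: "complex^'m^'m" where
    "B = (\<chi> k q. \<Sum>i<l. herm G (axis k 1) (V i) * herm G (V i) (axis q 1))"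
  have hG: "hermitian_mat G"
    using G by (rule hermitian_posdef_imp_hermitian_mat)
  have B: "herm B v w = (\<Sum>i<l. herm G v (V i) * herm G (V i) w)" for v w
  proof -
    have "(\<Sum>i<l. herm G v (V i) * herm G (V i) w) =
        (\<Sum>i<l. \<Sum>k\<in>UNIV. \<Sum>q\<in>UNIV. v $ k * herm G (axis k 1) (V i) * (cnj (w $ q) * herm G (V i) (axis q 1)))"
      by (subst herm_axis_sum(1), subst herm_axis_sum(2)) (simp only: sum_product)
    also have "\<dots> = (\<Sum>k\<in>UNIV. \<Sum>q\<in>UNIV. \<Sum>i<l. v $ k * herm G (axis k 1) (V i) * (cnj (w $ q) * herm G (V i) (axis q 1)))"
      by (rule sum_swap_3[symmetric])
    also have "\<dots> = herm B v w"
      unfolding herm_def[of B] by (simp add: B_def sum_distrib_left sum_distrib_right mult_ac)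
    finally show ?thesis ..
  qed
  have "cnj (B $ k $ q) = B $ q $ k" for k q
    by (simp add: B_def cnj_herm[OF hG] mult_ac)
  then have hB: "hermitian_mat B"
    unfolding hermitian_mat_def by metis
  obtain E where E: "ortho_frame G l E" "\<And>i. i < l \<Longrightarrow> V i \<in> vec.span (E ` {..<l})"
      "\<And>i j. i < l \<Longrightarrow> j < l \<Longrightarrow> i \<noteq> j \<Longrightarrow> herm B (E i) (E j) = 0"
    by (rule exists_span_frame[OF G hB l, of V]) blast
  define \<gamma> where "\<gamma> a = Re (herm B (E a) (E a))" for a
  have B\<gamma>: "herm B (E a) (E b) = (if a = b then of_real (\<gamma> a) else 0)" if "a < l" "b < l" for a b
    using E(3)[OF that] herm_self_real[OF hB, of "E a"] by (auto simp: \<gamma>_def)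
  \<comment> \<open>Both sums in the claim are linear in the \<open>s a\<close>: the first has
    weights 2, the second weights \<open>\<gamma> a\<close>. Since \<open>s a\<close> itself is
    \<open>\<gamma> a\<close> times a diagonal entry of \<open>H\<close>, the weights combine to
    \<open>2 * \<gamma> a - (\<gamma> a)\<^sup>2\<close>.\<close>
  define s where "s a = (\<Sum>i<l. herm G (V i) (E a) * herm H (E a) (V i))" for a
  have s: "s a = of_real (\<gamma> a) * herm H (E a) (E a)" if a: "a < l" for a
  proof -
    have "herm H (E a) (V i) = (\<Sum>b<l. herm G (E b) (V i) * herm H (E a) (E b))" if "i < l" for i
    proof -
      have "herm H (E a) (V i) = herm H (E a) (\<Sum>b<l. herm G (V i) (E b) *s E b)"
        by (rule arg_cong[OF ortho_frame_expand[OF E(1) E(2)[OF that]]])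
      then show ?thesis
        by (simp add: herm_sum_right herm_scale_right cnj_herm[OF hG])
    qed
    then have "s a = (\<Sum>i<l. \<Sum>b<l. herm G (V i) (E a) * (herm G (E b) (V i) * herm H (E a) (E b)))"
      by (simp add: s_def sum_distrib_left)
    also have "\<dots> = (\<Sum>b<l. \<Sum>i<l. herm G (V i) (E a) * (herm G (E b) (V i) * herm H (E a) (E b)))"
      by (rule sum.swap)
    also have "\<dots> = (\<Sum>b<l. herm B (E b) (E a) * herm H (E a) (E b))"
      by (simp add: B sum_distrib_left sum_distrib_right mult_ac)
    also have "\<dots> = (\<Sum>b<l. if b = a then of_real (\<gamma> a) * herm H (E a) (E a) else 0)"
      by (rule sum.cong[OF refl]) (simp add: B\<gamma> a)
    finally show ?thesis
      using a by simp
  qed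
  have expand: "herm H (V i) (V i) = (\<Sum>a<l. herm G (V i) (E a) * herm H (E a) (V i))" if "i < l" for i
  proof -
    have "herm H (V i) (V i) = herm H (\<Sum>a<l. herm G (V i) (E a) *s E a) (V i)"
      by (rule arg_cong[OF ortho_frame_expand[OF E(1) E(2)[OF that]], where f = "\<lambda>x. herm H x (V i)"])
    then show ?thesis
      by (simp only: herm_sum_left herm_scale_left)
  qed
  have T1: "(\<Sum>i<l. 2 * herm H (V i) (V i)) = (\<Sum>a<l. 2 * s a)"
    unfolding s_def sum_distrib_left[symmetric]
    by (subst sum.swap) (use expand in simp)
  have T2: "(\<Sum>i<l. \<Sum>j<l. herm G (V i) (V j) * herm H (V j) (V i)) = (\<Sum>a<l. of_real (\<gamma> a) * s a)"
  proof -
    have "(\<Sum>j<l. herm G (V i) (V j) * herm H (V j) (V i)) =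
        (\<Sum>a<l. of_real (\<gamma> a) * (herm G (V i) (E a) * herm H (E a) (V i)))" if i: "i < l" for i
    proof -
      have "(\<Sum>j<l. herm G (V i) (V j) * herm H (V j) (V i)) =
          (\<Sum>j<l. \<Sum>a<l. herm G (V i) (V j) * (herm G (V j) (E a) * herm H (E a) (V i)))"
      proof (rule sum.cong[OF refl])
        fix j assume "j \<in> {..<l}"
        then have j: "V j \<in> vec.span (E ` {..<l})"
          using E(2) by simp
        have "herm H (V j) (V i) = herm H (\<Sum>a<l. herm G (V j) (E a) *s E a) (V i)"
          by (rule arg_cong[OF ortho_frame_expand[OF E(1) j], where f = "\<lambda>x. herm H x (V i)"])
        then show "herm G (V i) (V j) * herm H (V j) (V i) =
            (\<Sum>a<l. herm G (V i) (V j) * (herm G (V j) (E a) * herm H (E a) (V i)))"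
          by (simp only: herm_sum_left herm_scale_left sum_distrib_left)
      qed
      also have "\<dots> = (\<Sum>a<l. \<Sum>j<l. herm G (V i) (V j) * (herm G (V j) (E a) * herm H (E a) (V i)))"
        by (rule sum.swap)
      also have "\<dots> = (\<Sum>a<l. herm B (V i) (E a) * herm H (E a) (V i))"
        unfolding B sum_distrib_right by (simp only: mult.assoc)
      also have "\<dots> = (\<Sum>a<l. of_real (\<gamma> a) * (herm G (V i) (E a) * herm H (E a) (V i)))"
      proof (rule sum.cong[OF refl])
        fix a assume a: "a \<in> {..<l}"
        have "herm B (V i) (E a) = herm B (\<Sum>b<l. herm G (V i) (E b) *s E b) (E a)"
          by (rule arg_cong[OF ortho_frame_expand[OF E(1) E(2)[OF i]], where f = "\<lambda>x. herm B x (E a)"])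
        also have "\<dots> = (\<Sum>b<l. if b = a then herm G (V i) (E a) * of_real (\<gamma> a) else 0)"
          unfolding herm_sum_left herm_scale_left
          by (rule sum.cong[OF refl]) (use a in \<open>simp add: B\<gamma>\<close>)
        finally show "herm B (V i) (E a) * herm H (E a) (V i) = of_real (\<gamma> a) * (herm G (V i) (E a) * herm H (E a) (V i))"
          using a by simp
      qed
      finally show ?thesis .
    qed
    then have "(\<Sum>i<l. \<Sum>j<l. herm G (V i) (V j) * herm H (V j) (V i)) =
        (\<Sum>i<l. \<Sum>a<l. of_real (\<gamma> a) * (herm G (V i) (E a) * herm H (E a) (V i)))"
      by simp
    also have "\<dots> = (\<Sum>a<l. \<Sum>i<l. of_real (\<gamma> a) * (herm G (V i) (E a) * herm H (E a) (V i)))"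
      by (rule sum.swap)
    finally show ?thesis
      by (simp only: s_def sum_distrib_left)
  qed
  have "Re (2 * s a) - Re (of_real (\<gamma> a) * s a) \<le> Re (herm H (E a) (E a))" if "a < l" for a
  proof -
    have "Re (2 * s a) - Re (of_real (\<gamma> a) * s a) = (2 * \<gamma> a - (\<gamma> a)\<^sup>2) * Re (herm H (E a) (E a))"
      by (simp add: s[OF that] power2_eq_square algebra_simps)
    also have "\<dots> \<le> 1 * Re (herm H (E a) (E a))"
      using zero_le_power2[of "\<gamma> a - 1"] H by (intro mult_right_mono) (simp_all add: power2_eq_square algebra_simps)
    finally show ?thesis by simp
  qed
  then have "(\<Sum>a<l. Re (2 * s a) - Re (of_real (\<gamma> a) * s a)) \<le> (\<Sum>a<l. Re (herm H (E a) (E a)))"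
    by (intro sum_mono) simp
  then show thesis
    using that[OF E(1)] by (simp only: T1 T2 Re_sum sum_subtractf minus_complex.sel)
qed

text \<open>The common factor is 1, as the same formula applied to \<open>G\<close> itself shows.
  Diagonalizing a maximizing frame inside its span hence keeps it maximizing.\<close>

lemma ndet_gram_same_span:
  assumes G: "hermitian_posdef G" and E: "ortho_frame G l E" and F: "ortho_frame G l F"
    and span: "vec.span (E ` {..<l}) = vec.span (F ` {..<l})"
  shows "ndet l (gram H E) = ndet l (gram H F)"
proof -
  have "E i \<in> vec.span (F ` {..<l})" if "i < l" for i
    unfolding span[symmetric] using that by (intro vec.span_base) simp
  then have *: "ndet l (gram B E) = of_real ((cmod (ndet l (\<lambda>i a. herm G (E i) (F a))))\<^sup>2) * ndet l (gram B F)" for B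
    by (rule gram_combination_ortho[OF F])
  have "of_real ((cmod (ndet l (\<lambda>i a. herm G (E i) (F a))))\<^sup>2) = (1 :: complex)"
    using *[of G] by (simp add: ndet_gram_ortho[OF E] ndet_gram_ortho[OF F])
  then show ?thesis
    using *[of H] by simp
qed

text \<open>The matrix of coefficients between two unitary bases is unitary, which is Parseval's
  identity for \<open>F b\<close> and \<open>F a\<close> in the basis \<open>E\<close>.\<close>

lemma trace_gram_same_span:
  assumes G: "hermitian_posdef G" and E: "ortho_frame G l E" and F: "ortho_frame G l F"
    and span: "vec.span (E ` {..<l}) = vec.span (F ` {..<l})"
  shows "(\<Sum>i<l. herm H (E i) (E i)) = (\<Sum>i<l. herm H (F i) (F i))"
proof -
  have hG: "hermitian_mat G"
    using G by (rule hermitian_posdef_imp_hermitian_mat)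
  have EF: "E i \<in> vec.span (F ` {..<l})" "F i \<in> vec.span (E ` {..<l})" if "i < l" for i
    using that span vec.span_base[of "E i" "E ` {..<l}"] vec.span_base[of "F i" "F ` {..<l}"] by auto
  let ?c = "\<lambda>i a. herm G (E i) (F a)"
  have "(\<Sum>i<l. herm H (E i) (E i)) = (\<Sum>i<l. \<Sum>a<l. \<Sum>b<l. ?c i a * cnj (?c i b) * herm H (F a) (F b))"
  proof (rule sum.cong[OF refl])
    fix i assume "i \<in> {..<l}"
    then have e: "E i = (\<Sum>a<l. ?c i a *s F a)"
      using ortho_frame_expand[OF F EF(1)] by simp
    have "herm H (E i) (E i) = herm H (\<Sum>a<l. ?c i a *s F a) (\<Sum>a<l. ?c i a *s F a)"
      by (rule arg_cong[OF e, where f = "\<lambda>x. herm H x x"])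
    then show "herm H (E i) (E i) = (\<Sum>a<l. \<Sum>b<l. ?c i a * cnj (?c i b) * herm H (F a) (F b))"
      by (simp only: herm_sum_left) (simp only: herm_sum_right herm_scale_left herm_scale_right sum_distrib_left mult_ac)
  qed
  also have "\<dots> = (\<Sum>a<l. \<Sum>b<l. \<Sum>i<l. ?c i a * cnj (?c i b) * herm H (F a) (F b))"
    by (rule sum_swap_3[symmetric])
  also have "\<dots> = (\<Sum>a<l. \<Sum>b<l. if b = a then herm H (F a) (F a) else 0)"
  proof (rule sum.cong[OF refl], rule sum.cong[OF refl])
    fix a b assume ab: "a \<in> {..<l}" "b \<in> {..<l}"
    have "(\<Sum>i<l. ?c i a * cnj (?c i b)) = herm G (F b) (F a)"
      using parseval[OF G E EF(2)[of b], of "F a"] ab by (simp add: cnj_herm[OF hG] mult.commute)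
    then show "(\<Sum>i<l. ?c i a * cnj (?c i b) * herm H (F a) (F b)) = (if b = a then herm H (F a) (F a) else 0)"
      using ab ortho_frameD[OF F] by (simp flip: sum_distrib_right)
  qed
  finally show ?thesis
    by simp
qed

section \<open>Second order expansions at the origin\<close>

text \<open>The coefficients of \<open>t\<^sup>2\<close> and of its conjugate are left unspecified: they do not
  contribute to the mixed coefficient \<open>q\<close> of a product.\<close>

definition jet :: "(complex \<Rightarrow> complex) \<Rightarrow> complex \<Rightarrow> complex \<Rightarrow> complex \<Rightarrow> complex \<Rightarrow> bool" where
  "jet u u0 a b q \<longleftrightarrow> (\<exists>p s. (\<lambda>t. u t - (u0 + (a * t + b * cnj t) + (p * t\<^sup>2 + q * (t * cnj t) + s * (cnj t)\<^sup>2)))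
     \<in> o[at 0](\<lambda>t. t\<^sup>2))"

lemma bigo_cnj_power: "(\<lambda>t. cnj t ^ n) \<in> O[F](\<lambda>t. t ^ n)"
  by (rule bigoI[of _ 1]) (simp add: norm_power)

lemma linear_bigo: "(\<lambda>t. a * t + b * cnj t) \<in> O[at 0](\<lambda>t. t)"
  using bigo_cnj_power[of 1 "at 0"] by (intro sum_in_bigo) simp_all

lemma quadratic_bigo: "(\<lambda>t. p * t\<^sup>2 + q * (t * cnj t) + s * (cnj t)\<^sup>2) \<in> O[at 0](\<lambda>t. t\<^sup>2)"
proof (intro sum_in_bigo)
  have "(\<lambda>t. t * cnj t) \<in> O[at 0](\<lambda>t. t * t)"
    using bigo_cnj_power[of 1 "at 0"] by (intro landau_o.big.mult) simp_all
  then show "(\<lambda>t. q * (t * cnj t)) \<in> O[at 0](\<lambda>t. t\<^sup>2)"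
    by (simp add: power2_eq_square)
  show "(\<lambda>t. s * (cnj t)\<^sup>2) \<in> O[at 0](\<lambda>t. t\<^sup>2)"
    using bigo_cnj_power[of 2 "at 0"] by simp
qed simp

lemma power_smallo_at_0:
  assumes "m < n"
  shows "(\<lambda>t::complex. t ^ n) \<in> o[at 0](\<lambda>t. t ^ m)"
proof (rule smalloI_tendsto)
  have "((\<lambda>t::complex. t ^ (n - m)) \<longlongrightarrow> 0 ^ (n - m)) (at 0)"
    by (intro tendsto_intros)
  moreover have "eventually (\<lambda>t::complex. t ^ n / t ^ m = t ^ (n - m)) (at 0)"
    unfolding eventually_at_filter using assms by (intro always_eventually) (auto simp: power_diff)
  ultimately show "((\<lambda>t::complex. t ^ n / t ^ m) \<longlongrightarrow> 0) (at 0)"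
    using assms by (simp add: zero_power tendsto_cong)
  show "eventually (\<lambda>t::complex. t ^ m \<noteq> 0) (at 0)"
    unfolding eventually_at_filter by (intro always_eventually) auto
qed

lemma jet_const: "jet (\<lambda>t. c) c 0 0 0"
  unfolding jet_def by (intro exI[of _ 0]) simp

lemma jet_add:
  assumes "jet u u0 a b q" "jet v v0 a' b' q'"
  shows "jet (\<lambda>t. u t + v t) (u0 + v0) (a + a') (b + b') (q + q')"
proof -
  obtain p s where u: "(\<lambda>t. u t - (u0 + (a * t + b * cnj t) + (p * t\<^sup>2 + q * (t * cnj t) + s * (cnj t)\<^sup>2))) \<in> o[at 0](\<lambda>t. t\<^sup>2)"
    using assms(1) unfolding jet_def by blast
  obtain p' s' where v: "(\<lambda>t. v t - (v0 + (a' * t + b' * cnj t) + (p' * t\<^sup>2 + q' * (t * cnj t) + s' * (cnj t)\<^sup>2))) \<in> o[at 0](\<lambda>t. t\<^sup>2)"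
    using assms(2) unfolding jet_def by blast
  show ?thesis
    unfolding jet_def
    using sum_in_smallo(1)[OF u v]
    by (intro exI[of _ "p + p'"] exI[of _ "s + s'"]) (simp add: algebra_simps)
qed

lemma jet_mult:
  assumes "jet u u0 a b q" "jet v v0 a' b' q'"
  shows "jet (\<lambda>t. u t * v t) (u0 * v0) (u0 * a' + a * v0) (u0 * b' + b * v0)
    (u0 * q' + q * v0 + (a * b' + b * a'))"
proof -
  define U1 where "U1 t = a * t + b * cnj t" for t
  define V1 where "V1 t = a' * t + b' * cnj t" for t
  obtain p s where "(\<lambda>t. u t - (u0 + (a * t + b * cnj t) + (p * t\<^sup>2 + q * (t * cnj t) + s * (cnj t)\<^sup>2))) \<in> o[at 0](\<lambda>t. t\<^sup>2)"
    using assms(1) unfolding jet_def by blast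
  moreover define U2 where "U2 t = p * t\<^sup>2 + q * (t * cnj t) + s * (cnj t)\<^sup>2" for t
  ultimately have u: "(\<lambda>t. u t - (u0 + U1 t + U2 t)) \<in> o[at 0](\<lambda>t. t\<^sup>2)"
    by (simp add: U1_def)
  obtain p' s' where "(\<lambda>t. v t - (v0 + (a' * t + b' * cnj t) + (p' * t\<^sup>2 + q' * (t * cnj t) + s' * (cnj t)\<^sup>2))) \<in> o[at 0](\<lambda>t. t\<^sup>2)"
    using assms(2) unfolding jet_def by blast
  moreover define V2 where "V2 t = p' * t\<^sup>2 + q' * (t * cnj t) + s' * (cnj t)\<^sup>2" for t
  ultimately have v: "(\<lambda>t. v t - (v0 + V1 t + V2 t)) \<in> o[at 0](\<lambda>t. t\<^sup>2)"
    by (simp add: V1_def)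
  have t1: "(\<lambda>t::complex. t) \<in> O[at 0](\<lambda>_. 1)" and t2: "(\<lambda>t::complex. t\<^sup>2) \<in> O[at 0](\<lambda>_. 1)"
    using power_smallo_at_0[of 0 1] power_smallo_at_0[of 0 2] by (auto intro: landau_o.small_imp_big)
  have 1: "U1 \<in> O[at 0](\<lambda>t. t)" "V1 \<in> O[at 0](\<lambda>t. t)"
      and 2: "U2 \<in> O[at 0](\<lambda>t. t\<^sup>2)" "V2 \<in> O[at 0](\<lambda>t. t\<^sup>2)"
    unfolding U1_def V1_def U2_def V2_def by (rule linear_bigo quadratic_bigo)+
  have V: "(\<lambda>t. v0 + V1 t + V2 t) \<in> O[at 0](\<lambda>_. 1)"
    by (intro sum_in_bigo landau_o.big_trans[OF 1(2) t1] landau_o.big_trans[OF 2(2) t2]) simp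
  have U: "(\<lambda>t. u0 + U1 t + U2 t) \<in> O[at 0](\<lambda>_. 1)"
    by (intro sum_in_bigo landau_o.big_trans[OF 1(1) t1] landau_o.big_trans[OF 2(1) t2]) simp
  have small2: "(\<lambda>t::complex. t\<^sup>2) \<in> o[at 0](\<lambda>_. 1)"
    using power_smallo_at_0[of 0 2] by simp
  have t12: "(\<lambda>t::complex. t * t\<^sup>2) \<in> o[at 0](\<lambda>t. t\<^sup>2)"
    using power_smallo_at_0[of 2 3] by (simp add: power3_eq_cube power2_eq_square mult.assoc)
  have t22: "(\<lambda>t::complex. t\<^sup>2 * t\<^sup>2) \<in> o[at 0](\<lambda>t. t\<^sup>2)"
    using power_smallo_at_0[of 2 4] by (simp flip: power_add)
  have t21: "(\<lambda>t::complex. t\<^sup>2 * t) \<in> o[at 0](\<lambda>t. t\<^sup>2)"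
    using t12 by (simp add: mult.commute)
  let ?ru = "\<lambda>t. u t - (u0 + U1 t + U2 t)" and ?rv = "\<lambda>t. v t - (v0 + V1 t + V2 t)"
  have "(\<lambda>t. (u0 + U1 t + U2 t) * ?rv t) \<in> o[at 0](\<lambda>t. 1 * t\<^sup>2)"
    by (rule landau_o.big_small_mult[OF U v])
  moreover have "(\<lambda>t. ?ru t * (v0 + V1 t + V2 t)) \<in> o[at 0](\<lambda>t. t\<^sup>2 * 1)"
    by (rule landau_o.small_big_mult[OF u V])
  moreover have "(\<lambda>t. ?ru t * ?rv t) \<in> o[at 0](\<lambda>t. t\<^sup>2 * t\<^sup>2)"
    by (rule landau_o.small_mult[OF u v])
  then have "(\<lambda>t. ?ru t * ?rv t) \<in> o[at 0](\<lambda>t. t\<^sup>2)"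
    by (rule landau_o.small_trans[OF _ t22])
  moreover have "(\<lambda>t. U1 t * V2 t) \<in> o[at 0](\<lambda>t. t\<^sup>2)"
    by (rule landau_o.big_small_trans[OF landau_o.big.mult[OF 1(1) 2(2)] t12])
  moreover have "(\<lambda>t. U2 t * V1 t) \<in> o[at 0](\<lambda>t. t\<^sup>2)"
    by (rule landau_o.big_small_trans[OF landau_o.big.mult[OF 2(1) 1(2)] t21])
  moreover have "(\<lambda>t. U2 t * V2 t) \<in> o[at 0](\<lambda>t. t\<^sup>2)"
    by (rule landau_o.big_small_trans[OF landau_o.big.mult[OF 2(1) 2(2)] t22])
  \<comment> \<open>Everything in the product beyond second order: the terms containing a remainder,
    and the products of \<open>U1\<close>, \<open>U2\<close> with \<open>V1\<close>,
    \<open>V2\<close> of total degree at least three.\<close>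
  ultimately have "(\<lambda>t. (u0 + U1 t + U2 t) * ?rv t + ?ru t * (v0 + V1 t + V2 t) + ?ru t * ?rv t
      + U1 t * V2 t + U2 t * V1 t + U2 t * V2 t) \<in> o[at 0](\<lambda>t. t\<^sup>2)"
    by (intro sum_in_smallo) simp_all
  then have "(\<lambda>t. u t * v t - (u0 * v0 + (u0 * V1 t + U1 t * v0) + (u0 * V2 t + U1 t * V1 t + U2 t * v0))) \<in> o[at 0](\<lambda>t. t\<^sup>2)"
    by (simp add: algebra_simps)
  then show ?thesis
    unfolding jet_def
    by (intro exI[of _ "u0 * p' + a * a' + p * v0"] exI[of _ "u0 * s' + b * b' + s * v0"])
       (simp add: U1_def V1_def U2_def V2_def algebra_simps power2_eq_square)
qed

lemma jet_cnj:
  assumes "jet u u0 a b q"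
  shows "jet (\<lambda>t. cnj (u t)) (cnj u0) (cnj b) (cnj a) (cnj q)"
proof -
  obtain p s where u: "(\<lambda>t. u t - (u0 + (a * t + b * cnj t) + (p * t\<^sup>2 + q * (t * cnj t) + s * (cnj t)\<^sup>2))) \<in> o[at 0](\<lambda>t. t\<^sup>2)"
    using assms(1) unfolding jet_def by blast
  have "(\<lambda>t. cnj (u t - (u0 + (a * t + b * cnj t) + (p * t\<^sup>2 + q * (t * cnj t) + s * (cnj t)\<^sup>2)))) \<in> o[at 0](\<lambda>t. t\<^sup>2)"
    using u by (simp only: smallo_def mem_Collect_eq complex_mod_cnj)
  then show ?thesis
    unfolding jet_def by (intro exI[of _ "cnj s"] exI[of _ "cnj p"]) (simp add: algebra_simps)
qed

lemma jet_cmult: "jet u u0 a b q \<Longrightarrow> jet (\<lambda>t. c * u t) (c * u0) (c * a) (c * b) (c * q)"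
  using jet_mult[OF jet_const[of c], of u u0 a b q] by simp

lemma jet_sum:
  assumes "\<And>i. i \<in> A \<Longrightarrow> jet (u i) (u0 i) (a i) (b i) (q i)"
  shows "jet (\<lambda>t. \<Sum>i\<in>A. u i t) (\<Sum>i\<in>A. u0 i) (\<Sum>i\<in>A. a i) (\<Sum>i\<in>A. b i) (\<Sum>i\<in>A. q i)"
  using assms
  by (induction A rule: infinite_finite_induct) (auto intro: jet_const jet_add)

text \<open>Without first order terms no two factors interact, so the mixed coefficient follows the
  Leibniz rule alone.\<close>

lemma jet_prod:
  assumes "finite A" "\<And>i. i \<in> A \<Longrightarrow> jet (u i) (u0 i) 0 0 (q i)"
  shows "jet (\<lambda>t. \<Prod>i\<in>A. u i t) (\<Prod>i\<in>A. u0 i) 0 0 (\<Sum>i\<in>A. q i * (\<Prod>j\<in>A - {i}. u0 j))"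
  using assms
proof (induction A rule: finite_induct)
  case empty
  then show ?case by (simp add: jet_const)
next
  case (insert x A)
  have "(\<Sum>i\<in>A. q i * (\<Prod>j\<in>insert x A - {i}. u0 j)) = (\<Sum>i\<in>A. u0 x * (q i * (\<Prod>j\<in>A - {i}. u0 j)))"
  proof (rule sum.cong[OF refl])
    fix i assume "i \<in> A"
    then have "insert x A - {i} = insert x (A - {i})"
      using insert.hyps by auto
    then show "q i * (\<Prod>j\<in>insert x A - {i}. u0 j) = u0 x * (q i * (\<Prod>j\<in>A - {i}. u0 j))"
      using insert.hyps by simp
  qed
  moreover have "insert x A - {x} = A"
    using insert.hyps by auto
  ultimately show ?case
    using jet_mult[OF insert.prems[of x] insert.IH[OF insert.prems]] insert.hyps
    by (simp add: sum_distrib_left add.commute)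
qed

text \<open>On the ray \<open>t = r * w\<close> one has \<open>t * cnj t = r\<^sup>2\<close>, so
  \<open>q\<close> enters independently of the direction. The numbers \<open>p\<close> and
  \<open>s\<close> are common to all directions, which allows averaging.\<close>

lemma jet_ray_limit:
  assumes "jet u u0 a b q"
  obtains p s where "\<And>w. cmod w = 1 \<Longrightarrow>
    ((\<lambda>r. (u (of_real r * w) - u0 - of_real r * (a * w + b * cnj w)) / of_real (r\<^sup>2)) \<longlongrightarrow> p * w\<^sup>2 + q + s * (cnj w)\<^sup>2) (at_right 0)"
proof -
  obtain p s where u: "(\<lambda>t. u t - (u0 + (a * t + b * cnj t) + (p * t\<^sup>2 + q * (t * cnj t) + s * (cnj t)\<^sup>2))) \<in> o[at 0](\<lambda>t. t\<^sup>2)"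
    using assms unfolding jet_def by blast
  show thesis
  proof
    fix w :: complex
    assume w: "cmod w = 1"
    let ?R = "\<lambda>t. u t - (u0 + (a * t + b * cnj t) + (p * t\<^sup>2 + q * (t * cnj t) + s * (cnj t)\<^sup>2))"
    have "((\<lambda>r. of_real r * w) \<longlongrightarrow> of_real 0 * w) (at_right 0)"
      by (intro tendsto_intros)
    then have "filterlim (\<lambda>r. of_real r * w) (at 0) (at_right 0)"
      using w by (intro filterlim_atI) (auto simp: eventually_at_filter intro!: always_eventually)
    from filterlim_compose[OF smalloD_tendsto[OF u] this]
    have "((\<lambda>r. ?R (of_real r * w) / (of_real r * w)\<^sup>2 * w\<^sup>2 + (p * w\<^sup>2 + q + s * (cnj w)\<^sup>2)) \<longlongrightarrow>
        0 * w\<^sup>2 + (p * w\<^sup>2 + q + s * (cnj w)\<^sup>2)) (at_right 0)"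
      by (intro tendsto_intros)
    moreover have "eventually (\<lambda>r. ?R (of_real r * w) / (of_real r * w)\<^sup>2 * w\<^sup>2 + (p * w\<^sup>2 + q + s * (cnj w)\<^sup>2) =
        (u (of_real r * w) - u0 - of_real r * (a * w + b * cnj w)) / of_real (r\<^sup>2)) (at_right 0)"
      unfolding eventually_at_filter
    proof (intro always_eventually allI impI)
      fix r :: real assume r: "r \<noteq> 0"
      define t where "t = of_real r * w"
      have "w \<noteq> 0"
        using w by auto
      then have 1: "?R t / t\<^sup>2 * w\<^sup>2 = ?R t / of_real (r\<^sup>2)"
        using r by (simp add: t_def power_mult_distrib)
      have "t * cnj t = of_real (r\<^sup>2)"
        using w unfolding complex_norm_square[symmetric] by (simp add: t_def norm_mult)
      then have "p * t\<^sup>2 + q * (t * cnj t) + s * (cnj t)\<^sup>2 = of_real (r\<^sup>2) * (p * w\<^sup>2 + q + s * (cnj w)\<^sup>2)"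
        unfolding t_def by (simp add: power_mult_distrib algebra_simps)
      then have 2: "p * w\<^sup>2 + q + s * (cnj w)\<^sup>2 = (p * t\<^sup>2 + q * (t * cnj t) + s * (cnj t)\<^sup>2) / of_real (r\<^sup>2)"
        using r by simp
      have 3: "of_real r * (a * w + b * cnj w) = a * t + b * cnj t"
        by (simp add: t_def algebra_simps)
      show "?R (of_real r * w) / (of_real r * w)\<^sup>2 * w\<^sup>2 + (p * w\<^sup>2 + q + s * (cnj w)\<^sup>2) =
        (u (of_real r * w) - u0 - of_real r * (a * w + b * cnj w)) / of_real (r\<^sup>2)"
        unfolding t_def[symmetric] 1 2 3 add_divide_distrib[symmetric] by (intro arg_cong2[where f = "(/)"] refl) simp
    qed
    ultimately show "((\<lambda>r. (u (of_real r * w) - u0 - of_real r * (a * w + b * cnj w)) / of_real (r\<^sup>2)) \<longlongrightarrow> p * w\<^sup>2 + q + s * (cnj w)\<^sup>2) (at_right 0)"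
      by (simp add: tendsto_cong)
  qed
qed

text \<open>Averaging second differences over directions removes \<open>p\<close> and
  \<open>s\<close> and leaves \<open>q\<close>; the linear part of the real function is
  \<open>Re ((a + cnj b) * t)\<close>, whose vanishing is the first order condition.\<close>

lemma jet_local_max:
  assumes u: "jet u u0 a b q" and max: "eventually (\<lambda>t. Re (u t) \<le> Re u0) (at 0)"
  shows "Re q \<le> 0" and "a + cnj b = 0"
proof -
  let ?d = "\<lambda>w r. (u (of_real r * w) - u0 - of_real r * (a * w + b * cnj w)) / of_real (r\<^sup>2)"
  obtain p s where lim: "\<And>w. cmod w = 1 \<Longrightarrow> (?d w \<longlongrightarrow> p * w\<^sup>2 + q + s * (cnj w)\<^sup>2) (at_right 0)"
    by (rule jet_ray_limit[OF u]) (rule that)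
  have ray: "eventually (\<lambda>r. Re (u (of_real r * w)) \<le> Re u0) (at_right 0)" if "cmod w = 1" for w
  proof -
    have "((\<lambda>r. of_real r * w) \<longlongrightarrow> of_real 0 * w) (at_right 0)"
      by (intro tendsto_intros)
    then have "filterlim (\<lambda>r. of_real r * w) (at 0) (at_right 0)"
      using that by (intro filterlim_atI) (auto simp: eventually_at_filter intro!: always_eventually)
    with max show ?thesis
      by (rule eventually_compose_filterlim)
  qed
  have pos: "eventually (\<lambda>r::real. r > 0) (at_right 0)"
    by (simp add: eventually_at_right_less)
  have le: "Re ((a + cnj b) * w) \<le> 0" if w: "cmod w = 1" for w
  proof -
    have "((\<lambda>r. of_real r * ?d w r + (a * w + b * cnj w)) \<longlongrightarrow> of_real 0 * (p * w\<^sup>2 + q + s * (cnj w)\<^sup>2) + (a * w + b * cnj w)) (at_right 0)"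
      by (intro tendsto_intros lim w)
    then have "((\<lambda>r. Re (of_real r * ?d w r + (a * w + b * cnj w))) \<longlongrightarrow> Re (a * w + b * cnj w)) (at_right 0)"
      by (intro tendsto_Re) simp
    moreover have "eventually (\<lambda>r. Re (of_real r * ?d w r + (a * w + b * cnj w)) \<le> 0) (at_right 0)"
      using ray[OF w] pos
    proof eventually_elim
      case (elim r)
      have "of_real r * ?d w r + (a * w + b * cnj w) = (u (of_real r * w) - u0) / of_real r"
        using elim(2) by (simp add: power2_eq_square field_simps)
      then show ?case
        using elim by (simp add: divide_nonpos_pos)
    qed
    ultimately have "Re (a * w + b * cnj w) \<le> 0"
      by (intro tendsto_upperbound[of _ _ "at_right (0::real)"]) simp_all
    then show ?thesis
      by (simp add: algebra_simps)
  qed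
  show "a + cnj b = 0"
  proof (rule ccontr)
    assume nz: "a + cnj b \<noteq> 0"
    \<comment> \<open>The direction of steepest ascent, on which the linear part is
      \<open>cmod (a + cnj b)\<close>.\<close>
    let ?w = "cnj (a + cnj b) / of_real (cmod (a + cnj b))"
    have "cmod ?w = 1"
      using nz by (simp only: norm_divide complex_mod_cnj norm_of_real abs_norm_cancel divide_self norm_eq_zero not_False_eq_True)
    then have "Re ((a + cnj b) * ?w) \<le> 0"
      by (rule le)
    moreover have "(a + cnj b) * ?w = of_real (cmod (a + cnj b))"
      using nz by (simp add: complex_norm_square[symmetric] power2_eq_square del: complex_cnj_add)
    ultimately have "Re (of_real (cmod (a + cnj b))) \<le> 0"
      by (simp only:)
    then show False
      using nz by simp
  qed
  \<comment> \<open>The fourth roots of unity: the sums of \<open>w\<close>, \<open>cnj w\<close>,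
    \<open>w\<^sup>2\<close> and \<open>(cnj w)\<^sup>2\<close> over them vanish, so the first order
    term drops out of the sum as well.\<close>
  let ?W = "{1, \<i>, - 1, - \<i>}"
  have sumW: "(\<Sum>w\<in>?W. f w) = f 1 + f \<i> + f (- 1) + f (- \<i>)" for f :: "complex \<Rightarrow> complex"
    by (simp add: complex_eq_iff)
  have "((\<lambda>r. Re (\<Sum>w\<in>?W. ?d w r)) \<longlongrightarrow> Re (\<Sum>w\<in>?W. p * w\<^sup>2 + q + s * (cnj w)\<^sup>2)) (at_right 0)"
    by (intro tendsto_intros tendsto_Re lim) auto
  moreover have "(\<Sum>w\<in>?W. p * w\<^sup>2 + q + s * (cnj w)\<^sup>2) = 4 * q"
    unfolding sumW by simp
  moreover have "eventually (\<lambda>r. Re (\<Sum>w\<in>?W. ?d w r) \<le> 0) (at_right 0)"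
    using ray[of 1, simplified] ray[of \<i>, simplified] ray[of "- 1", simplified] ray[of "- \<i>", simplified] pos
  proof eventually_elim
    case (elim r)
    have "(\<Sum>w\<in>?W. ?d w r) = (\<Sum>w\<in>?W. u (of_real r * w) - u0) / of_real (r\<^sup>2)"
      unfolding sumW by (simp add: add_divide_distrib[symmetric] algebra_simps del: of_real_power)
    moreover have "Re (\<Sum>w\<in>?W. u (of_real r * w) - u0) \<le> 0"
      unfolding sumW using elim by simp
    ultimately show ?case
      by (simp only: Re_divide_of_real divide_nonpos_nonneg zero_le_power2)
  qed
  ultimately have "Re (4 * q) \<le> 0"
    by (intro tendsto_upperbound[of _ _ "at_right (0::real)"]) simp_all
  then show "Re q \<le> 0"
    by simp
qed

text \<open>Taylor's formula, with the first derivatives assumed differentiable at the origin only.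
  \<open>A2\<close> and \<open>B1\<close> are the two orders of mixed differentiation; only their
  mean enters, so no symmetry theorem is invoked.\<close>

lemma jet_C2:
  assumes u: "eventually (\<lambda>t. (u has_derivative (\<lambda>\<tau>. A t * \<tau> + B t * cnj \<tau>)) (at t)) (nhds 0)"
    and A: "(A has_derivative (\<lambda>\<tau>. A1 * \<tau> + A2 * cnj \<tau>)) (at 0)"
    and B: "(B has_derivative (\<lambda>\<tau>. B1 * \<tau> + B2 * cnj \<tau>)) (at 0)"
  shows "jet u (u 0) (A 0) (B 0) ((A2 + B1) / 2)"
proof -
  let ?R = "\<lambda>t. u t - (u 0 + (A 0 * t + B 0 * cnj t) + (A1 / 2 * t\<^sup>2 + (A2 + B1) / 2 * (t * cnj t) + B2 / 2 * (cnj t)\<^sup>2))"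
  have bound: "\<exists>\<delta>>0. \<forall>t. cmod t < \<delta> \<longrightarrow> cmod (F t - F 0 - (F1 * t + F2 * cnj t)) \<le> e * cmod t"
    if F: "(F has_derivative (\<lambda>\<tau>. F1 * \<tau> + F2 * cnj \<tau>)) (at 0)" and "e > 0" for F F1 F2 e
    using F \<open>e > 0\<close> unfolding has_derivative_at_alt by simp
  have "?R \<in> o[at 0](\<lambda>t. t\<^sup>2)"
  proof (rule landau_o.smallI)
    fix c :: real assume "c > 0"
    obtain \<delta>1 where \<delta>1: "\<delta>1 > 0" "\<And>t. cmod t < \<delta>1 \<Longrightarrow> (u has_derivative (\<lambda>\<tau>. A t * \<tau> + B t * cnj \<tau>)) (at t)"
      using u unfolding eventually_nhds_metric by (auto simp: dist_norm)
    obtain \<delta>2 where \<delta>2: "\<delta>2 > 0" "\<And>t. cmod t < \<delta>2 \<Longrightarrow> cmod (A t - A 0 - (A1 * t + A2 * cnj t)) \<le> c / 2 * cmod t"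
      using bound[OF A, of "c / 2"] \<open>c > 0\<close> by auto
    obtain \<delta>3 where \<delta>3: "\<delta>3 > 0" "\<And>t. cmod t < \<delta>3 \<Longrightarrow> cmod (B t - B 0 - (B1 * t + B2 * cnj t)) \<le> c / 2 * cmod t"
      using bound[OF B, of "c / 2"] \<open>c > 0\<close> by auto
    have "cmod (?R t) \<le> c * cmod (t\<^sup>2)" if t: "cmod t < min \<delta>1 (min \<delta>2 \<delta>3)" for t
    proof -
      let ?\<phi> = "\<lambda>s. ?R (of_real s * t)"
      \<comment> \<open>The derivative of the remainder along the segment. \<open>A2\<close> and
        \<open>B1\<close> appear unaveraged because \<open>cnj (s * t) * t\<close> equals
        \<open>(s * t) * cnj t\<close> for real \<open>s\<close>; each bracket is thus the first
        order remainder of \<open>A\<close> or of \<open>B\<close>.\<close>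
      let ?D = "\<lambda>s. (A (of_real s * t) - A 0 - (A1 * (of_real s * t) + A2 * cnj (of_real s * t))) * t
          + (B (of_real s * t) - B 0 - (B1 * (of_real s * t) + B2 * cnj (of_real s * t))) * cnj t"
      have st: "cmod (of_real s * t) < min \<delta>1 (min \<delta>2 \<delta>3)" "cmod (of_real s * t) \<le> cmod t"
        if "0 \<le> s" "s \<le> 1" for s
      proof -
        show "cmod (of_real s * t) \<le> cmod t"
          using that by (simp add: norm_mult mult_left_le_one_le)
        then show "cmod (of_real s * t) < min \<delta>1 (min \<delta>2 \<delta>3)"
          using t by linarith
      qed
      have D: "(?\<phi> has_vector_derivative ?D s) (at s)" if s: "0 \<le> s" "s \<le> 1" for s
      proof -
        have "((\<lambda>s. u (of_real s * t)) has_derivative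
            (\<lambda>x. A (of_real s * t) * (of_real x * t) + B (of_real s * t) * cnj (of_real x * t))) (at s)"
          by (rule has_derivative_compose[OF _ \<delta>1(2)])
             (use st(1)[OF s] in \<open>auto intro!: derivative_eq_intros\<close>)
        then have 1: "((\<lambda>s. u (of_real s * t)) has_vector_derivative
            (A (of_real s * t) * t + B (of_real s * t) * cnj t)) (at s)"
          unfolding has_vector_derivative_def by (simp add: scaleR_conv_of_real algebra_simps)
        define L where "L = A 0 * t + B 0 * cnj t"
        define Q where "Q = A1 / 2 * t\<^sup>2 + (A2 + B1) / 2 * (t * cnj t) + B2 / 2 * (cnj t)\<^sup>2"
        have 2: "((\<lambda>s. u 0 + s *\<^sub>R L + s\<^sup>2 *\<^sub>R Q) has_vector_derivative (L + (2 * s) *\<^sub>R Q)) (at s)"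
          by (auto intro!: derivative_eq_intros)
        have "u 0 + s *\<^sub>R L + s\<^sup>2 *\<^sub>R Q = u 0 + (A 0 * (of_real s * t) + B 0 * cnj (of_real s * t)) +
            (A1 / 2 * (of_real s * t)\<^sup>2 + (A2 + B1) / 2 * ((of_real s * t) * cnj (of_real s * t)) + B2 / 2 * (cnj (of_real s * t))\<^sup>2)" for s
          by (simp add: L_def Q_def scaleR_conv_of_real algebra_simps power2_eq_square)
        moreover have "?D s = A (of_real s * t) * t + B (of_real s * t) * cnj t - (L + (2 * s) *\<^sub>R Q)"
          by (simp add: L_def Q_def scaleR_conv_of_real field_simps power2_eq_square)
        ultimately show ?thesis
          using has_vector_derivative_diff[OF 1 2] by (simp only:)
      qed
      have "cmod (?D s) \<le> c * (cmod t)\<^sup>2" if s: "0 \<le> s" "s \<le> 1" for s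
      proof -
        have "cmod (?D s) \<le> c / 2 * cmod (of_real s * t) * cmod t + c / 2 * cmod (of_real s * t) * cmod t"
          using \<delta>2(2)[of "of_real s * t"] \<delta>3(2)[of "of_real s * t"] st(1)[OF s]
          by (intro order_trans[OF norm_triangle_ineq] add_mono)
             (simp_all only: norm_mult complex_mod_cnj min_less_iff_conj mult_right_mono norm_ge_zero)
        also have "\<dots> = c * (cmod (of_real s * t) * cmod t)"
          by simp
        also have "\<dots> \<le> c * (cmod t * cmod t)"
          using st(2)[OF s] \<open>c > 0\<close> by (intro mult_left_mono mult_right_mono) simp_all
        finally show ?thesis
          by (simp add: power2_eq_square)
      qed
      then have le: "cmod (?D s) \<le> c * (cmod t)\<^sup>2" if "0 < s" "s < 1" for s
        using that by simp
      have cont: "continuous_on {0..1} ?\<phi>"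
        by (intro continuous_at_imp_continuous_on ballI has_vector_derivative_continuous[OF D]) auto
      have "norm (?\<phi> 1 - ?\<phi> 0) \<le> (\<lambda>s. c * (cmod t)\<^sup>2 * s) 1 - (\<lambda>s. c * (cmod t)\<^sup>2 * s) 0"
      proof (rule differentiable_bound_general[OF _ cont])
        show "continuous_on {0..1} (\<lambda>s. c * (cmod t)\<^sup>2 * s)"
          by (intro continuous_intros)
        fix s :: real
        assume s: "0 < s" "s < 1"
        show "(?\<phi> has_vector_derivative ?D s) (at s)"
          by (rule D) (use s in auto)
        show "((\<lambda>s. c * (cmod t)\<^sup>2 * s) has_vector_derivative c * (cmod t)\<^sup>2) (at s)"
          by (auto intro!: derivative_eq_intros)
        show "norm (?D s) \<le> c * (cmod t)\<^sup>2"
          by (rule le[OF s])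
      qed simp
      then show ?thesis
        by (simp add: norm_power)
    qed
    then show "eventually (\<lambda>t. cmod (?R t) \<le> c * cmod (t\<^sup>2)) (at 0)"
      unfolding eventually_at
      by (intro exI[of _ "min \<delta>1 (min \<delta>2 \<delta>3)"]) (use \<delta>1(1) \<delta>2(1) \<delta>3(1) in \<open>auto simp: dist_norm\<close>)
  qed
  then show ?thesis
    unfolding jet_def by blast
qed

lemma jet_holomorphic:
  assumes "u holomorphic_on S" "open S" "0 \<in> S"
  shows "jet u (u 0) (deriv u 0) 0 0"
proof -
  have "eventually (\<lambda>t. t \<in> S) (nhds 0)"
    using assms by (intro eventually_nhds_in_open)
  then have 1: "eventually (\<lambda>t. (u has_derivative (\<lambda>\<tau>. deriv u t * \<tau> + 0 * cnj \<tau>)) (at t)) (nhds 0)"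
  proof eventually_elim
    case (elim t)
    then show ?case
      using holomorphic_derivI[OF assms(1,2)] by (simp add: has_field_derivative_def)
  qed
  have 2: "(deriv u has_derivative (\<lambda>\<tau>. deriv (deriv u) 0 * \<tau> + 0 * cnj \<tau>)) (at 0)"
    using holomorphic_derivI[OF holomorphic_deriv[OF assms(1,2)] assms(2,3)]
    by (simp add: has_field_derivative_def)
  have 3: "((\<lambda>_. 0) has_derivative (\<lambda>\<tau>. 0 * \<tau> + 0 * cnj \<tau>)) (at (0::complex))"
    by simp
  show ?thesis
    using jet_C2[OF 1 2 3] by simp
qed

section \<open>Curvature along a holomorphic curve\<close>

lemma frechet_derivative_wirtinger:
  fixes \<phi> :: "complex^'m \<Rightarrow> complex"
  assumes "\<phi> differentiable (at z)"
  shows "frechet_derivative \<phi> (at z) \<eta> = (\<Sum>i\<in>UNIV. \<eta> $ i * dz i \<phi> z + cnj (\<eta> $ i) * dzbar i \<phi> z)"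
proof -
  let ?D = "frechet_derivative \<phi> (at z)"
  have lin: "linear ?D"
    using assms by (rule linear_frechet_derivative)
  have "\<eta> = (\<Sum>i\<in>UNIV. Re (\<eta> $ i) *\<^sub>R axis i 1 + Im (\<eta> $ i) *\<^sub>R axis i \<i>)"
  proof -
    have "\<eta> = (\<Sum>i\<in>UNIV. \<eta> $ i *s axis i 1)"
      by (rule basis_expansion[symmetric])
    also have "\<dots> = (\<Sum>i\<in>UNIV. Re (\<eta> $ i) *\<^sub>R axis i 1 + Im (\<eta> $ i) *\<^sub>R axis i \<i>)"
    proof (rule sum.cong[OF refl])
      fix i
      show "\<eta> $ i *s axis i 1 = Re (\<eta> $ i) *\<^sub>R axis i 1 + Im (\<eta> $ i) *\<^sub>R axis i \<i>"
        unfolding vec_eq_iff by (simp add: axis_def complex_eq_iff)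
    qed
    finally show ?thesis .
  qed
  then have "?D \<eta> = ?D (\<Sum>i\<in>UNIV. Re (\<eta> $ i) *\<^sub>R axis i 1 + Im (\<eta> $ i) *\<^sub>R axis i \<i>)"
    by (rule arg_cong)
  also have "\<dots> = (\<Sum>i\<in>UNIV. Re (\<eta> $ i) *\<^sub>R ?D (axis i 1) + Im (\<eta> $ i) *\<^sub>R ?D (axis i \<i>))"
    by (simp add: linear_sum[OF lin] linear_add[OF lin] linear_scale[OF lin])
  also have "\<dots> = (\<Sum>i\<in>UNIV. \<eta> $ i * dz i \<phi> z + cnj (\<eta> $ i) * dzbar i \<phi> z)"
  proof (rule sum.cong[OF refl])
    fix i
    define x where "x = ?D (axis i 1)"
    define y where "y = ?D (axis i \<i>)"
    show "Re (\<eta> $ i) *\<^sub>R ?D (axis i 1) + Im (\<eta> $ i) *\<^sub>R ?D (axis i \<i>) =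
        \<eta> $ i * dz i \<phi> z + cnj (\<eta> $ i) * dzbar i \<phi> z"
      unfolding dz_def dzbar_def x_def[symmetric] y_def[symmetric]
      by (simp add: complex_eq_iff field_simps)
  qed
  finally show ?thesis .
qed

lemma frechet_derivative_line:
  fixes \<phi> :: "complex^'m \<Rightarrow> complex"
  assumes "\<phi> differentiable (at z)"
  shows "frechet_derivative \<phi> (at z) (\<tau> *s \<xi>) =
    (\<Sum>i\<in>UNIV. \<xi> $ i * dz i \<phi> z) * \<tau> + (\<Sum>i\<in>UNIV. cnj (\<xi> $ i) * dzbar i \<phi> z) * cnj \<tau>"
  unfolding frechet_derivative_wirtinger[OF assms] by (simp add: sum.distrib sum_distrib_left mult_ac)

text \<open>The acceleration \<open>\<gamma>dd\<close> of a holomorphic curve enters the unmixed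
  second order terms only. The mixed coefficient is therefore that of a straight line with the same
  velocity, which makes image curves as good as lines.\<close>

lemma jet_comp_curve:
  fixes \<phi> :: "complex^'m \<Rightarrow> complex" and \<gamma> :: "complex \<Rightarrow> complex^'m"
  assumes S: "open S" "\<gamma> 0 \<in> S"
    and \<phi>: "\<And>z. z \<in> S \<Longrightarrow> \<phi> differentiable (at z)"
    and d\<phi>: "\<And>v. (\<lambda>z. frechet_derivative \<phi> (at z) v) differentiable (at (\<gamma> 0))"
    and \<gamma>: "eventually (\<lambda>t. (\<gamma> has_derivative (\<lambda>\<tau>. \<tau> *s \<gamma>d t)) (at t)) (nhds 0)"
    and \<gamma>d: "(\<gamma>d has_derivative (\<lambda>\<tau>. \<tau> *s \<gamma>dd)) (at 0)"
  defines "\<xi> \<equiv> \<gamma>d 0"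
  shows "jet (\<lambda>t. \<phi> (\<gamma> t)) (\<phi> (\<gamma> 0)) (\<Sum>i\<in>UNIV. \<xi> $ i * dz i \<phi> (\<gamma> 0)) (\<Sum>i\<in>UNIV. cnj (\<xi> $ i) * dzbar i \<phi> (\<gamma> 0))
    (((\<Sum>i\<in>UNIV. \<Sum>j\<in>UNIV. \<xi> $ i * cnj (\<xi> $ j) * dzbar j (dz i \<phi>) (\<gamma> 0)) +
      (\<Sum>i\<in>UNIV. \<Sum>j\<in>UNIV. \<xi> $ i * cnj (\<xi> $ j) * dz i (dzbar j \<phi>) (\<gamma> 0))) / 2)"
proof -
  define A where "A t = (\<Sum>i\<in>UNIV. \<gamma>d t $ i * dz i \<phi> (\<gamma> t))" for t
  define B where "B t = (\<Sum>i\<in>UNIV. cnj (\<gamma>d t $ i) * dzbar i \<phi> (\<gamma> t))" for t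
  have \<gamma>0: "(\<gamma> has_derivative (\<lambda>\<tau>. \<tau> *s \<xi>)) (at 0)"
    unfolding \<xi>_def using \<gamma> by (rule eventually_nhds_x_imp_x)
  have "isCont \<gamma> 0"
    using \<gamma>0 by (rule has_derivative_continuous)
  then have "eventually (\<lambda>t. \<gamma> t \<in> S) (nhds 0)"
    unfolding isCont_def tendsto_at_iff_tendsto_nhds using S by (rule topological_tendstoD)
  then have u: "eventually (\<lambda>t. ((\<lambda>t. \<phi> (\<gamma> t)) has_derivative (\<lambda>\<tau>. A t * \<tau> + B t * cnj \<tau>)) (at t)) (nhds 0)"
    using \<gamma>
  proof eventually_elim
    case (elim t)
    have "(\<phi> has_derivative frechet_derivative \<phi> (at (\<gamma> t))) (at (\<gamma> t))"
      using \<phi>[OF elim(1)] by (simp add: frechet_derivative_works)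
    from has_derivative_compose[OF elim(2) this]
    show ?case
      unfolding A_def B_def frechet_derivative_line[OF \<phi>[OF elim(1)]] .
  qed
  have nth: "((\<lambda>t. \<gamma>d t $ i) has_derivative (\<lambda>\<tau>. \<tau> * \<gamma>dd $ i)) (at 0)" for i
    using bounded_linear.has_derivative[OF bounded_linear_vec_nth \<gamma>d, of i] by simp
  have comp: "((\<lambda>t. \<psi> (\<gamma> t)) has_derivative (\<lambda>\<tau>. (\<Sum>j\<in>UNIV. \<xi> $ j * dz j \<psi> (\<gamma> 0)) * \<tau> + (\<Sum>j\<in>UNIV. cnj (\<xi> $ j) * dzbar j \<psi> (\<gamma> 0)) * cnj \<tau>)) (at 0)"
    if "\<psi> differentiable (at (\<gamma> 0))" for \<psi>
  proof -
    have "(\<psi> has_derivative frechet_derivative \<psi> (at (\<gamma> 0))) (at (\<gamma> 0))"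
      using that by (simp add: frechet_derivative_works)
    from has_derivative_compose[OF \<gamma>0 this] show ?thesis
      unfolding frechet_derivative_line[OF that] .
  qed
  have diff: "dz i \<phi> differentiable (at (\<gamma> 0))" "dzbar i \<phi> differentiable (at (\<gamma> 0))" for i
    unfolding dz_def[abs_def] dzbar_def[abs_def]
    by (intro differentiable_add differentiable_diff differentiable_mult differentiable_const differentiable_divide d\<phi>; simp)+
  have dA: "(A has_derivative (\<lambda>\<tau>. (\<Sum>i\<in>UNIV. \<gamma>dd $ i * dz i \<phi> (\<gamma> 0) + (\<Sum>j\<in>UNIV. \<xi> $ i * (\<xi> $ j * dz j (dz i \<phi>) (\<gamma> 0)))) * \<tau> +
      (\<Sum>i\<in>UNIV. \<Sum>j\<in>UNIV. \<xi> $ i * cnj (\<xi> $ j) * dzbar j (dz i \<phi>) (\<gamma> 0)) * cnj \<tau>)) (at 0)"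
    unfolding A_def[abs_def]
    by (rule has_derivative_eq_rhs, rule has_derivative_sum, rule has_derivative_mult[OF nth comp[OF diff(1)]])
       (simp add: fun_eq_iff \<xi>_def sum_distrib_left sum_distrib_right algebra_simps sum.distrib)
  have dB: "(B has_derivative (\<lambda>\<tau>. (\<Sum>i\<in>UNIV. \<Sum>j\<in>UNIV. \<xi> $ i * cnj (\<xi> $ j) * dz i (dzbar j \<phi>) (\<gamma> 0)) * \<tau> +
      (\<Sum>i\<in>UNIV. cnj (\<gamma>dd $ i) * dzbar i \<phi> (\<gamma> 0) + (\<Sum>j\<in>UNIV. cnj (\<xi> $ i) * (cnj (\<xi> $ j) * dzbar j (dzbar i \<phi>) (\<gamma> 0)))) * cnj \<tau>)) (at 0)"
    unfolding B_def[abs_def]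
    by (rule has_derivative_eq_rhs, rule has_derivative_sum,
        rule has_derivative_mult[OF bounded_linear.has_derivative[OF bounded_linear_cnj nth] comp[OF diff(2)]],
        subst sum.swap)
       (simp add: fun_eq_iff \<xi>_def sum_distrib_left sum_distrib_right algebra_simps sum.distrib)
  show ?thesis
    using jet_C2[OF u dA dB] unfolding A_def B_def \<xi>_def .
qed

text \<open>Here \<open>W\<close> contributes only \<open>t\<close> and, after conjugation,
  \<open>V\<close> only \<open>cnj t\<close>, which is why the mixed coefficient has just four
  terms.\<close>

lemma jet_herm:
  fixes M :: "complex \<Rightarrow> complex^'m^'m"
  assumes M: "\<And>k l. jet (\<lambda>t. M t $ k $ l) (M0 $ k $ l) (Ma $ k $ l) (Mb $ k $ l) (Mq $ k $ l)"
    and W: "\<And>k. jet (\<lambda>t. W t $ k) (W0 $ k) (W1 $ k) 0 0"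
    and V: "\<And>k. jet (\<lambda>t. V t $ k) (V0 $ k) (V1 $ k) 0 0"
  shows "jet (\<lambda>t. herm (M t) (W t) (V t)) (herm M0 W0 V0) (herm Ma W0 V0 + herm M0 W1 V0)
    (herm Mb W0 V0 + herm M0 W0 V1) (herm Mq W0 V0 + herm Ma W0 V1 + herm Mb W1 V0 + herm M0 W1 V1)"
proof -
  have "jet (\<lambda>t. herm (M t) (W t) (V t)) (\<Sum>k\<in>UNIV. \<Sum>l\<in>UNIV. M0 $ k $ l * W0 $ k * cnj (V0 $ l))
     (\<Sum>k\<in>UNIV. \<Sum>l\<in>UNIV. (Ma $ k $ l * W0 $ k + M0 $ k $ l * W1 $ k) * cnj (V0 $ l))
     (\<Sum>k\<in>UNIV. \<Sum>l\<in>UNIV. M0 $ k $ l * W0 $ k * cnj (V1 $ l) + Mb $ k $ l * W0 $ k * cnj (V0 $ l))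
     (\<Sum>k\<in>UNIV. \<Sum>l\<in>UNIV. Mq $ k $ l * W0 $ k * cnj (V0 $ l) + Ma $ k $ l * W0 $ k * cnj (V1 $ l)
       + Mb $ k $ l * W1 $ k * cnj (V0 $ l) + M0 $ k $ l * W1 $ k * cnj (V1 $ l))"
    unfolding herm_def
  proof (intro jet_sum)
    fix k l
    have "jet (\<lambda>t. M t $ k $ l * W t $ k) (M0 $ k $ l * W0 $ k) (Ma $ k $ l * W0 $ k + M0 $ k $ l * W1 $ k)
        (Mb $ k $ l * W0 $ k) (Mq $ k $ l * W0 $ k + Mb $ k $ l * W1 $ k)"
      using jet_mult[OF M[of k l] W[of k]] by (simp add: add_ac)
    from jet_mult[OF this jet_cnj[OF V[of l]]]
    show "jet (\<lambda>t. M t $ k $ l * W t $ k * cnj (V t $ l)) (M0 $ k $ l * W0 $ k * cnj (V0 $ l))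
     ((Ma $ k $ l * W0 $ k + M0 $ k $ l * W1 $ k) * cnj (V0 $ l))
     (M0 $ k $ l * W0 $ k * cnj (V1 $ l) + Mb $ k $ l * W0 $ k * cnj (V0 $ l))
     (Mq $ k $ l * W0 $ k * cnj (V0 $ l) + Ma $ k $ l * W0 $ k * cnj (V1 $ l)
       + Mb $ k $ l * W1 $ k * cnj (V0 $ l) + M0 $ k $ l * W1 $ k * cnj (V1 $ l))"
      by (simp add: algebra_simps)
  qed
  then show ?thesis
    by (simp add: herm_def sum.distrib algebra_simps)
qed

section \<open>Derivatives of a smooth Hermitian metric\<close>

lemma frechet_derivative_cong_open:
  assumes "open S" "z \<in> S" "\<And>w. w \<in> S \<Longrightarrow> f w = g w"
  shows "frechet_derivative f (at z) = frechet_derivative g (at z)"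
proof -
  have "(f has_derivative D) (at z) \<longleftrightarrow> (g has_derivative D) (at z)" for D
    using has_derivative_transform_within_open[OF _ assms(1,2), of f D UNIV g]
      has_derivative_transform_within_open[OF _ assms(1,2), of g D UNIV f] assms(3) by auto
  then show ?thesis
    by (simp add: frechet_derivative_def)
qed

lemma wirtinger_cong_open:
  assumes "open S" "z \<in> S" "\<And>w. w \<in> S \<Longrightarrow> f w = g w"
  shows "dz i f z = dz i g z" "dzbar i f z = dzbar i g z"
  using frechet_derivative_cong_open[OF assms] by (simp_all add: dz_def dzbar_def)

lemma wirtinger_cnj:
  assumes "\<phi> differentiable (at z)"
  shows "dz i (\<lambda>w. cnj (\<phi> w)) z = cnj (dzbar i \<phi> z)" "dzbar i (\<lambda>w. cnj (\<phi> w)) z = cnj (dz i \<phi> z)"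
proof -
  have "((\<lambda>w. cnj (\<phi> w)) has_derivative (\<lambda>v. cnj (frechet_derivative \<phi> (at z) v))) (at z)"
    using assms by (intro bounded_linear.has_derivative[OF bounded_linear_cnj]) (simp add: frechet_derivative_works)
  then have "frechet_derivative (\<lambda>w. cnj (\<phi> w)) (at z) = (\<lambda>v. cnj (frechet_derivative \<phi> (at z) v))"
    by (rule frechet_derivative_at[symmetric])
  then show "dz i (\<lambda>w. cnj (\<phi> w)) z = cnj (dzbar i \<phi> z)" "dzbar i (\<lambda>w. cnj (\<phi> w)) z = cnj (dz i \<phi> z)"
    by (simp_all add: dz_def dzbar_def)
qed

lemma smooth_on_imp_C2:
  assumes "smooth_on G S" "z \<in> S"
  shows "G differentiable (at z)" "(\<lambda>x. frechet_derivative G (at x) v) differentiable (at z)"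
proof -
  have "Ck_on (Suc (Suc 0)) G S"
    using assms(1) unfolding smooth_on_def by blast
  then show "G differentiable (at z)" "(\<lambda>x. frechet_derivative G (at x) v) differentiable (at z)"
    using assms(2) by auto
qed

lemma smooth_on_component:
  fixes G :: "complex^'m \<Rightarrow> complex^'k^'l"
  assumes G: "smooth_on G S" and S: "open S" "z \<in> S"
  shows "(\<lambda>w. G w $ k $ l) differentiable (at z)"
    "(\<lambda>x. frechet_derivative (\<lambda>w. G w $ k $ l) (at x) v) differentiable (at z)"
proof -
  have bl: "bounded_linear (\<lambda>A :: complex^'k^'l. A $ k $ l)"
    by (intro bounded_linear_compose[OF bounded_linear_vec_nth] bounded_linear_vec_nth)
  have D: "((\<lambda>w. G w $ k $ l) has_derivative (\<lambda>v. frechet_derivative G (at x) v $ k $ l)) (at x)" if "x \<in> S" for x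
    using smooth_on_imp_C2(1)[OF G that]
    by (intro bounded_linear.has_derivative[OF bl]) (simp add: frechet_derivative_works)
  show "(\<lambda>w. G w $ k $ l) differentiable (at z)"
    using D[OF S(2)] by (rule differentiableI)
  have eq: "frechet_derivative (\<lambda>w. G w $ k $ l) (at x) v = frechet_derivative G (at x) v $ k $ l" if "x \<in> S" for x
    using frechet_derivative_at[OF D[OF that]] by metis
  obtain D2 where "((\<lambda>x. frechet_derivative G (at x) v) has_derivative D2) (at z)"
    using smooth_on_imp_C2(2)[OF G S(2)] unfolding differentiable_def by blast
  then have "((\<lambda>x. frechet_derivative G (at x) v $ k $ l) has_derivative (\<lambda>y. D2 y $ k $ l)) (at z)"
    by (rule bounded_linear.has_derivative[OF bl])
  then have "((\<lambda>x. frechet_derivative (\<lambda>w. G w $ k $ l) (at x) v) has_derivative (\<lambda>y. D2 y $ k $ l)) (at z)"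
    by (rule has_derivative_transform_within_open[OF _ S]) (simp add: eq)
  then show "(\<lambda>x. frechet_derivative (\<lambda>w. G w $ k $ l) (at x) v) differentiable (at z)"
    by (rule differentiableI)
qed

lemma wirtinger_differentiable:
  assumes "\<And>v. (\<lambda>x. frechet_derivative \<phi> (at x) v) differentiable (at z)"
  shows "dz i \<phi> differentiable (at z)" "dzbar i \<phi> differentiable (at z)"
  unfolding dz_def[abs_def] dzbar_def[abs_def]
  by (intro differentiable_add differentiable_diff differentiable_mult differentiable_const
      differentiable_divide assms; simp)+

lemma ginv_mult:
  assumes "hermitian_posdef G"
  shows "(\<Sum>p\<in>UNIV. ginv G $ p $ q * G $ p $ l) = (if q = l then 1 else 0)"
proof -
  obtain B where "G ** B = mat 1"
    using hermitian_posdef_invertible[OF assms] unfolding invertible_def by blast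
  then have "matrix_inv G ** G = mat 1"
    using matrix_inv_eqI matrix_left_right_inverse1 by metis
  then have "(matrix_inv G ** G) $ q $ l = (if q = l then 1 else 0)"
    by (simp add: mat_def)
  then show ?thesis
    by (simp add: matrix_matrix_mult_def ginv_def transpose_def)
qed

text \<open>\<open>X\<close> is the connection form of the Chern connection contracted with \<open>\<xi>\<close>, so that
  \<open>W1 + X W0\<close> is the covariant derivative along the curve of a holomorphic section \<open>W\<close>. Only the real part
  of the mixed coefficient is determined, since this does not presuppose that \<open>\<partial>\<close> and the conjugate
  operator commute.\<close>

lemma jet_metric_along_curve:
  fixes G :: "complex^'m \<Rightarrow> complex^'m^'m" and \<gamma> :: "complex \<Rightarrow> complex^'m"
  assumes S: "open S" "z \<in> S" and G: "smooth_on G S" "\<And>z. z \<in> S \<Longrightarrow> hermitian_posdef (G z)"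
    and \<gamma>: "eventually (\<lambda>t. (\<gamma> has_derivative (\<lambda>\<tau>. \<tau> *s \<gamma>d t)) (at t)) (nhds 0)"
    and \<gamma>d: "(\<gamma>d has_derivative (\<lambda>\<tau>. \<tau> *s \<gamma>dd)) (at 0)"
    and \<gamma>0: "\<gamma> 0 = z" "\<gamma>d 0 = \<xi>"
  shows "\<exists>X. \<forall>W V W0 W1 V0 V1. (\<forall>k. jet (\<lambda>t. W t $ k) (W0 $ k) (W1 $ k) 0 0) \<longrightarrow>
      (\<forall>k. jet (\<lambda>t. V t $ k) (V0 $ k) (V1 $ k) 0 0) \<longrightarrow>
      (\<exists>q. jet (\<lambda>t. herm (G (\<gamma> t)) (W t) (V t)) (herm (G z) W0 V0)
        (herm (G z) (W1 + X W0) V0) (herm (G z) W0 (V1 + X V0)) q \<and>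
        (W0 = V0 \<and> W1 = V1 \<longrightarrow> Re q = - Re (chern_R G z \<xi> \<xi> W0 W0)
           + Re (herm (G z) (W1 + X W0) (W1 + X W0))))"
proof -
  have zS: "\<gamma> 0 \<in> S"
    using S \<gamma>0 by simp
  define Ma :: "complex^'m^'m" where "Ma = (\<chi> k l. \<Sum>i\<in>UNIV. \<xi> $ i * dz i (\<lambda>w. G w $ k $ l) z)"
  define Mb :: "complex^'m^'m" where "Mb = (\<chi> k l. \<Sum>i\<in>UNIV. cnj (\<xi> $ i) * dzbar i (\<lambda>w. G w $ k $ l) z)"
  define M1 :: "complex^'m^'m" where
    "M1 = (\<chi> k l. \<Sum>i\<in>UNIV. \<Sum>j\<in>UNIV. \<xi> $ i * cnj (\<xi> $ j) * dz i (dzbar j (\<lambda>w. G w $ k $ l)) z)"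
  define M2 :: "complex^'m^'m" where
    "M2 = (\<chi> k l. \<Sum>i\<in>UNIV. \<Sum>j\<in>UNIV. \<xi> $ i * cnj (\<xi> $ j) * dzbar j (dz i (\<lambda>w. G w $ k $ l)) z)"
  define Mq :: "complex^'m^'m" where "Mq = (\<chi> k l. (M2 $ k $ l + M1 $ k $ l) / 2)"
  note comp = smooth_on_component[OF G(1) S(1)]
  have cG: "cnj (G w $ k $ l) = G w $ l $ k" if "w \<in> S" for w k l
    using G(2)[OF that] unfolding hermitian_posdef_def by metis
  have hG: "hermitian_mat (G z)"
    using G(2)[OF S(2)] by (rule hermitian_posdef_imp_hermitian_mat)
  have jG: "jet (\<lambda>t. G (\<gamma> t) $ k $ l) (G z $ k $ l) (Ma $ k $ l) (Mb $ k $ l) (Mq $ k $ l)" for k l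
    using jet_comp_curve[OF S(1) zS comp(1) comp(2)[OF zS] \<gamma> \<gamma>d, of k l]
    by (simp add: Ma_def Mb_def Mq_def M1_def M2_def \<gamma>0)
  have Mb: "Mb $ k $ l = cnj (Ma $ l $ k)" for k l
  proof -
    have "dzbar i (\<lambda>w. G w $ k $ l) z = cnj (dz i (\<lambda>w. G w $ l $ k) z)" for i
      using wirtinger_cong_open(2)[OF S(1) S(2), of "\<lambda>w. G w $ k $ l" "\<lambda>w. cnj (G w $ l $ k)" i]
        wirtinger_cnj(2)[OF comp(1)[OF S(2)], of i l k] cG by simp
    then show ?thesis
      by (simp add: Mb_def Ma_def)
  qed
  \<comment> \<open>Conjugating and using that \<open>G\<close> is Hermitian exchanges the two
    orders of differentiation, so \<open>herm Mq W0 W0\<close> has the same real part as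
    \<open>herm M1 W0 W0\<close>, where \<open>M1\<close> has the order used in
    \<open>chern_comp\<close>.\<close>
  have M2: "M2 $ k $ l = cnj (M1 $ l $ k)" for k l
  proof -
    have "dzbar j (dz i (\<lambda>w. G w $ k $ l)) z = cnj (dz j (dzbar i (\<lambda>w. G w $ l $ k)) z)" for i j
    proof -
      have "dzbar j (dz i (\<lambda>w. G w $ k $ l)) z = dzbar j (\<lambda>w. cnj (dzbar i (\<lambda>w. G w $ l $ k) w)) z"
      proof (rule wirtinger_cong_open(2)[OF S(1) S(2)])
        fix w assume w: "w \<in> S"
        show "dz i (\<lambda>w. G w $ k $ l) w = cnj (dzbar i (\<lambda>w. G w $ l $ k) w)"
          using wirtinger_cong_open(1)[OF S(1) w, of "\<lambda>w. G w $ k $ l" "\<lambda>w. cnj (G w $ l $ k)" i]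
            wirtinger_cnj(1)[OF comp(1)[OF w], of i l k] cG by simp
      qed
      also have "\<dots> = cnj (dz j (dzbar i (\<lambda>w. G w $ l $ k)) z)"
        by (rule wirtinger_cnj(2)[OF wirtinger_differentiable(2)[OF comp(2)[OF S(2)]]])
      finally show ?thesis .
    qed
    then have "M2 $ k $ l = (\<Sum>i\<in>UNIV. \<Sum>j\<in>UNIV. cnj (\<xi> $ j * cnj (\<xi> $ i) * dz j (dzbar i (\<lambda>w. G w $ l $ k)) z))"
      by (simp add: M2_def mult_ac)
    also have "\<dots> = cnj (M1 $ l $ k)"
      by (subst sum.swap) (simp add: M1_def)
    finally show ?thesis .
  qed
  \<comment> \<open>The derivative \<open>Ma\<close> of the metric with its barred index raised, so
    that pairing with \<open>X W\<close> under \<open>G z\<close> reproduces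
    \<open>Ma\<close>.\<close>
  define X where "X W = (\<chi> p. \<Sum>k\<in>UNIV. \<Sum>q\<in>UNIV. ginv (G z) $ p $ q * Ma $ k $ q * W $ k)" for W :: "complex^'m"
  have X: "herm (G z) (X W) v = herm Ma W v" for W v
  proof -
    have "herm (G z) (X W) v = (\<Sum>p\<in>UNIV. \<Sum>l\<in>UNIV. \<Sum>k\<in>UNIV. \<Sum>q\<in>UNIV.
        ginv (G z) $ p $ q * G z $ p $ l * (Ma $ k $ q * W $ k * cnj (v $ l)))"
      by (simp add: herm_def X_def sum_distrib_left sum_distrib_right mult_ac)
    also have "\<dots> = (\<Sum>l\<in>UNIV. \<Sum>k\<in>UNIV. \<Sum>q\<in>UNIV. \<Sum>p\<in>UNIV.
        ginv (G z) $ p $ q * G z $ p $ l * (Ma $ k $ q * W $ k * cnj (v $ l)))"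
      by (subst sum.swap, rule sum.cong[OF refl], rule sum_swap_3[symmetric])
    also have "\<dots> = (\<Sum>l\<in>UNIV. \<Sum>k\<in>UNIV. \<Sum>q\<in>UNIV. if q = l then Ma $ k $ l * W $ k * cnj (v $ l) else 0)"
      by (intro sum.cong refl) (simp add: ginv_mult[OF G(2)[OF S(2)]] flip: sum_distrib_right)
    also have "\<dots> = (\<Sum>l\<in>UNIV. \<Sum>k\<in>UNIV. Ma $ k $ l * W $ k * cnj (v $ l))"
      by simp
    also have "\<dots> = herm Ma W v"
      unfolding herm_def by (rule sum.swap)
    finally show ?thesis .
  qed
  have hMb: "herm Mb v w = herm (G z) v (X w)" for v w
  proof -
    have "herm Mb v w = cnj (herm Ma w v)"
      unfolding herm_def cnj_sum by (subst sum.swap) (simp add: Mb mult_ac)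
    then show ?thesis
      by (simp add: X[symmetric] cnj_herm[OF hG])
  qed
  \<comment> \<open>The quadratic term of the Chern curvature is the \<open>G\<close>-pairing of
    \<open>X W\<close> with \<open>X V\<close>. It completes the square with the first order terms
    of the section, leaving the squared length of the covariant derivative.\<close>
  have R: "chern_R G z \<xi> \<xi> W V = - herm M1 W V + herm (G z) (X W) (X V)" for W V
  proof -
    have "chern_R G z \<xi> \<xi> W V = (\<Sum>i\<in>UNIV. \<Sum>j\<in>UNIV. \<Sum>k\<in>UNIV. \<Sum>l\<in>UNIV.
        - (\<xi> $ i * cnj (\<xi> $ j) * dz i (dzbar j (\<lambda>w. G w $ k $ l)) z * W $ k * cnj (V $ l))
        + (\<Sum>p\<in>UNIV. \<Sum>q\<in>UNIV. ginv (G z) $ p $ q * (\<xi> $ i * dz i (\<lambda>w. G w $ k $ q) z)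
           * (cnj (\<xi> $ j) * dzbar j (\<lambda>w. G w $ p $ l) z) * W $ k * cnj (V $ l)))"
      unfolding chern_R_def chern_comp_def
      by (intro sum.cong refl) (simp add: algebra_simps sum_distrib_left sum_distrib_right)
    also have "\<dots> = (\<Sum>k\<in>UNIV. \<Sum>l\<in>UNIV. \<Sum>i\<in>UNIV. \<Sum>j\<in>UNIV.
        - (\<xi> $ i * cnj (\<xi> $ j) * dz i (dzbar j (\<lambda>w. G w $ k $ l)) z * W $ k * cnj (V $ l))
        + (\<Sum>p\<in>UNIV. \<Sum>q\<in>UNIV. ginv (G z) $ p $ q * (\<xi> $ i * dz i (\<lambda>w. G w $ k $ q) z)
           * (cnj (\<xi> $ j) * dzbar j (\<lambda>w. G w $ p $ l) z) * W $ k * cnj (V $ l)))"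
      by (subst sum_swap_3, rule sum.cong[OF refl], rule sum_swap_3)
    also have "\<dots> = (\<Sum>k\<in>UNIV. \<Sum>l\<in>UNIV. - (M1 $ k $ l * W $ k * cnj (V $ l))
        + (\<Sum>p\<in>UNIV. \<Sum>q\<in>UNIV. ginv (G z) $ p $ q * Ma $ k $ q * Mb $ p $ l * W $ k * cnj (V $ l)))"
    proof (rule sum.cong[OF refl], rule sum.cong[OF refl])
      fix k l
      have "(\<Sum>i\<in>UNIV. \<Sum>j\<in>UNIV. \<Sum>p\<in>UNIV. \<Sum>q\<in>UNIV. ginv (G z) $ p $ q * (\<xi> $ i * dz i (\<lambda>w. G w $ k $ q) z)
           * (cnj (\<xi> $ j) * dzbar j (\<lambda>w. G w $ p $ l) z) * W $ k * cnj (V $ l)) =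
         (\<Sum>p\<in>UNIV. \<Sum>q\<in>UNIV. \<Sum>i\<in>UNIV. \<Sum>j\<in>UNIV. ginv (G z) $ p $ q * (\<xi> $ i * dz i (\<lambda>w. G w $ k $ q) z)
           * (cnj (\<xi> $ j) * dzbar j (\<lambda>w. G w $ p $ l) z) * W $ k * cnj (V $ l))"
        by (subst sum_swap_3, rule sum.cong[OF refl], rule sum_swap_3)
      also have "\<dots> = (\<Sum>p\<in>UNIV. \<Sum>q\<in>UNIV. ginv (G z) $ p $ q * Ma $ k $ q * Mb $ p $ l * W $ k * cnj (V $ l))"
        by (intro sum.cong refl) (simp add: Ma_def Mb_def sum_distrib_left sum_distrib_right mult_ac)
      finally show "(\<Sum>i\<in>UNIV. \<Sum>j\<in>UNIV.
        - (\<xi> $ i * cnj (\<xi> $ j) * dz i (dzbar j (\<lambda>w. G w $ k $ l)) z * W $ k * cnj (V $ l))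
        + (\<Sum>p\<in>UNIV. \<Sum>q\<in>UNIV. ginv (G z) $ p $ q * (\<xi> $ i * dz i (\<lambda>w. G w $ k $ q) z)
           * (cnj (\<xi> $ j) * dzbar j (\<lambda>w. G w $ p $ l) z) * W $ k * cnj (V $ l))) =
        - (M1 $ k $ l * W $ k * cnj (V $ l))
        + (\<Sum>p\<in>UNIV. \<Sum>q\<in>UNIV. ginv (G z) $ p $ q * Ma $ k $ q * Mb $ p $ l * W $ k * cnj (V $ l))"
        unfolding sum.distrib by (simp add: M1_def sum_negf sum_distrib_right)
    qed
    also have "\<dots> = - herm M1 W V + (\<Sum>k\<in>UNIV. \<Sum>l\<in>UNIV. \<Sum>p\<in>UNIV. \<Sum>q\<in>UNIV. ginv (G z) $ p $ q * Ma $ k $ q * Mb $ p $ l * W $ k * cnj (V $ l))"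
      by (simp add: sum_subtractf herm_def)
    also have "(\<Sum>k\<in>UNIV. \<Sum>l\<in>UNIV. \<Sum>p\<in>UNIV. \<Sum>q\<in>UNIV. ginv (G z) $ p $ q * Ma $ k $ q * Mb $ p $ l * W $ k * cnj (V $ l)) =
        (\<Sum>p\<in>UNIV. \<Sum>k\<in>UNIV. \<Sum>l\<in>UNIV. \<Sum>q\<in>UNIV. ginv (G z) $ p $ q * Ma $ k $ q * Mb $ p $ l * W $ k * cnj (V $ l))"
      by (rule sum_swap_3)
    also have "\<dots> = (\<Sum>p\<in>UNIV. \<Sum>l\<in>UNIV. \<Sum>k\<in>UNIV. \<Sum>q\<in>UNIV. ginv (G z) $ p $ q * Ma $ k $ q * Mb $ p $ l * W $ k * cnj (V $ l))"
      by (rule sum.cong[OF refl], rule sum.swap)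
    also have "\<dots> = herm Mb (X W) V"
      by (simp add: herm_def[of Mb] X_def sum_distrib_left sum_distrib_right mult_ac)
    finally show ?thesis
      by (simp add: hMb)
  qed
  show ?thesis
  proof (rule exI[of _ X], intro allI impI)
    fix W V and W0 W1 V0 V1 :: "complex^'m"
    assume "\<forall>k. jet (\<lambda>t. W t $ k) (W0 $ k) (W1 $ k) 0 0" and "\<forall>k. jet (\<lambda>t. V t $ k) (V0 $ k) (V1 $ k) 0 0"
    then have W: "jet (\<lambda>t. W t $ k) (W0 $ k) (W1 $ k) 0 0" and V: "jet (\<lambda>t. V t $ k) (V0 $ k) (V1 $ k) 0 0" for k
      by blast+
    let ?q = "herm Mq W0 V0 + herm Ma W0 V1 + herm Mb W1 V0 + herm (G z) W1 V1"
    have "jet (\<lambda>t. herm (G (\<gamma> t)) (W t) (V t)) (herm (G z) W0 V0)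
        (herm (G z) (W1 + X W0) V0) (herm (G z) W0 (V1 + X V0)) ?q"
      using jet_herm[where M = "\<lambda>t. G (\<gamma> t)", OF jG W V] by (simp add: herm_add_left herm_add_right X hMb add.commute)
    moreover have "Re ?q = - Re (chern_R G z \<xi> \<xi> W0 W0) + Re (herm (G z) (W1 + X W0) (W1 + X W0))"
      if "W0 = V0" "W1 = V1"
    proof -
      have "herm M2 W0 W0 = cnj (herm M1 W0 W0)"
        unfolding herm_def cnj_sum by (subst sum.swap) (simp add: M2 mult_ac)
      moreover have "herm Mq W0 W0 = (herm M2 W0 W0 + herm M1 W0 W0) / 2"
        by (simp add: herm_def Mq_def sum_divide_distrib add_divide_distrib distrib_right sum.distrib)
      ultimately have "herm Mq W0 W0 = (cnj (herm M1 W0 W0) + herm M1 W0 W0) / 2"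
        by (simp only:)
      then have "Re (herm Mq W0 W0) = Re (herm M1 W0 W0)"
        by (simp only: Re_divide_numeral plus_complex.sel complex_cnj) simp
      moreover have "?q = herm Mq W0 W0 + herm (G z) (X W0) W1 + herm (G z) W1 (X W0) + herm (G z) W1 W1"
        using that by (simp add: X hMb)
      ultimately show ?thesis
        by (simp add: R herm_add_left herm_add_right)
    qed
    ultimately show "\<exists>q. jet (\<lambda>t. herm (G (\<gamma> t)) (W t) (V t)) (herm (G z) W0 V0)
        (herm (G z) (W1 + X W0) V0) (herm (G z) W0 (V1 + X V0)) q \<and>
        (W0 = V0 \<and> W1 = V1 \<longrightarrow> Re q = - Re (chern_R G z \<xi> \<xi> W0 W0)
           + Re (herm (G z) (W1 + X W0) (W1 + X W0)))"
      by blast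
  qed
qed

section \<open>Partial derivatives of holomorphic maps\<close>

lemma mholomorphic_on_has_derivative:
  fixes F :: "complex^'m \<Rightarrow> complex^'n"
  assumes "mholomorphic_on F S" "z \<in> S"
  shows "(F has_derivative (\<lambda>v. jacobian F z *v v)) (at z)"
proof -
  obtain D where D: "(F has_derivative D) (at z)" "\<And>c v. D (c *s v) = c *s D v"
    using assms unfolding mholomorphic_on_def by blast
  have lin: "linear D"
    using D(1) by (rule has_derivative_linear)
  have "D v = jacobian F z *v v" for v
  proof -
    have comp: "dz \<alpha> (\<lambda>w. F w $ i) z = D (axis \<alpha> 1) $ i" for i \<alpha>
    proof -
      have "((\<lambda>w. F w $ i) has_derivative (\<lambda>v. D v $ i)) (at z)"
        by (rule bounded_linear.has_derivative[OF bounded_linear_vec_nth D(1)])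
      then have "frechet_derivative (\<lambda>w. F w $ i) (at z) = (\<lambda>v. D v $ i)"
        by (rule frechet_derivative_at[symmetric])
      moreover have "axis \<alpha> \<i> = \<i> *s axis \<alpha> (1::complex)"
        by (simp add: vec_eq_iff axis_def)
      ultimately show ?thesis
        by (simp add: dz_def D(2))
    qed
    have "D v = D (\<Sum>\<alpha>\<in>UNIV. v $ \<alpha> *s axis \<alpha> 1)"
      by (simp only: basis_expansion)
    also have "\<dots> = (\<Sum>\<alpha>\<in>UNIV. v $ \<alpha> *s D (axis \<alpha> 1))"
      by (simp add: linear_sum[OF lin] D(2))
    also have "\<dots> = jacobian F z *v v"
      by (simp add: vec_eq_iff jacobian_def comp matrix_vector_mult_def mult_ac)
    finally show ?thesis .
  qed
  then show ?thesis
    using D(1) by (simp add: fun_eq_iff[of D, symmetric] flip: \<open>\<And>v. D v = jacobian F z *v v\<close>)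
qed

lemma norm_scale_vec: "norm (c *s v) = cmod c * norm v" for v :: "complex^'m"
  by (simp add: norm_vec_def L2_set_def norm_mult power_mult_distrib real_sqrt_mult flip: sum_distrib_left)

lemma norm_axis_complex: "norm (axis k 1 :: complex^'m) = 1"
proof -
  have "(\<Sum>i\<in>UNIV. (norm (axis k (1::complex) $ i))\<^sup>2) = (\<Sum>i\<in>UNIV. if i = k then 1 else 0)"
    by (rule sum.cong) (auto simp: axis_def)
  then show ?thesis
    by (simp add: norm_vec_def L2_set_def)
qed

lemma matrix_vector_mult_axis: "(A *v axis k 1) $ i = A $ i $ k" for A :: "complex^'m^'n"
proof -
  have "(A *v axis k 1) $ i = (\<Sum>j\<in>UNIV. if j = k then A $ i $ k else 0)"
    unfolding matrix_vector_mult_def vec_lambda_beta by (rule sum.cong) (auto simp: axis_def)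
  then show ?thesis
    by simp
qed

lemma add_axis_in_cball:
  assumes "z \<in> ball z0 \<delta>" "cmod s \<le> 2 * \<delta>"
  shows "z + s *s axis k 1 \<in> cball z0 (3 * \<delta>)"
proof -
  have "norm (z - z0 + s *s axis k 1) \<le> norm (z - z0) + cmod s"
    using norm_triangle_ineq[of "z - z0" "s *s axis k 1"] by (simp add: norm_scale_vec norm_axis_complex)
  moreover have "norm (z - z0) < \<delta>"
    using assms(1) by (simp add: dist_norm norm_minus_commute)
  ultimately have "norm (z - z0 + s *s axis k 1) \<le> 3 * \<delta>"
    using assms(2) by simp
  moreover have "dist z0 (z + s *s axis k 1) = norm (z - z0 + s *s axis k 1)"
    unfolding dist_norm norm_minus_commute[of z0] by (simp add: algebra_simps)
  ultimately show ?thesis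
    by simp
qed

lemma has_derivative_affine_line: "((\<lambda>t. z + t *s v) has_derivative (\<lambda>\<tau>. \<tau> *s v)) (at (t :: complex))"
  for v :: "complex^'m"
proof -
  have "((\<lambda>t::complex. t *s v) has_derivative (\<lambda>\<tau>. \<tau> *s v)) (at t)"
  proof (rule bounded_linear_imp_has_derivative, rule bounded_linear_intro[where K = "norm v"])
    show "norm (x *s v) \<le> norm x * norm v" for x
      by (simp add: norm_scale_vec)
  qed (simp_all add: vec.scale_left_distrib vec_eq_iff)
  then show ?thesis
    by (auto intro: derivative_eq_intros)
qed

lemma mholomorphic_on_along_line:
  fixes F :: "complex^'m \<Rightarrow> complex^'n"
  assumes "mholomorphic_on F S" "z + t *s v \<in> S"
  shows "((\<lambda>t. F (z + t *s v)) has_derivative (\<lambda>\<tau>. \<tau> *s (jacobian F (z + t *s v) *v v))) (at t)"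
  using has_derivative_compose[OF has_derivative_affine_line mholomorphic_on_has_derivative[OF assms]]
  by (simp add: vec.scale)

text \<open>Taylor's remainder, with the second derivative on \<open>cball 0 \<delta>\<close>
  bounded by Cauchy's inequality on discs of radius \<open>\<delta> / 2\<close>; the constant is
  \<open>2! * M / (\<delta> / 2)\<^sup>2\<close>.\<close>

lemma holomorphic_quotient_bound:
  assumes \<phi>: "\<phi> holomorphic_on ball 0 (2 * \<delta>)" and "\<delta> > 0"
    and M: "\<And>s. s \<in> ball 0 (2 * \<delta>) \<Longrightarrow> cmod (\<phi> s) \<le> M"
    and h: "h \<noteq> 0" "cmod h \<le> \<delta>"
  shows "cmod ((\<phi> h - \<phi> 0) / h - deriv \<phi> 0) \<le> 8 * M / \<delta>\<^sup>2 * cmod h"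
proof -
  have b: "cmod ((deriv ^^ 2) \<phi> x) \<le> 8 * M / \<delta>\<^sup>2" if x: "x \<in> cball 0 \<delta>" for x
  proof -
    have sub: "cball x (\<delta> / 2) \<subseteq> ball 0 (2 * \<delta>)"
    proof
      fix y assume "y \<in> cball x (\<delta> / 2)"
      then have "cmod (y - x) \<le> \<delta> / 2" "cmod x \<le> \<delta>"
        using x by (auto simp: dist_norm norm_minus_commute)
      then show "y \<in> ball 0 (2 * \<delta>)"
        using norm_triangle_ineq[of "y - x" x] \<open>\<delta> > 0\<close> by simp
    qed
    have "cmod ((deriv ^^ 2) \<phi> x) \<le> fact 2 * M / (\<delta> / 2) ^ 2"
    proof (rule Cauchy_inequality)
      show "\<phi> holomorphic_on ball x (\<delta> / 2)"
        using \<phi> by (rule holomorphic_on_subset) (use sub ball_subset_cball in blast)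
      show "continuous_on (cball x (\<delta> / 2)) \<phi>"
        using \<phi> sub by (meson continuous_on_subset holomorphic_on_imp_continuous_on)
      show "cmod (\<phi> y) \<le> M" if "cmod (x - y) = \<delta> / 2" for y
        using that sub by (intro M) (auto simp: dist_norm subset_iff)
    qed (use \<open>\<delta> > 0\<close> in simp)
    then show ?thesis
      by (simp add: power_divide fact_2)
  qed
  have "cmod ((deriv ^^ 0) \<phi> h - (\<Sum>i\<le>1. (deriv ^^ i) \<phi> 0 * (h - 0) ^ i / fact i)) \<le> 8 * M / \<delta>\<^sup>2 * cmod (h - 0) ^ Suc 1 / fact 1"
  proof (rule complex_Taylor[where S = "cball 0 \<delta>" and f = "\<lambda>i. (deriv ^^ i) \<phi>"])
    fix i :: nat and x :: complex assume "x \<in> cball 0 \<delta>"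
    then have "x \<in> ball 0 (2 * \<delta>)"
      using \<open>\<delta> > 0\<close> by simp
    then have "((deriv ^^ i) \<phi> has_field_derivative (deriv ^^ Suc i) \<phi> x) (at x)"
      using holomorphic_derivI[OF holomorphic_higher_deriv[OF \<phi> open_ball] open_ball] by simp
    then show "((deriv ^^ i) \<phi> has_field_derivative (deriv ^^ Suc i) \<phi> x) (at x within cball 0 \<delta>)"
      by (rule has_field_derivative_at_within)
  next
    fix x :: complex assume "x \<in> cball 0 \<delta>"
    from b[OF this] show "cmod ((deriv ^^ Suc 1) \<phi> x) \<le> 8 * M / \<delta>\<^sup>2"
      by (simp add: numeral_2_eq_2)
  qed (use h \<open>\<delta> > 0\<close> in auto)
  then have "cmod (\<phi> h - \<phi> 0 - deriv \<phi> 0 * h) \<le> 8 * M / \<delta>\<^sup>2 * (cmod h)\<^sup>2"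
    by (simp add: power2_eq_square diff_diff_eq)
  moreover have "(\<phi> h - \<phi> 0) / h - deriv \<phi> 0 = (\<phi> h - \<phi> 0 - deriv \<phi> 0 * h) / h"
    using h(1) by (simp add: diff_divide_distrib)
  ultimately have "cmod ((\<phi> h - \<phi> 0) / h - deriv \<phi> 0) \<le> 8 * M / \<delta>\<^sup>2 * (cmod h)\<^sup>2 / cmod h"
    by (simp only: norm_divide) (rule divide_right_mono, simp_all)
  then show ?thesis
    using h(1) by (simp add: power2_eq_square)
qed

text \<open>The easy case of Hartogs' theorem: since \<open>F\<close> is continuous, Cauchy's estimates in one variable
  make the difference quotients converge locally uniformly.\<close>

lemma jacobian_uniform_limit:
  fixes F :: "complex^'m \<Rightarrow> complex^'n"
  assumes S: "open S" "z0 \<in> S" and F: "mholomorphic_on F S"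
  obtains \<delta> where "\<delta> > 0" "cball z0 (3 * \<delta>) \<subseteq> S"
    "uniform_limit (ball z0 \<delta>) (\<lambda>n z. (F (z + of_real (\<delta> / real (Suc n)) *s axis \<alpha> 1) $ i - F z $ i) / of_real (\<delta> / real (Suc n)))
      (\<lambda>z. jacobian F z $ i $ \<alpha>) sequentially"
proof -
  obtain r where r: "r > 0" "cball z0 r \<subseteq> S"
    using S open_contains_cball by blast
  \<comment> \<open>Base points within \<open>\<delta>\<close> of \<open>z0\<close> and increments
    up to \<open>2 * \<delta>\<close> stay in the closed ball of radius \<open>3 * \<delta>\<close>,
    where \<open>F\<close> is bounded.\<close>
  define \<delta> where "\<delta> = r / 3"
  have \<delta>: "\<delta> > 0" "cball z0 (3 * \<delta>) \<subseteq> S"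
    using r by (simp_all add: \<delta>_def)
  have contF: "continuous_on S (\<lambda>z. F z $ i)"
    using mholomorphic_on_has_derivative[OF F]
    by (intro continuous_intros continuous_at_imp_continuous_on ballI) (rule has_derivative_continuous)
  have "bounded ((\<lambda>z. F z $ i) ` cball z0 (3 * \<delta>))"
    by (intro compact_imp_bounded compact_continuous_image continuous_on_subset[OF contF] \<delta>) simp
  then obtain M where M: "\<And>z. z \<in> cball z0 (3 * \<delta>) \<Longrightarrow> cmod (F z $ i) \<le> M"
    unfolding bounded_iff by blast
  let ?h = "\<lambda>n. complex_of_real (\<delta> / real (Suc n))"
  have key: "cmod ((F (z + h *s axis \<alpha> 1) $ i - F z $ i) / h - jacobian F z $ i $ \<alpha>) \<le> 8 * M / \<delta>\<^sup>2 * cmod h"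
    if z: "z \<in> ball z0 \<delta>" and h: "h \<noteq> 0" "cmod h \<le> \<delta>" for z h
  proof -
    let ?\<phi> = "\<lambda>s. F (z + s *s axis \<alpha> 1) $ i"
    have mem: "z + s *s axis \<alpha> 1 \<in> cball z0 (3 * \<delta>)" if "s \<in> ball 0 (2 * \<delta>)" for s
      using that z by (intro add_axis_in_cball) simp_all
    have der: "(?\<phi> has_field_derivative jacobian F (z + s *s axis \<alpha> 1) $ i $ \<alpha>) (at s)" if "s \<in> ball 0 (2 * \<delta>)" for s
    proof -
      have "z + s *s axis \<alpha> 1 \<in> S"
        using mem[OF that] \<delta>(2) by blast
      note bounded_linear.has_derivative[OF bounded_linear_vec_nth mholomorphic_on_along_line[OF F this], of i]
      moreover have "(\<lambda>\<tau>. (\<tau> *s (jacobian F (z + s *s axis \<alpha> 1) *v axis \<alpha> 1)) $ i) = (*) (jacobian F (z + s *s axis \<alpha> 1) $ i $ \<alpha>)"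
        by (simp add: fun_eq_iff matrix_vector_mult_axis)
      ultimately show ?thesis
        unfolding has_field_derivative_def by (simp only:)
    qed
    have "?\<phi> holomorphic_on ball 0 (2 * \<delta>)"
      unfolding holomorphic_on_open[OF open_ball] using der by blast
    moreover have "cmod (?\<phi> s) \<le> M" if "s \<in> ball 0 (2 * \<delta>)" for s
      using mem[OF that] by (rule M)
    ultimately have "cmod ((?\<phi> h - ?\<phi> 0) / h - deriv ?\<phi> 0) \<le> 8 * M / \<delta>\<^sup>2 * cmod h"
      by (intro holomorphic_quotient_bound \<delta> h) auto
    moreover have "deriv ?\<phi> 0 = jacobian F z $ i $ \<alpha>"
      using DERIV_imp_deriv[OF der[of 0]] \<delta>(1) by simp
    ultimately show ?thesis
      by simp
  qed
  have "uniform_limit (ball z0 \<delta>) (\<lambda>n z. (F (z + ?h n *s axis \<alpha> 1) $ i - F z $ i) / ?h n) (\<lambda>z. jacobian F z $ i $ \<alpha>) sequentially"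
  proof (rule uniform_limitI)
    fix e :: real assume "e > 0"
    have "(\<lambda>n. 8 * M / \<delta>\<^sup>2 * (\<delta> / real (Suc n))) \<longlonglongrightarrow> 8 * M / \<delta>\<^sup>2 * 0"
      by (intro tendsto_mult tendsto_const LIMSEQ_Suc[OF lim_const_over_n])
    then have "eventually (\<lambda>n. 8 * M / \<delta>\<^sup>2 * (\<delta> / real (Suc n)) < e) sequentially"
      using \<open>e > 0\<close> by (intro order_tendstoD(2)[where y = "8 * M / \<delta>\<^sup>2 * 0"]) simp_all
    then show "eventually (\<lambda>n. \<forall>z\<in>ball z0 \<delta>. dist ((F (z + ?h n *s axis \<alpha> 1) $ i - F z $ i) / ?h n) (jacobian F z $ i $ \<alpha>) < e) sequentially"
    proof eventually_elim
      case (elim n)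
      show ?case
      proof
        fix z assume z: "z \<in> ball z0 \<delta>"
        have hn: "cmod (?h n) = \<delta> / real (Suc n)"
          using \<delta>(1) by (simp only: norm_of_real) simp
        have "?h n \<noteq> 0"
          unfolding of_real_eq_0_iff using \<delta>(1) by simp
        moreover have "\<delta> / real (Suc n) \<le> \<delta>"
          using \<delta>(1) by (simp add: divide_simps)
        ultimately have "cmod ((F (z + ?h n *s axis \<alpha> 1) $ i - F z $ i) / ?h n - jacobian F z $ i $ \<alpha>) \<le> 8 * M / \<delta>\<^sup>2 * (\<delta> / real (Suc n))"
          by (rule key[OF z, of "?h n", unfolded hn])
        then show "dist ((F (z + ?h n *s axis \<alpha> 1) $ i - F z $ i) / ?h n) (jacobian F z $ i $ \<alpha>) < e"
          unfolding dist_norm using elim by (rule order.strict_trans1)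
      qed
    qed
  qed
  then show thesis
    using \<delta> that by blast
qed

text \<open>\<open>mholomorphic_on\<close> asks for a derivative at each point only; continuity
  comes from the locally uniform convergence of continuous difference quotients.\<close>

lemma jacobian_continuous_on:
  fixes F :: "complex^'m \<Rightarrow> complex^'n"
  assumes S: "open S" and F: "mholomorphic_on F S"
  shows "continuous_on S (jacobian F)"
proof (intro continuous_at_imp_continuous_on ballI)
  fix z0 assume z0: "z0 \<in> S"
  have "isCont (\<lambda>z. jacobian F z $ i $ \<alpha>) z0" for i \<alpha>
  proof -
    obtain \<delta> where \<delta>: "\<delta> > 0" "cball z0 (3 * \<delta>) \<subseteq> S"
      and lim: "uniform_limit (ball z0 \<delta>) (\<lambda>n z. (F (z + of_real (\<delta> / real (Suc n)) *s axis \<alpha> 1) $ i - F z $ i) / of_real (\<delta> / real (Suc n)))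
        (\<lambda>z. jacobian F z $ i $ \<alpha>) sequentially"
      by (rule jacobian_uniform_limit[OF S z0 F, where \<alpha> = \<alpha> and i = i]) (rule that)
    have contF: "continuous_on S F"
      using mholomorphic_on_has_derivative[OF F]
      by (intro continuous_at_imp_continuous_on ballI) (rule has_derivative_continuous)
    have mem: "z + of_real (\<delta> / real (Suc n)) *s axis \<alpha> 1 \<in> S" if "z \<in> ball z0 \<delta>" for z n
    proof -
      have "\<delta> / real (Suc n) \<le> 2 * \<delta>"
        using \<delta>(1) by (simp add: divide_simps)
      then have "cmod (complex_of_real (\<delta> / real (Suc n))) \<le> 2 * \<delta>"
        using \<delta>(1) by (simp only: norm_of_real) simp
      then show ?thesis
        using add_axis_in_cball[OF that] \<delta>(2) by blast
    qed
    have "continuous_on (ball z0 \<delta>) (\<lambda>z. (F (z + of_real (\<delta> / real (Suc n)) *s axis \<alpha> 1) $ i - F z $ i) / of_real (\<delta> / real (Suc n)))" for n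
    proof -
      have 1: "continuous_on (ball z0 \<delta>) (\<lambda>z. F (z + of_real (\<delta> / real (Suc n)) *s axis \<alpha> 1))"
        using mem by (intro continuous_on_compose2[OF contF] continuous_intros) auto
      have 2: "continuous_on (ball z0 \<delta>) F"
        using \<delta> by (intro continuous_on_subset[OF contF]) (auto simp: subset_iff)
      have 3: "of_real (\<delta> / real (Suc n)) \<noteq> (0::complex)"
        unfolding of_real_eq_0_iff using \<delta>(1) by simp
      show ?thesis
        by (intro continuous_on_divide continuous_on_diff continuous_on_component 1 2 continuous_on_const ballI 3)
    qed
    then have "continuous_on (ball z0 \<delta>) (\<lambda>z. jacobian F z $ i $ \<alpha>)"
      by (intro uniform_limit_theorem[OF _ lim] always_eventually allI) simp_all
    then show ?thesis
      using \<delta>(1) by (simp add: continuous_on_eq_continuous_at)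
  qed
  then show "isCont (jacobian F) z0"
    unfolding continuous_at by (intro vec_tendstoI)
qed

text \<open>Weierstrass's theorem for the same difference quotients restricted to the line. It
  supplies the second derivatives of \<open>F\<close> that the variation of image frames
  requires.\<close>

lemma jacobian_holomorphic_along_line:
  fixes F :: "complex^'m \<Rightarrow> complex^'n"
  assumes S: "open S" "z0 \<in> S" and F: "mholomorphic_on F S"
  obtains U where "open U" "0 \<in> U" "(\<lambda>t. jacobian F (z0 + t *s v) $ i $ \<alpha>) holomorphic_on U"
proof -
  obtain \<delta> where \<delta>: "\<delta> > 0" "cball z0 (3 * \<delta>) \<subseteq> S"
    and lim: "uniform_limit (ball z0 \<delta>) (\<lambda>n z. (F (z + of_real (\<delta> / real (Suc n)) *s axis \<alpha> 1) $ i - F z $ i) / of_real (\<delta> / real (Suc n)))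
      (\<lambda>z. jacobian F z $ i $ \<alpha>) sequentially"
    by (rule jacobian_uniform_limit[OF S F, where \<alpha> = \<alpha> and i = i]) (rule that)
  let ?h = "\<lambda>n. complex_of_real (\<delta> / real (Suc n))"
  define U where "U = (\<lambda>t. z0 + t *s v) -` ball z0 \<delta>"
  have cont: "continuous_on UNIV (\<lambda>t. z0 + t *s v)"
    by (intro continuous_at_imp_continuous_on ballI has_derivative_continuous[OF has_derivative_affine_line])
  have U: "open U" "0 \<in> U"
    using \<delta>(1) open_vimage[OF open_ball cont] by (auto simp: U_def)
  have mem: "z + ?h n *s axis \<alpha> 1 \<in> S" if "z \<in> ball z0 \<delta>" for z n
  proof -
    have "\<delta> / real (Suc n) \<le> 2 * \<delta>"
      using \<delta>(1) by (simp add: divide_simps)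
    then have "cmod (complex_of_real (\<delta> / real (Suc n))) \<le> 2 * \<delta>"
      using \<delta>(1) by (simp only: norm_of_real) simp
    then show ?thesis
      using add_axis_in_cball[OF that] \<delta>(2) by blast
  qed
  have hol: "(\<lambda>t. F (z + t *s v) $ i) holomorphic_on U" if "\<And>t. t \<in> U \<Longrightarrow> z + t *s v \<in> S" for z
    unfolding holomorphic_on_open[OF U(1)]
  proof
    fix t assume "t \<in> U"
    note bounded_linear.has_derivative[OF bounded_linear_vec_nth mholomorphic_on_along_line[OF F that[OF this]], of i]
    moreover have "(\<lambda>\<tau>. (\<tau> *s (jacobian F (z + t *s v) *v v)) $ i) = (*) ((jacobian F (z + t *s v) *v v) $ i)"
      by (simp add: fun_eq_iff)
    ultimately show "\<exists>f'. ((\<lambda>t. F (z + t *s v) $ i) has_field_derivative f') (at t)"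
      unfolding has_field_derivative_def by metis
  qed
  have "(\<lambda>t. jacobian F (z0 + t *s v) $ i $ \<alpha>) holomorphic_on U"
  proof (rule holomorphic_uniform_sequence[OF U(1)])
    show "(\<lambda>t. (F (z0 + t *s v + ?h n *s axis \<alpha> 1) $ i - F (z0 + t *s v) $ i) / ?h n) holomorphic_on U" for n
    proof -
      have eq: "z0 + t *s v + ?h n *s axis \<alpha> 1 = (z0 + ?h n *s axis \<alpha> 1) + t *s v" for t
        by (simp only: add_ac)
      have "(z0 + ?h n *s axis \<alpha> 1) + t *s v \<in> S" if "t \<in> U" for t
        using mem[of "z0 + t *s v" n] that unfolding eq by (simp add: U_def)
      then have 1: "(\<lambda>t. F (z0 + t *s v + ?h n *s axis \<alpha> 1) $ i) holomorphic_on U"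
        unfolding eq by (rule hol)
      have 2: "(\<lambda>t. F (z0 + t *s v) $ i) holomorphic_on U"
        using \<delta> by (intro hol) (auto simp: U_def subset_iff)
      have 3: "?h n \<noteq> 0"
        unfolding of_real_eq_0_iff using \<delta>(1) by simp
      show ?thesis
        by (intro holomorphic_on_divide holomorphic_on_diff 1 2 holomorphic_on_const 3)
    qed
    fix t assume "t \<in> U"
    then obtain d where d: "d > 0" "cball t d \<subseteq> U"
      using U(1) open_contains_cball by blast
    moreover have "uniform_limit (cball t d) (\<lambda>n t. (F (z0 + t *s v + ?h n *s axis \<alpha> 1) $ i - F (z0 + t *s v) $ i) / ?h n)
        (\<lambda>t. jacobian F (z0 + t *s v) $ i $ \<alpha>) sequentially"
    proof (rule uniform_limitI)
      fix e :: real assume "e > 0"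
      from uniform_limitD[OF lim this]
      show "eventually (\<lambda>n. \<forall>t\<in>cball t d. dist ((F (z0 + t *s v + ?h n *s axis \<alpha> 1) $ i - F (z0 + t *s v) $ i) / ?h n)
          (jacobian F (z0 + t *s v) $ i $ \<alpha>) < e) sequentially"
        by eventually_elim (use d(2) in \<open>auto simp: U_def subset_iff\<close>)
    qed
    ultimately show "\<exists>d>0. cball t d \<subseteq> U \<and> uniform_limit (cball t d)
        (\<lambda>n t. (F (z0 + t *s v + ?h n *s axis \<alpha> 1) $ i - F (z0 + t *s v) $ i) / ?h n)
        (\<lambda>t. jacobian F (z0 + t *s v) $ i $ \<alpha>) sequentially"
      by blast
  qed
  then show thesis
    using U that by blast
qed

section \<open>Second variation\<close>

lemma has_derivative_vecI:
  fixes f :: "complex \<Rightarrow> complex^'n"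
  assumes "\<And>i. ((\<lambda>t. f t $ i) has_derivative (\<lambda>\<tau>. D \<tau> $ i)) (at t)"
  shows "(f has_derivative D) (at t)"
proof (subst has_derivative_componentwise_within, intro ballI)
  fix b :: "complex^'n" assume "b \<in> Basis"
  then obtain i u where b: "b = axis i u"
    by (auto simp: Basis_vec_def)
  show "((\<lambda>x. f x \<bullet> b) has_derivative (\<lambda>x. D x \<bullet> b)) (at t)"
    unfolding b inner_axis by (intro has_derivative_inner_left assms)
qed

lemma jet_affine: "jet (\<lambda>t. a + t * b) a b 0 0"
  unfolding jet_def by (intro exI[of _ 0]) simp

text \<open>\<open>V\<close> is the extension of \<open>E\<close> parallel at \<open>t = 0\<close>,
  so its Gram matrix in the source has no first order terms. \<open>Y i\<close> is the covariant
  derivative of the image vector along the image curve; it is the analogue of a second fundamental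
  form and does not vanish in general.\<close>

lemma second_variation:
  fixes F :: "complex^'m \<Rightarrow> complex^'n" and G :: "complex^'m \<Rightarrow> complex^'m^'m" and H :: "complex^'n \<Rightarrow> complex^'n^'n"
  assumes S: "open S" "z \<in> S" and F: "mholomorphic_on F S"
    and G: "smooth_on G S" "\<forall>w\<in>S. hermitian_posdef (G w)"
    and T: "open T" "F z \<in> T" and H: "smooth_on H T" "\<forall>w\<in>T. hermitian_posdef (H w)"
  defines "J \<equiv> jacobian F"
  shows "\<exists>V Y p q.
    (\<forall>i j. jet (\<lambda>t. herm (G (z + t *s v)) (V i t) (V j t)) (herm (G z) (E i) (E j)) 0 0 (p i j)) \<and>
    (\<forall>i. Re (p i i) = - Re (chern_R G z v v (E i) (E i))) \<and>
    (\<forall>i j. jet (\<lambda>t. herm (H (F (z + t *s v))) (J (z + t *s v) *v V i t) (J (z + t *s v) *v V j t))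
       (herm (H (F z)) (J z *v E i) (J z *v E j))
       (herm (H (F z)) (Y i) (J z *v E j)) (herm (H (F z)) (J z *v E i) (Y j)) (q i j)) \<and>
    (\<forall>i. Re (q i i) = - Re (chern_R H (F z) (J z *v v) (J z *v v) (J z *v E i) (J z *v E i))
       + Re (herm (H (F z)) (Y i) (Y i)))"
proof -
  have line: "eventually (\<lambda>t. ((\<lambda>t. z + t *s v) has_derivative (\<lambda>\<tau>. \<tau> *s v)) (at t)) (nhds 0)"
    by (intro always_eventually allI has_derivative_affine_line)
  have "((\<lambda>_. v) has_derivative (\<lambda>\<tau>. \<tau> *s 0)) (at (0::complex))"
    by simp
  from jet_metric_along_curve[OF S G(1) bspec[OF G(2)] line this]
  obtain X where X: "\<forall>W V W0 W1 V0 V1. (\<forall>k. jet (\<lambda>t. W t $ k) (W0 $ k) (W1 $ k) 0 0) \<longrightarrow>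
      (\<forall>k. jet (\<lambda>t. V t $ k) (V0 $ k) (V1 $ k) 0 0) \<longrightarrow>
      (\<exists>q. jet (\<lambda>t. herm (G (z + t *s v)) (W t) (V t)) (herm (G z) W0 V0)
        (herm (G z) (W1 + X W0) V0) (herm (G z) W0 (V1 + X V0)) q \<and>
        (W0 = V0 \<and> W1 = V1 \<longrightarrow> Re q = - Re (chern_R G z v v W0 W0)
           + Re (herm (G z) (W1 + X W0) (W1 + X W0))))"
    by auto
  \<comment> \<open>Holomorphic in \<open>t\<close>, with initial derivative
    \<open>- X (E i)\<close>: the covariant derivative \<open>W1 + X W0\<close> is then 0.\<close>
  define V where "V i t = E i + t *s (- X (E i))" for i t
  have V: "jet (\<lambda>t. V i t $ k) (E i $ k) ((- X (E i)) $ k) 0 0" for i k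
    using jet_affine[of "E i $ k" "(- X (E i)) $ k"] by (simp add: V_def)
  \<comment> \<open>The curvature clause is bound to the same witness as the expansion, so that a
    single choice of \<open>p i j\<close> serves both.\<close>
  let ?P = "\<lambda>i j p. jet (\<lambda>t. herm (G (z + t *s v)) (V i t) (V j t)) (herm (G z) (E i) (E j)) 0 0 p \<and>
      (i = j \<longrightarrow> Re p = - Re (chern_R G z v v (E i) (E i)))"
  have exp: "\<exists>p. ?P i j p" for i j
    using X[rule_format, of "V i" "E i" "- X (E i)" "V j" "E j" "- X (E j)", OF V V] by auto
  define p where "p i j = (SOME p. ?P i j p)" for i j
  have "?P i j (p i j)" for i j
    unfolding p_def by (rule someI_ex[OF exp])
  then have p: "\<And>i j. jet (\<lambda>t. herm (G (z + t *s v)) (V i t) (V j t)) (herm (G z) (E i) (E j)) 0 0 (p i j)"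
      "\<And>i. Re (p i i) = - Re (chern_R G z v v (E i) (E i))"
    by simp_all
  have Jhol: "\<exists>U. open U \<and> 0 \<in> U \<and> (\<lambda>t. J (z + t *s v) $ i $ \<alpha>) holomorphic_on U" for i \<alpha>
    unfolding J_def by (rule jacobian_holomorphic_along_line[OF S F]) blast
  define J' where "J' = (\<chi> i \<alpha>. deriv (\<lambda>t. J (z + t *s v) $ i $ \<alpha>) 0)"
  have Jjet: "jet (\<lambda>t. J (z + t *s v) $ i $ \<alpha>) (J z $ i $ \<alpha>) (J' $ i $ \<alpha>) 0 0" for i \<alpha>
    using Jhol[of i \<alpha>] jet_holomorphic[of "\<lambda>t. J (z + t *s v) $ i $ \<alpha>"] by (auto simp: J'_def)
  have Jder: "((\<lambda>t. J (z + t *s v) $ i $ \<alpha>) has_field_derivative J' $ i $ \<alpha>) (at 0)" for i \<alpha>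
    using Jhol[of i \<alpha>] holomorphic_derivI by (auto simp: J'_def)
  \<comment> \<open>The velocity \<open>J v\<close> of the image curve is differentiable, since the
    Jacobian is holomorphic along the line.\<close>
  have \<gamma>d: "((\<lambda>t. J (z + t *s v) *v v) has_derivative (\<lambda>\<tau>. \<tau> *s (J' *v v))) (at 0)"
  proof (rule has_derivative_vecI)
    fix i
    have "((\<lambda>t. \<Sum>\<alpha>\<in>UNIV. J (z + t *s v) $ i $ \<alpha> * v $ \<alpha>) has_field_derivative (\<Sum>\<alpha>\<in>UNIV. J' $ i $ \<alpha> * v $ \<alpha>)) (at 0)"
      by (intro DERIV_sum DERIV_cmult_right Jder)
    then show "((\<lambda>t. (J (z + t *s v) *v v) $ i) has_derivative (\<lambda>\<tau>. (\<tau> *s (J' *v v)) $ i)) (at 0)"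
      by (simp add: has_field_derivative_def matrix_vector_mult_def mult_commute_abs)
  qed
  have "isCont (\<lambda>t. z + t *s v) 0"
    by (rule has_derivative_continuous[OF has_derivative_affine_line])
  then have "((\<lambda>t. z + t *s v) \<longlongrightarrow> z + 0 *s v) (nhds 0)"
    unfolding isCont_def by (simp only: tendsto_at_iff_tendsto_nhds[of "\<lambda>t. z + t *s v" 0])
  then have "eventually (\<lambda>t. z + t *s v \<in> S) (nhds 0)"
    using S by (intro topological_tendstoD) simp_all
  then have \<gamma>: "eventually (\<lambda>t. ((\<lambda>t. F (z + t *s v)) has_derivative (\<lambda>\<tau>. \<tau> *s (J (z + t *s v) *v v))) (at t)) (nhds 0)"
    by eventually_elim (unfold J_def, rule mholomorphic_on_along_line[OF F])
  from jet_metric_along_curve[OF T H(1) bspec[OF H(2)] \<gamma> \<gamma>d]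
  obtain X' where X': "\<forall>W V W0 W1 V0 V1. (\<forall>k. jet (\<lambda>t. W t $ k) (W0 $ k) (W1 $ k) 0 0) \<longrightarrow>
      (\<forall>k. jet (\<lambda>t. V t $ k) (V0 $ k) (V1 $ k) 0 0) \<longrightarrow>
      (\<exists>q. jet (\<lambda>t. herm (H (F (z + t *s v))) (W t) (V t)) (herm (H (F z)) W0 V0)
        (herm (H (F z)) (W1 + X' W0) V0) (herm (H (F z)) W0 (V1 + X' V0)) q \<and>
        (W0 = V0 \<and> W1 = V1 \<longrightarrow> Re q = - Re (chern_R H (F z) (J z *v v) (J z *v v) W0 W0)
           + Re (herm (H (F z)) (W1 + X' W0) (W1 + X' W0))))"
    by auto
  define W1 where "W1 i = J z *v (- X (E i)) + J' *v E i" for i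
  have W: "jet (\<lambda>t. (J (z + t *s v) *v V i t) $ k) ((J z *v E i) $ k) (W1 i $ k) 0 0" for i k
  proof -
    have "jet (\<lambda>t. \<Sum>\<alpha>\<in>UNIV. J (z + t *s v) $ k $ \<alpha> * V i t $ \<alpha>) (\<Sum>\<alpha>\<in>UNIV. J z $ k $ \<alpha> * E i $ \<alpha>)
        (\<Sum>\<alpha>\<in>UNIV. J z $ k $ \<alpha> * (- X (E i)) $ \<alpha> + J' $ k $ \<alpha> * E i $ \<alpha>) (\<Sum>\<alpha>\<in>(UNIV::'m set). 0) (\<Sum>\<alpha>\<in>(UNIV::'m set). 0)"
      by (rule jet_sum) (use jet_mult[OF Jjet V] in simp)
    then show ?thesis
      by (simp add: matrix_vector_mult_def W1_def sum_subtractf sum_negf)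
  qed
  define Y where "Y i = W1 i + X' (J z *v E i)" for i
  let ?Q = "\<lambda>i j q. jet (\<lambda>t. herm (H (F (z + t *s v))) (J (z + t *s v) *v V i t) (J (z + t *s v) *v V j t))
       (herm (H (F z)) (J z *v E i) (J z *v E j))
       (herm (H (F z)) (Y i) (J z *v E j)) (herm (H (F z)) (J z *v E i) (Y j)) q \<and>
      (i = j \<longrightarrow> Re q = - Re (chern_R H (F z) (J z *v v) (J z *v v) (J z *v E i) (J z *v E i))
       + Re (herm (H (F z)) (Y i) (Y i)))"
  have exq: "\<exists>q. ?Q i j q" for i j
    using X'[rule_format, OF W[of i] W[of j]] by (auto simp: Y_def)
  define q where "q i j = (SOME q. ?Q i j q)" for i j
  have "?Q i j (q i j)" for i j
    unfolding q_def by (rule someI_ex[OF exq])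
  then have "\<And>i j. jet (\<lambda>t. herm (H (F (z + t *s v))) (J (z + t *s v) *v V i t) (J (z + t *s v) *v V j t))
       (herm (H (F z)) (J z *v E i) (J z *v E j))
       (herm (H (F z)) (Y i) (J z *v E j)) (herm (H (F z)) (J z *v E i) (Y j)) (q i j)"
      "\<And>i. Re (q i i) = - Re (chern_R H (F z) (J z *v v) (J z *v v) (J z *v E i) (J z *v E i))
       + Re (herm (H (F z)) (Y i) (Y i))"
    by simp_all
  with p show ?thesis
    by (intro exI[of _ V] exI[of _ Y] exI[of _ p] exI[of _ q]) simp
qed

text \<open>The value at the origin is diagonal and first order terms are absent. A permutation
  other than \<open>id\<close> moves at least two indices, so differentiating one factor still
  leaves a vanishing off-diagonal one, and only the diagonal product contributes.\<close>

lemma jet_ndet: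
  assumes A: "\<And>i j. i < l \<Longrightarrow> j < l \<Longrightarrow> jet (\<lambda>t. A t i j) (if i = j then d i else 0) 0 0 (q i j)"
  shows "jet (\<lambda>t. ndet l (A t)) (\<Prod>i<l. d i) 0 0 (\<Sum>i<l. q i i * (\<Prod>j\<in>{..<l} - {i}. d j))"
proof -
  let ?D = "\<lambda>i j. if i = j then d i else 0"
  let ?Q = "\<lambda>p. \<Sum>i<l. q i (p i) * (\<Prod>j\<in>{..<l} - {i}. ?D j (p j))"
  have "jet (\<lambda>t. ndet l (A t)) (\<Sum>p | p permutes {..<l}. of_int (sign p) * (\<Prod>i<l. ?D i (p i)))
      (\<Sum>p | p permutes {..<l}. of_int (sign p) * 0) (\<Sum>p | p permutes {..<l}. of_int (sign p) * 0)
      (\<Sum>p | p permutes {..<l}. of_int (sign p) * ?Q p)"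
    unfolding ndet_def
  proof (intro jet_sum jet_cmult jet_prod)
    fix p i assume "p \<in> {p. p permutes {..<l}}" "i \<in> {..<l}"
    then show "jet (\<lambda>t. A t i (p i)) (?D i (p i)) 0 0 (q i (p i))"
      using permutes_in_image[of p "{..<l}" i] by (intro A) auto
  qed simp
  moreover have "(\<Sum>p | p permutes {..<l}. of_int (sign p) * (\<Prod>i<l. ?D i (p i))) = (\<Prod>i<l. d i)"
    using ndet_diag[of l ?D] by (simp add: ndet_def)
  moreover have "(\<Sum>p | p permutes {..<l}. of_int (sign p) * ?Q p) = (\<Sum>p\<in>{id}. of_int (sign p) * ?Q p)"
  proof (rule sum.mono_neutral_right)
    show "\<forall>p\<in>{p. p permutes {..<l}} - {id}. of_int (sign p) * ?Q p = 0"
    proof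
      fix p assume "p \<in> {p. p permutes {..<l}} - {id}"
      then have p: "p permutes {..<l}" "p \<noteq> id" by auto
      then obtain a where a: "p a \<noteq> a"
        by (auto simp: fun_eq_iff)
      have inj: "inj p"
        using p(1) by (rule permutes_inj)
      have "(\<Prod>j\<in>{..<l} - {i}. ?D j (p j)) = 0" for i
      proof -
        \<comment> \<open>Besides \<open>a\<close>, also \<open>p a\<close> is moved, so some moved
          index differs from the omitted \<open>i\<close>.\<close>
        have "p (p a) \<noteq> p a"
          using a inj by (auto dest: injD)
        then obtain j where j: "j \<noteq> i" "p j \<noteq> j"
          using a by (cases "a = i") auto
        then have "j < l"
          using p(1) unfolding permutes_def by auto
        then show ?thesis
          using j by (intro prod_zero bexI[of _ j]) auto
      qed
      then show "of_int (sign p) * ?Q p = 0"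
        by (simp only: mult_zero_right sum.neutral_const)
    qed
  qed (auto simp: finite_permutations permutes_id)
  moreover have "?Q id = (\<Sum>i<l. q i i * (\<Prod>j\<in>{..<l} - {i}. d j))"
    by simp
  ultimately show ?thesis
    by (simp add: sign_id)
qed

lemma line_eventually_in_open:
  fixes z v :: "complex^'m"
  assumes "open S" "z \<in> S"
  shows "eventually (\<lambda>t. z + t *s v \<in> S) (at 0)"
proof -
  have "isCont (\<lambda>t. z + t *s v) 0"
    by (rule has_derivative_continuous[OF has_derivative_affine_line])
  then have "((\<lambda>t. z + t *s v) \<longlongrightarrow> z) (at 0)"
    unfolding isCont_def by simp
  then show ?thesis
    using assms by (rule topological_tendstoD)
qed

text \<open>The functional in \<open>max\<close> has the value of the trace at a unitary frame and
  is bounded on every tuple, so it can be tested on the moved frame. In the product the source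
  factor has no first order terms, and the mixed coefficient reduces to
  \<open>2 q - q - \<mu> p\<close>, summed over the diagonal.\<close>

lemma trace_second_variation:
  fixes F :: "complex^'m \<Rightarrow> complex^'n" and G :: "complex^'m \<Rightarrow> complex^'m^'m" and H :: "complex^'n \<Rightarrow> complex^'n^'n"
  assumes S: "open S" "z \<in> S" and F: "mholomorphic_on F S"
    and G: "smooth_on G S" "\<And>w. w \<in> S \<Longrightarrow> hermitian_posdef (G w)"
    and T: "open T" "F z \<in> T" and H: "smooth_on H T" "\<And>w. w \<in> T \<Longrightarrow> hermitian_posdef (H w)"
  defines "J \<equiv> jacobian F" and "B \<equiv> \<lambda>w. pullback_form (jacobian F w) (H (F w))"
  assumes E: "ortho_frame (G z) l E" "\<And>i j. i < l \<Longrightarrow> j < l \<Longrightarrow> i \<noteq> j \<Longrightarrow> herm (B z) (E i) (E j) = 0"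
    and max: "\<And>w V. w \<in> S \<Longrightarrow>
      Re ((\<Sum>i<l. 2 * herm (B w) (V i) (V i)) - (\<Sum>i<l. \<Sum>j<l. herm (G w) (V i) (V j) * herm (B w) (V j) (V i)))
        \<le> (\<Sum>i<l. Re (herm (B z) (E i) (E i)))"
  shows "(\<Sum>i<l. Re (herm (B z) (E i) (E i)) * Re (chern_R G z v v (E i) (E i)))
    \<le> (\<Sum>i<l. Re (chern_R H (F z) (J z *v v) (J z *v v) (J z *v E i) (J z *v E i)))"
proof -
  have hB: "herm (B w) x y = herm (H (F w)) (J w *v x) (J w *v y)" for w x y
    by (simp add: B_def J_def herm_pullback_form)
  have hH: "hermitian_mat (H (F z))"
    using H(2)[OF T(2)] by (rule hermitian_posdef_imp_hermitian_mat)
  define \<mu> where "\<mu> i = Re (herm (B z) (E i) (E i))" for i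
  have \<mu>: "herm (B z) (E i) (E i) = of_real (\<mu> i)" for i
    unfolding \<mu>_def hB by (rule herm_self_real[OF hH])
  have posG: "\<forall>w\<in>S. hermitian_posdef (G w)" and posH': "\<forall>w\<in>T. hermitian_posdef (H w)"
    using G(2) H(2) by blast+
  obtain V Y p q where
    p1: "\<forall>i j. jet (\<lambda>t. herm (G (z + t *s v)) (V i t) (V j t)) (herm (G z) (E i) (E j)) 0 0 (p i j)"
    and p2: "\<forall>i. Re (p i i) = - Re (chern_R G z v v (E i) (E i))"
    and q1: "\<forall>i j. jet (\<lambda>t. herm (H (F (z + t *s v))) (J (z + t *s v) *v V i t) (J (z + t *s v) *v V j t))
       (herm (H (F z)) (J z *v E i) (J z *v E j))
       (herm (H (F z)) (Y i) (J z *v E j)) (herm (H (F z)) (J z *v E i) (Y j)) (q i j)"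
    and q2: "\<forall>i. Re (q i i) = - Re (chern_R H (F z) (J z *v v) (J z *v v) (J z *v E i) (J z *v E i))
       + Re (herm (H (F z)) (Y i) (Y i))"
    using second_variation[OF S F G(1) posG T H(1) posH', of v E, folded J_def] by (elim exE conjE) (rule that)
  note p = p1[rule_format] p2[rule_format] and q = q1[rule_format] q2[rule_format]
  define u where "u t = (\<Sum>i<l. 2 * herm (B (z + t *s v)) (V i t) (V i t)) -
    (\<Sum>i<l. \<Sum>j<l. herm (G (z + t *s v)) (V i t) (V j t) * herm (B (z + t *s v)) (V j t) (V i t))" for t
  define a where "a i j = herm (H (F z)) (Y i) (J z *v E j)" for i j
  define b where "b i j = herm (H (F z)) (J z *v E i) (Y j)" for i j
  note qB = q(1)[folded hB, folded a_def b_def]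
  let ?A = "(\<Sum>i<l. 2 * a i i) + (- 1) * (\<Sum>i<l. \<Sum>j<l. herm (G z) (E i) (E j) * a j i)"
  let ?B = "(\<Sum>i<l. 2 * b i i) + (- 1) * (\<Sum>i<l. \<Sum>j<l. herm (G z) (E i) (E j) * b j i)"
  have "jet u ((\<Sum>i<l. 2 * herm (B z) (E i) (E i)) + (- 1) * (\<Sum>i<l. \<Sum>j<l. herm (G z) (E i) (E j) * herm (B z) (E j) (E i)))
    ?A ?B ((\<Sum>i<l. 2 * q i i) + (- 1) * (\<Sum>i<l. \<Sum>j<l. herm (G z) (E i) (E j) * q j i + p i j * herm (B z) (E j) (E i)))"
  proof -
    have "jet (\<lambda>t. herm (G (z + t *s v)) (V i t) (V j t) * herm (B (z + t *s v)) (V j t) (V i t))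
       (herm (G z) (E i) (E j) * herm (B z) (E j) (E i)) (herm (G z) (E i) (E j) * a j i)
       (herm (G z) (E i) (E j) * b j i) (herm (G z) (E i) (E j) * q j i + p i j * herm (B z) (E j) (E i))" for i j
      using jet_mult[OF p(1)[of i j] qB[of j i]] by simp
    from jet_add[OF jet_sum[where A = "{..<l}", OF jet_cmult[OF qB]] jet_cmult[where c = "- 1", OF jet_sum[where A = "{..<l}", OF jet_sum[where A = "{..<l}", OF this]]]]
    show ?thesis
      unfolding u_def by simp
  qed
  moreover have "(\<Sum>i<l. 2 * herm (B z) (E i) (E i)) + (- 1) * (\<Sum>i<l. \<Sum>j<l. herm (G z) (E i) (E j) * herm (B z) (E j) (E i)) =
      of_real (\<Sum>i<l. \<mu> i)"
  proof -
    have "(\<Sum>j<l. herm (G z) (E i) (E j) * herm (B z) (E j) (E i)) = of_real (\<mu> i)" if "i < l" for i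
    proof -
      have "(\<Sum>j<l. herm (G z) (E i) (E j) * herm (B z) (E j) (E i)) = (\<Sum>j<l. if j = i then of_real (\<mu> i) else 0)"
        by (rule sum.cong) (use that in \<open>auto simp: ortho_frameD[OF E(1)] \<mu>\<close>)
      then show ?thesis
        using that by simp
    qed
    then show ?thesis
      by (simp add: \<mu> sum_distrib_left[symmetric])
  qed
  moreover have "(\<Sum>i<l. 2 * q i i) + (- 1) * (\<Sum>i<l. \<Sum>j<l. herm (G z) (E i) (E j) * q j i + p i j * herm (B z) (E j) (E i)) =
      (\<Sum>i<l. q i i - of_real (\<mu> i) * p i i)"
  proof -
    have "(\<Sum>j<l. herm (G z) (E i) (E j) * q j i + p i j * herm (B z) (E j) (E i)) = q i i + p i i * of_real (\<mu> i)" if "i < l" for i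
    proof -
      have "(\<Sum>j<l. herm (G z) (E i) (E j) * q j i + p i j * herm (B z) (E j) (E i)) =
          (\<Sum>j<l. if j = i then q i i + p i i * of_real (\<mu> i) else 0)"
        by (rule sum.cong) (use that in \<open>auto simp: ortho_frameD[OF E(1)] \<mu> E(2)\<close>)
      then show ?thesis
        using that by simp
    qed
    then show ?thesis
      by (simp add: sum_distrib_left[symmetric] sum.distrib sum_subtractf mult.commute)
  qed
  ultimately have "jet u (of_real (\<Sum>i<l. \<mu> i)) ?A ?B (\<Sum>i<l. q i i - of_real (\<mu> i) * p i i)"
    by (simp only:)
  moreover have "eventually (\<lambda>t. Re (u t) \<le> Re (of_real (\<Sum>i<l. \<mu> i))) (at 0)"
    using line_eventually_in_open[OF S, of v]
  proof eventually_elim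
    case (elim t)
    show ?case
      using max[OF elim, of "\<lambda>i. V i t"] by (simp only: u_def \<mu>_def Re_complex_of_real)
  qed
  ultimately have "Re (\<Sum>i<l. q i i - of_real (\<mu> i) * p i i) \<le> 0"
    by (rule jet_local_max(1))
  then have "(\<Sum>i<l. Re (q i i) - \<mu> i * Re (p i i)) \<le> 0"
    by simp
  \<comment> \<open>The squared length of \<open>Y i\<close> in \<open>q i i\<close> is nonnegative
    and is discarded.\<close>
  moreover have "(\<Sum>i<l. \<mu> i * Re (chern_R G z v v (E i) (E i)) - Re (chern_R H (F z) (J z *v v) (J z *v v) (J z *v E i) (J z *v E i)))
     \<le> (\<Sum>i<l. Re (q i i) - \<mu> i * Re (p i i))"
    by (rule sum_mono) (use herm_self_nonneg[OF H(2)[OF T(2)]] in \<open>simp add: p(2) q(2)\<close>)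
  ultimately show ?thesis
    by (simp add: sum_subtractf \<mu>_def)
qed

text \<open>Replacing the frame by its image under \<open>1 - t C\<close> with constant \<open>C\<close> cancels the first order
  terms of the Gram matrix in the target at the cost of the factor \<open>\<bar>det (1 - t C)\<bar>\<^sup>2\<close>, whose logarithm is harmonic.\<close>

lemma det_second_variation:
  fixes F :: "complex^'m \<Rightarrow> complex^'n" and G :: "complex^'m \<Rightarrow> complex^'m^'m" and H :: "complex^'n \<Rightarrow> complex^'n^'n"
    and E :: "nat \<Rightarrow> complex^'m"
  assumes S: "open S" "z \<in> S" and F: "mholomorphic_on F S"
    and G: "smooth_on G S" "\<And>w. w \<in> S \<Longrightarrow> hermitian_posdef (G w)"
    and T: "open T" "F z \<in> T" and H: "smooth_on H T" "\<And>w. w \<in> T \<Longrightarrow> hermitian_posdef (H w)"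
  defines "J \<equiv> jacobian F" and "B \<equiv> \<lambda>w. pullback_form (jacobian F w) (H (F w))"
  defines "\<mu> \<equiv> \<lambda>i. Re (herm (B z) (E i) (E i))"
  assumes E: "ortho_frame (G z) l E" "\<And>i j. i < l \<Longrightarrow> j < l \<Longrightarrow> i \<noteq> j \<Longrightarrow> herm (B z) (E i) (E j) = 0"
    and pos: "\<And>i. i < l \<Longrightarrow> \<mu> i > 0"
    and max: "\<And>w V. w \<in> S \<Longrightarrow> Re (ndet l (gram (B w) V)) \<le> (\<Prod>i<l. \<mu> i) * Re (ndet l (gram (G w) V))"
  shows "(\<Sum>i<l. Re (chern_R G z v v (E i) (E i)))
    \<le> (\<Sum>i<l. Re (chern_R H (F z) (J z *v v) (J z *v v) (J z *v E i) (J z *v E i)) / \<mu> i)"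
proof -
  have hB: "herm (B w) x y = herm (H (F w)) (J w *v x) (J w *v y)" for w x y
    by (simp add: B_def J_def herm_pullback_form)
  have posH: "hermitian_posdef (H (F z))"
    by (rule H(2)[OF T(2)])
  have hH: "hermitian_mat (H (F z))"
    using posH by (rule hermitian_posdef_imp_hermitian_mat)
  have \<mu>: "herm (B z) (E i) (E i) = of_real (\<mu> i)" for i
    unfolding \<mu>_def hB by (rule herm_self_real[OF hH])
  have D: "herm (B z) (E i) (E j) = (if i = j then of_real (\<mu> i) else 0)" if "i < l" "j < l" for i j
    using E(2)[OF that] \<mu> by simp
  have posG: "\<forall>w\<in>S. hermitian_posdef (G w)" and posH': "\<forall>w\<in>T. hermitian_posdef (H w)"
    using G(2) H(2) by blast+
  obtain V Y p q where
    p1: "\<forall>i j. jet (\<lambda>t. herm (G (z + t *s v)) (V i t) (V j t)) (herm (G z) (E i) (E j)) 0 0 (p i j)"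
    and p2: "\<forall>i. Re (p i i) = - Re (chern_R G z v v (E i) (E i))"
    and q1: "\<forall>i j. jet (\<lambda>t. herm (H (F (z + t *s v))) (J (z + t *s v) *v V i t) (J (z + t *s v) *v V j t))
       (herm (H (F z)) (J z *v E i) (J z *v E j))
       (herm (H (F z)) (Y i) (J z *v E j)) (herm (H (F z)) (J z *v E i) (Y j)) (q i j)"
    and q2: "\<forall>i. Re (q i i) = - Re (chern_R H (F z) (J z *v v) (J z *v v) (J z *v E i) (J z *v E i))
       + Re (herm (H (F z)) (Y i) (Y i))"
    using second_variation[OF S F G(1) posG T H(1) posH', of v E, folded J_def] by (elim exE conjE) (rule that)
  note p = p1[rule_format] p2[rule_format] and q = q1[rule_format] q2[rule_format]
  define a where "a i j = herm (H (F z)) (Y i) (J z *v E j)" for i j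
  have b: "herm (H (F z)) (J z *v E i) (Y j) = cnj (a j i)" for i j
    by (simp add: a_def cnj_herm[OF hH])
  note qB = q(1)[folded hB, folded a_def, unfolded b]
  \<comment> \<open>Solves \<open>C * diag \<mu> = a\<close>, the equation under which the row
    operation \<open>1 - t C\<close> cancels the first order term of the target Gram matrix; this
    requires all \<open>\<mu> j\<close> to be nonzero.\<close>
  define C where "C i j = a i j / of_real (\<mu> j)" for i j
  have C: "C i j * of_real (\<mu> j) = a i j" if "j < l" for i j
    using pos[OF that] by (simp add: C_def)
  define N where "N t i j = (if i = j then 1 else 0) + t * (- C i j)" for t i j
  have N: "jet (\<lambda>t. N t i j) (if i = j then 1 else 0) (- C i j) 0 0" for i j
    unfolding N_def by (rule jet_affine)
  \<comment> \<open>Only rows are corrected here, which removes the term in \<open>t\<close>; the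
    term in \<open>cnj t\<close> goes when \<open>h\<close> corrects the columns.\<close>
  have K: "jet (\<lambda>t. \<Sum>k<l. N t i k * herm (B (z + t *s v)) (V k t) (V j t))
      (if i = j then of_real (\<mu> i) else 0) 0 (cnj (a j i)) (q i j - (\<Sum>k<l. C i k * cnj (a j k)))"
    if ij: "i < l" "j < l" for i j
  proof -
    note jet_sum[where A = "{..<l}" and u = "\<lambda>k t. N t i k * herm (B (z + t *s v)) (V k t) (V j t)", OF jet_mult[OF N qB]]
    moreover have "(\<Sum>k<l. (if i = k then 1 else 0) * herm (B z) (E k) (E j)) = (if i = j then of_real (\<mu> i) else 0)"
      using ij by (simp add: if_distrib[of "\<lambda>x. x * _"] D cong: if_cong)
    moreover have "(\<Sum>k<l. (if i = k then 1 else 0) * a k j + - C i k * herm (B z) (E k) (E j)) = 0"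
    proof -
      have "(\<Sum>k<l. (if i = k then 1 else 0) * a k j + - C i k * herm (B z) (E k) (E j)) =
          (\<Sum>k<l. (if k = i then a i j else 0) - (if k = j then C i j * of_real (\<mu> j) else 0))"
        by (rule sum.cong) (use ij in \<open>auto simp: D\<close>)
      then show ?thesis
        using ij by (simp add: sum_subtractf C)
    qed
    moreover have "(\<Sum>k<l. (if i = k then 1 else 0) * cnj (a j k) + 0 * herm (B z) (E k) (E j)) = cnj (a j i)"
      using ij by (simp add: if_distrib[of "\<lambda>x. x * _"] cong: if_cong)
    moreover have "(\<Sum>k<l. (if i = k then 1 else 0) * q k j + 0 * herm (B z) (E k) (E j) + (- C i k * cnj (a j k) + 0 * a k j)) =
        q i j - (\<Sum>k<l. C i k * cnj (a j k))"
      using ij by (simp add: if_distrib[of "\<lambda>x. x * _"] sum_subtractf cong: if_cong)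
    ultimately show ?thesis
      by (simp only:)
  qed
  define h where "h t i j = (\<Sum>k<l. \<Sum>m<l. N t i k * herm (B (z + t *s v)) (V k t) (V m t) * cnj (N t j m))" for t i j
  have h: "jet (\<lambda>t. h t i j) (if i = j then of_real (\<mu> i) else 0) 0 0 (q i j - (\<Sum>k<l. C i k * cnj (a j k)))"
    if ij: "i < l" "j < l" for i j
  proof -
    have eq: "h t i j = (\<Sum>m<l. (\<Sum>k<l. N t i k * herm (B (z + t *s v)) (V k t) (V m t)) * cnj (N t j m))" for t
      unfolding h_def sum_distrib_right by (rule sum.swap)
    let ?r = "\<lambda>m. q i m - (\<Sum>k<l. C i k * cnj (a m k))"
    have "jet (\<lambda>t. \<Sum>m<l. (\<Sum>k<l. N t i k * herm (B (z + t *s v)) (V k t) (V m t)) * cnj (N t j m))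
       (\<Sum>m<l. (if i = m then of_real (\<mu> i) else 0) * (if j = m then 1 else 0)) (\<Sum>m<l. 0)
       (\<Sum>m<l. (if i = m then of_real (\<mu> i) else 0) * - cnj (C j m) + cnj (a m i) * (if j = m then 1 else 0))
       (\<Sum>m<l. ?r m * (if j = m then 1 else 0))"
    proof (rule jet_sum)
      fix m assume "m \<in> {..<l}"
      then have m: "m < l" by simp
      have "jet (\<lambda>t. cnj (N t j m)) (if j = m then 1 else 0) 0 (- cnj (C j m)) 0"
        using jet_cnj[OF N[of j m]] by (simp add: if_distrib[of cnj] cong: if_cong)
      from jet_mult[OF K[OF ij(1) m] this]
      show "jet (\<lambda>t. (\<Sum>k<l. N t i k * herm (B (z + t *s v)) (V k t) (V m t)) * cnj (N t j m))
         ((if i = m then of_real (\<mu> i) else 0) * (if j = m then 1 else 0)) 0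
         ((if i = m then of_real (\<mu> i) else 0) * - cnj (C j m) + cnj (a m i) * (if j = m then 1 else 0))
         (?r m * (if j = m then 1 else 0))"
        by (simp add: add.commute)
    qed
    moreover have "(\<Sum>m<l. (if i = m then of_real (\<mu> i) else 0) * (if j = m then 1 else 0)) = (if i = j then of_real (\<mu> i) else (0::complex))"
      using ij by (simp add: if_distrib[of "\<lambda>x. x * _"] cong: if_cong)
    moreover have "(\<Sum>m<l. (if i = m then of_real (\<mu> i) else 0) * - cnj (C j m) + cnj (a m i) * (if j = m then 1 else 0)) = 0"
    proof -
      have "(\<Sum>m<l. (if i = m then of_real (\<mu> i) else 0) * - cnj (C j m) + cnj (a m i) * (if j = m then 1 else 0)) =
          (\<Sum>m<l. (if m = j then cnj (a j i) else 0) - (if m = i then cnj (C j i * of_real (\<mu> i)) else 0))"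
        by (rule sum.cong) auto
      then show ?thesis
        using ij by (simp add: sum_subtractf C)
    qed
    moreover have "(\<Sum>m<l. ?r m * (if j = m then 1 else 0)) = ?r j"
      using ij by (simp add: if_distrib[of "\<lambda>x. _ * x"] cong: if_cong)
    ultimately show ?thesis
      unfolding eq by (simp only: sum.neutral_const)
  qed
  define \<Lambda> where "\<Lambda> = (\<Prod>i<l. \<mu> i)"
  have \<Lambda>: "\<Lambda> > 0"
    unfolding \<Lambda>_def using pos by (intro prod_pos) auto
  define \<phi> where "\<phi> t = ndet l (N t)" for t
  define \<alpha> where "\<alpha> = deriv \<phi> 0"
  have "\<phi> holomorphic_on UNIV"
    unfolding \<phi>_def ndet_def N_def by (intro holomorphic_intros)
  moreover have "\<phi> 0 = 1"
    unfolding \<phi>_def by (subst ndet_diag) (simp_all add: N_def)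
  ultimately have \<phi>: "jet \<phi> 1 \<alpha> 0 0"
    using jet_holomorphic[of \<phi> UNIV] by (simp add: \<alpha>_def)
  have \<phi>\<phi>: "jet (\<lambda>t. \<phi> t * cnj (\<phi> t)) 1 \<alpha> (cnj \<alpha>) (\<alpha> * cnj \<alpha>)"
    using jet_mult[OF \<phi> jet_cnj[OF \<phi>]] by simp
  let ?r = "\<lambda>i. q i i - (\<Sum>k<l. C i k * cnj (a i k))"
  have jh: "jet (\<lambda>t. ndet l (h t)) (\<Prod>i<l. of_real (\<mu> i)) 0 0 (\<Sum>i<l. ?r i * (\<Prod>j\<in>{..<l} - {i}. of_real (\<mu> j)))"
    by (rule jet_ndet[where q = "\<lambda>i j. q i j - (\<Sum>k<l. C i k * cnj (a j k))"]) (rule h)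
  have jg: "jet (\<lambda>t. ndet l (gram (G (z + t *s v)) (\<lambda>i. V i t))) (\<Prod>i<l. 1) 0 0 (\<Sum>i<l. p i i * (\<Prod>j\<in>{..<l} - {i}. 1))"
  proof (rule jet_ndet[where d = "\<lambda>_. 1" and q = p])
    fix i j assume "i < l" "j < l"
    then show "jet (\<lambda>t. gram (G (z + t *s v)) (\<lambda>i. V i t) i j) (if i = j then 1 else 0) 0 0 (p i j)"
      using p(1)[of i j] by (simp only: ortho_frameD[OF E(1)])
  qed
  \<comment> \<open>The common factor \<open>\<phi> * cnj \<phi>\<close> multiplies both
    determinants, so \<open>Re u\<close> is a nonnegative multiple of the difference controlled by
    \<open>max\<close>, and \<open>u\<close> vanishes at \<open>t = 0\<close> to leading
    order.\<close>
  define u where "u t = ndet l (h t) + - of_real \<Lambda> * (\<phi> t * cnj (\<phi> t) * ndet l (gram (G (z + t *s v)) (\<lambda>i. V i t)))" for t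
  have "(\<Sum>i<l. ?r i * (\<Prod>j\<in>{..<l} - {i}. of_real (\<mu> j))) = of_real \<Lambda> * (\<Sum>i<l. ?r i / of_real (\<mu> i))"
    unfolding sum_distrib_left
  proof (rule sum.cong[OF refl])
    fix i assume i: "i \<in> {..<l}"
    have "of_real \<Lambda> = of_real (\<mu> i) * (\<Prod>j\<in>{..<l} - {i}. complex_of_real (\<mu> j))"
      unfolding \<Lambda>_def of_real_prod using i by (intro prod.remove) auto
    then show "?r i * (\<Prod>j\<in>{..<l} - {i}. of_real (\<mu> j)) = of_real \<Lambda> * (?r i / of_real (\<mu> i))"
      using pos[of i] i by simp
  qed
  then have ju: "jet u 0 (- of_real \<Lambda> * \<alpha>) (- of_real \<Lambda> * cnj \<alpha>)
      (of_real \<Lambda> * ((\<Sum>i<l. ?r i / of_real (\<mu> i)) - (\<Sum>i<l. p i i) - \<alpha> * cnj \<alpha>))"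
    using jet_add[OF jh jet_cmult[OF jet_mult[OF \<phi>\<phi> jg], of "- of_real \<Lambda>"]]
    by (simp add: u_def[abs_def] \<Lambda>_def of_real_prod algebra_simps)
  have "eventually (\<lambda>t. Re (u t) \<le> Re 0) (at 0)"
    using line_eventually_in_open[OF S, of v]
  proof eventually_elim
    case (elim t)
    have "ndet l (h t) = of_real ((cmod (\<phi> t))\<^sup>2) * ndet l (gram (B (z + t *s v)) (\<lambda>i. V i t))"
      unfolding h_def \<phi>_def by (rule ndet_congruence)
    moreover have "\<phi> t * cnj (\<phi> t) = of_real ((cmod (\<phi> t))\<^sup>2)"
      by (rule complex_norm_square[symmetric])
    ultimately have "Re (u t) = (cmod (\<phi> t))\<^sup>2 * (Re (ndet l (gram (B (z + t *s v)) (\<lambda>i. V i t)))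
        - \<Lambda> * Re (ndet l (gram (G (z + t *s v)) (\<lambda>i. V i t))))"
      by (simp add: u_def algebra_simps del: of_real_power)
    moreover have "\<dots> \<le> 0"
      using max[OF elim, of "\<lambda>i. V i t"] by (simp add: \<Lambda>_def mult_nonneg_nonpos)
    ultimately show ?case
      by simp
  qed
  note M = jet_local_max[OF ju this]
  \<comment> \<open>The first order condition at the maximum; without it the mixed term
    \<open>\<alpha> * cnj \<alpha>\<close> of the common factor would remain with the wrong
    sign.\<close>
  have "\<alpha> = 0"
    using M(2) \<Lambda> by simp
  then have "Re ((\<Sum>i<l. ?r i / of_real (\<mu> i)) - (\<Sum>i<l. p i i)) \<le> 0"
    using M(1) \<Lambda> by (simp add: mult_le_0_iff)
  then have 1: "(\<Sum>i<l. Re (?r i) / \<mu> i) - (\<Sum>i<l. Re (p i i)) \<le> 0"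
    by (simp add: Re_divide_of_real)
  \<comment> \<open>The subtracted sum is the squared length of the projection of \<open>Y i\<close>
    to the span of the normalized image vectors \<open>e k\<close>, so Bessel's inequality keeps the
    remainder nonnegative.\<close>
  have "- Re (chern_R H (F z) (J z *v v) (J z *v v) (J z *v E i) (J z *v E i)) \<le> Re (?r i)" if i: "i < l" for i
  proof -
    define e where "e k = of_real (1 / sqrt (\<mu> k)) *s (J z *v E k)" for k
    have "ortho_frame (H (F z)) l e"
      unfolding ortho_frame_def
    proof (intro allI impI)
      fix k m assume "k < l" "m < l"
      then show "herm (H (F z)) (e k) (e m) = (if k = m then 1 else 0)"
        using D[of k m] pos[of k] unfolding e_def herm_scale_left herm_scale_right hB
        by (auto simp flip: of_real_mult of_real_divide)
    qed
    from bessel[OF posH this, of "Y i"]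
    have "(\<Sum>k<l. (cmod (herm (H (F z)) (Y i) (e k)))\<^sup>2) \<le> Re (herm (H (F z)) (Y i) (Y i))" .
    moreover have "(cmod (herm (H (F z)) (Y i) (e k)))\<^sup>2 = Re (C i k * cnj (a i k))" if "k < l" for k
    proof -
      have "C i k * cnj (a i k) = of_real ((cmod (a i k))\<^sup>2 / \<mu> k)"
        unfolding of_real_divide complex_norm_square by (simp add: C_def)
      then show ?thesis
        using pos[OF that] unfolding e_def herm_scale_right a_def[symmetric]
        by (simp add: norm_mult norm_divide power_divide)
    qed
    ultimately show ?thesis
      by (simp add: q(2))
  qed
  then have "(\<Sum>i<l. - Re (chern_R H (F z) (J z *v v) (J z *v v) (J z *v E i) (J z *v E i)) / \<mu> i) \<le> (\<Sum>i<l. Re (?r i) / \<mu> i)"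
    using pos by (intro sum_mono divide_right_mono) (auto simp: less_imp_le)
  then show ?thesis
    using 1 by (simp add: p(2) sum_negf)
qed

section \<open>Maximum principle on the frame bundle\<close>

lemma chart_inv_apply: "is_chart c \<Longrightarrow> x \<in> fst c \<Longrightarrow> chart_inv c (snd c x) = x"
  unfolding is_chart_def by (meson homeomorphism_apply1)

lemma open_chart_image:
  assumes "is_chart c" "open W" "W \<subseteq> fst c"
  shows "open (snd c ` W)"
proof -
  have "openin (top_of_set (fst c)) W"
    using assms(2,3) by (simp add: openin_open_eq assms(1)[unfolded is_chart_def])
  then have "openin (top_of_set (snd c ` fst c)) (snd c ` W)"
    using assms(1) unfolding is_chart_def by (meson homeomorphism_imp_open_map)
  then show ?thesis
    using assms(1) openin_open_trans unfolding is_chart_def by blast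
qed

lemma smooth_on_imp_continuous_on: "smooth_on F S \<Longrightarrow> continuous_on S F"
  unfolding smooth_on_def by (drule spec[of _ 0]) simp

lemma jacobian_eqI:
  fixes F :: "complex^'m \<Rightarrow> complex^'n"
  assumes "(F has_derivative (\<lambda>v. A *v v)) (at z)"
  shows "jacobian F z = A"
proof -
  have "mholomorphic_on F {z}"
    unfolding mholomorphic_on_def using assms by (auto simp: vec.scale)
  then have "(F has_derivative (\<lambda>v. jacobian F z *v v)) (at z)"
    by (rule mholomorphic_on_has_derivative) simp
  then have "(\<lambda>v. jacobian F z *v v) = (\<lambda>v. A *v v)"
    using assms by (rule has_derivative_unique)
  then show ?thesis
    by (simp add: matrix_eq fun_eq_iff)
qed

text \<open>The chain rule. Continuity of \<open>f\<close> makes the coordinate set on which the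
  representatives compose open, so the composition formula holds near the point.\<close>

lemma tangent_map_comp:
  assumes c: "is_chart c" "x \<in> fst c" and d: "is_chart d" "f x \<in> fst d" and e: "k (f x) \<in> fst e"
    and f: "continuous_on UNIV f" "mholomorphic_on (local_rep c d f) (snd c ` (fst c \<inter> f -` fst d))"
    and k: "mholomorphic_on (local_rep d e k) (snd d ` (fst d \<inter> k -` fst e))"
  shows "tangent_map c e (k \<circ> f) x = tangent_map d e k (f x) ** tangent_map c d f x"
proof -
  let ?V = "snd c ` (fst c \<inter> f -` fst d)"
  have "open (fst c \<inter> f -` fst d)"
    using c(1) d(1) f(1) unfolding is_chart_def by (blast intro: open_Int open_vimage)
  then have V: "open ?V" "snd c x \<in> ?V"
    using c d open_chart_image[OF c(1)] by auto
  have 1: "(local_rep c d f has_derivative (\<lambda>v. tangent_map c d f x *v v)) (at (snd c x))"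
    unfolding tangent_map_def using f(2) V(2) by (rule mholomorphic_on_has_derivative)
  have fx: "local_rep c d f (snd c x) = snd d (f x)"
    by (simp add: local_rep_def chart_inv_apply c)
  have 2: "(local_rep d e k has_derivative (\<lambda>v. tangent_map d e k (f x) *v v)) (at (local_rep c d f (snd c x)))"
    unfolding tangent_map_def fx using k d e by (intro mholomorphic_on_has_derivative) auto
  from has_derivative_compose[OF 1 2]
  have "(local_rep c e (k \<circ> f) has_derivative
      (\<lambda>v. tangent_map d e k (f x) *v (tangent_map c d f x *v v))) (at (snd c x))"
  proof (rule has_derivative_transform_within_open[OF _ V])
    fix z assume "z \<in> ?V"
    then obtain y where "y \<in> fst c" "f y \<in> fst d" "z = snd c y"
      by auto
    then show "local_rep d e k (local_rep c d f z) = local_rep c e (k \<circ> f) z"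
      using c(1) d(1) by (simp add: local_rep_def chart_inv_apply)
  qed
  then show ?thesis
    unfolding tangent_map_def[of c e] by (intro jacobian_eqI) (simp add: matrix_vector_mul_assoc)
qed

lemma smooth_on_subset: "smooth_on F S \<Longrightarrow> S' \<subseteq> S \<Longrightarrow> smooth_on F S'"
proof -
  have "Ck_on k F S \<Longrightarrow> S' \<subseteq> S \<Longrightarrow> Ck_on k F S'" for k
    by (induction k arbitrary: F) (auto intro: continuous_on_subset)
  then show "smooth_on F S \<Longrightarrow> S' \<subseteq> S \<Longrightarrow> smooth_on F S'"
    unfolding smooth_on_def by blast
qed

lemma chern_R_scale: "chern_R G z (a *s u) (a *s u) (b *s w) (b *s w) =
    of_real ((cmod a)\<^sup>2 * (cmod b)\<^sup>2) * chern_R G z u u w w"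
  unfolding chern_R_def of_real_mult complex_norm_square
  by (simp add: sum_distrib_left mult_ac)

text \<open>Repeated Gram-Schmidt. Real bisectional curvature is tested on full frames, whereas the
  image of a source frame supplies at most \<open>l\<close> vectors.\<close>

lemma ortho_frame_extend:
  fixes G :: "complex^'m^'m"
  assumes G: "hermitian_posdef G" and E: "ortho_frame G k E" and k: "k \<le> CARD('m)"
  obtains E' where "ortho_frame G CARD('m) E'" "\<And>i. i < k \<Longrightarrow> E' i = E i"
proof -
  have hG: "hermitian_mat G"
    using G by (rule hermitian_posdef_imp_hermitian_mat)
  have "\<exists>E'. ortho_frame G n E' \<and> (\<forall>i<k. E' i = E i)" if "k \<le> n" "n \<le> CARD('m)" for n
    using that
  proof (induction n rule: dec_induct)
    case base
    then show ?case using E by blast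
  next
    case (step n)
    then obtain E' where E': "ortho_frame G n E'" "\<forall>i<k. E' i = E i"
      by (meson Suc_leD)
    have "n < vec.dim (UNIV :: (complex^'m) set)"
      unfolding vec_dim_card using step.prems by simp
    then obtain w where w: "w \<noteq> 0" "\<And>i. i < n \<Longrightarrow> herm G w (E' i) = 0"
      using exists_orthogonal_vector[OF G E'(1), of UNIV] vec.subspace_UNIV by auto
    define e where "e = complex_of_real (1 / sqrt (Re (herm G w w))) *s w"
    have "herm G e e = of_real (1 / sqrt (Re (herm G w w)) * (1 / sqrt (Re (herm G w w))) * Re (herm G w w))"
      unfolding e_def herm_scale_left herm_scale_right of_real_mult herm_self_real[OF hG, symmetric]
      by (simp add: mult_ac)
    also have "\<dots> = 1"
      using herm_self_pos[OF G w(1)] by (simp add: real_div_sqrt field_simps)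
    finally have e: "herm G e e = 1" "herm G e (E' i) = 0" "herm G (E' i) e = 0" if "i < n" for i
      using w(2)[OF that] cnj_herm[OF hG, of w "E' i"] by (auto simp: e_def herm_linear)
    moreover have "herm G e e = 1"
      using \<open>herm G e e = _\<close> \<open>_ = 1\<close> by simp
    ultimately have "ortho_frame G (Suc n) (E'(n := e))"
      using E'(1) by (auto simp: ortho_frame_def less_Suc_eq)
    moreover have "\<forall>i<k. (E'(n := e)) i = E i"
      using E'(2) step.hyps by simp
    ultimately show ?case by blast
  qed
  then show thesis
    using that k by blast
qed

text \<open>Arithmetic against geometric mean, raised to the power \<open>l\<close> so that the
  bound is free of roots.\<close>

lemma prod_le_mean_power:
  fixes x :: "nat \<Rightarrow> real"
  assumes "l > 0" "\<And>i. i < l \<Longrightarrow> x i \<ge> 0"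
  shows "(\<Prod>i<l. x i) \<le> ((\<Sum>i<l. x i) / real l) ^ l"
proof -
  let ?P = "\<Prod>i<l. x i"
  have P: "?P \<ge> 0"
    using assms(2) by (intro prod_nonneg) auto
  have "?P powr (1 / real l) \<le> (\<Sum>i<l. x i) / real l"
    using arith_geom_mean[of "{..<l}" x] assms by (simp add: sum_divide_distrib lessThan_empty_iff)
  then have "(?P powr (1 / real l)) ^ l \<le> ((\<Sum>i<l. x i) / real l) ^ l"
    by (intro power_mono) auto
  moreover have "(y powr (1 / real l)) ^ l = y" if "y \<ge> 0" for y :: real
    using that assms(1) by (cases "y = 0") (auto simp: powr_powr simp flip: powr_realpow)
  note this[OF P]
  ultimately show ?thesis
    by simp
qed

section \<open>Metrics and tangent maps under a change of charts\<close>

abbreviation target_form ::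
  "('b, 'n::finite) metric \<Rightarrow> ('a, 'm::finite) chart \<Rightarrow> ('b, 'n) chart \<Rightarrow> ('a \<Rightarrow> 'b) \<Rightarrow> 'a \<Rightarrow> complex^'m^'m" where
  "target_form h c d f x \<equiv> pullback_form (tangent_map c d f x) (h d (snd d (f x)))"

abbreviation source_form :: "('a, 'm::finite) metric \<Rightarrow> ('a, 'm) chart \<Rightarrow> 'a \<Rightarrow> complex^'m^'m" where
  "source_form g c x \<equiv> g c (snd c x)"

context
  fixes \<A> :: "('a::{t2_space,second_countable_topology}, 'm::finite) chart set"
    and \<B> :: "('b::{t2_space,second_countable_topology}, 'n::finite) chart set"
    and g :: "('a, 'm) metric" and h :: "('b, 'n) metric" and f :: "'a \<Rightarrow> 'b"
  assumes M: "hermitian_manifold \<A> g" and N: "hermitian_manifold \<B> h"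
    and f: "holomorphic_map \<A> \<B> f"
begin

lemma source_change:
  assumes "c \<in> \<A>" "c' \<in> \<A>" "x \<in> fst c" "x \<in> fst c'"
  shows "herm (source_form g c x) v w =
    herm (source_form g c' x) (tangent_map c c' id x *v v) (tangent_map c c' id x *v w)"
proof -
  have "source_form g c x = pullback_form (tangent_map c c' id x) (source_form g c' x)"
    using M assms unfolding hermitian_manifold_def hermitian_metric_def by blast
  then show ?thesis
    by (simp add: herm_pullback_form)
qed

text \<open>The derivative of \<open>f\<close> from chart \<open>c\<close> to chart
  \<open>d'\<close> factors through \<open>d\<close> and through \<open>c'\<close>; equating the two
  gives the compatibility \<open>J\<close>.\<close>

lemma target_change:
  assumes "c \<in> \<A>" "c' \<in> \<A>" "x \<in> fst c" "x \<in> fst c'"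
    and "d \<in> \<B>" "d' \<in> \<B>" "f x \<in> fst d" "f x \<in> fst d'"
  shows "herm (target_form h c d f x) v w =
    herm (target_form h c' d' f x) (tangent_map c c' id x *v v) (tangent_map c c' id x *v w)"
proof -
  have ch: "is_chart c" "is_chart c'" "is_chart d" "is_chart d'"
    using M N assms unfolding hermitian_manifold_def complex_manifold_def by blast+
  have f': "continuous_on UNIV f" "\<And>c d. c \<in> \<A> \<Longrightarrow> d \<in> \<B> \<Longrightarrow> mholomorphic_on (local_rep c d f) (snd c ` (fst c \<inter> f -` fst d))"
    using f unfolding holomorphic_map_def by blast+
  have idA: "mholomorphic_on (local_rep c c' id) (snd c ` (fst c \<inter> id -` fst c'))"
    using M assms unfolding hermitian_manifold_def complex_manifold_def by simp
  have idB: "mholomorphic_on (local_rep d d' id) (snd d ` (fst d \<inter> id -` fst d'))"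
    using N assms unfolding hermitian_manifold_def complex_manifold_def by simp
  have "tangent_map c d' (id \<circ> f) x = tangent_map d d' id (f x) ** tangent_map c d f x"
    using assms ch f' idB by (intro tangent_map_comp) auto
  moreover have "tangent_map c d' (f \<circ> id) x = tangent_map c' d' f (id x) ** tangent_map c c' id x"
    using assms ch f' idA by (intro tangent_map_comp) (auto simp: continuous_on_id[unfolded id_def] id_def)
  ultimately have J: "tangent_map d d' id (f x) ** tangent_map c d f x = tangent_map c' d' f x ** tangent_map c c' id x"
    by simp
  have "h d (snd d (f x)) = pullback_form (tangent_map d d' id (f x)) (h d' (snd d' (f x)))"
    using N assms unfolding hermitian_manifold_def hermitian_metric_def by blast
  then show ?thesis
    by (simp add: herm_pullback_form matrix_vector_mul_assoc J)
qed

lemma chart_domain_open: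
  assumes "c \<in> \<A>" "d \<in> \<B>"
  shows "open (snd c ` (fst c \<inter> f -` fst d))"
proof (rule open_chart_image)
  show "is_chart c"
    using M assms unfolding hermitian_manifold_def complex_manifold_def by blast
  have "is_chart d" "continuous_on UNIV f"
    using N f assms unfolding hermitian_manifold_def complex_manifold_def holomorphic_map_def by blast+
  then show "open (fst c \<inter> f -` fst d)"
    using \<open>is_chart c\<close> unfolding is_chart_def by (blast intro: open_Int open_vimage)
qed auto

lemma local_rep_in_chart:
  assumes "c \<in> \<A>" "z \<in> snd c ` (fst c \<inter> f -` fst d)"
  shows "local_rep c d f z \<in> snd d ` fst d"
proof -
  have "is_chart c"
    using M assms unfolding hermitian_manifold_def complex_manifold_def by blast
  then show ?thesis
    using assms(2) by (auto simp: local_rep_def chart_inv_apply)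
qed

text \<open>An \<open>l\<close>-frame is stored at the positions \<open>\<kappa> 0, \<dots>, \<kappa> (l - 1)\<close> of a vector of
  vectors, padded by zero, in order to live in a Euclidean space.\<close>

lemma compact_unitary_frames:
  fixes G :: "complex^'m \<Rightarrow> complex^'m^'m" and \<kappa> :: "nat \<Rightarrow> 'm"
  assumes K: "compact K" and G: "continuous_on K G" "\<And>z. z \<in> K \<Longrightarrow> hermitian_posdef (G z)"
  shows "compact {y :: (complex^'m) \<times> ((complex^'m)^'m). fst y \<in> K \<and> ortho_frame (G (fst y)) l (\<lambda>i. snd y $ \<kappa> i) \<and>
    (\<forall>a. a \<notin> \<kappa> ` {..<l} \<longrightarrow> snd y $ a = 0)}" (is "compact ?F")
proof -
  \<comment> \<open>Coercivity bounds every vector of a unitary frame by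
    \<open>sqrt (1 / c)\<close>, uniformly over \<open>K\<close>.\<close>
  obtain c where c: "c > 0" "\<And>z v. z \<in> K \<Longrightarrow> c * (norm v)\<^sup>2 \<le> Re (herm (G z) v v)"
    by (rule herm_coercive[OF K G]) blast+
  let ?S = "K \<times> (UNIV :: ((complex^'m)^'m) set)"
  let ?g = "\<lambda>i j (y :: (complex^'m) \<times> ((complex^'m)^'m)). herm (G (fst y)) (snd y $ \<kappa> i) (snd y $ \<kappa> j)"
  have "closed ?S"
    by (intro closed_Times compact_imp_closed K closed_UNIV)
  moreover have "continuous_on ?S (?g i j)" for i j
    by (intro continuous_intros continuous_on_compose2[OF G(1)]) auto
  ultimately have cl: "closed (?S \<inter> ?g i j -` {\<delta>})" for i j \<delta>
    by (intro continuous_closed_preimage) simp_all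
  have "closed (?S \<inter> (\<Inter>i\<in>{..<l}. \<Inter>j\<in>{..<l}. ?S \<inter> ?g i j -` {if i = j then 1 else 0}) \<inter>
      (\<Inter>a\<in>- \<kappa> ` {..<l}. {y. snd y $ a = 0}))"
    by (intro closed_Int \<open>closed ?S\<close> closed_INT ballI cl closed_Collect_eq continuous_intros)
  also have "?S \<inter> (\<Inter>i\<in>{..<l}. \<Inter>j\<in>{..<l}. ?S \<inter> ?g i j -` {if i = j then 1 else 0}) \<inter>
      (\<Inter>a\<in>- \<kappa> ` {..<l}. {y. snd y $ a = 0}) = ?F"
    by (auto simp: ortho_frame_def)
  finally have "closed ?F" .
  moreover have "bounded ?F"
  proof (rule bounded_subset[OF bounded_Times])
    show "bounded K"
      using K by (rule compact_imp_bounded)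
    show "bounded (cball (0 :: (complex^'m)^'m) (\<Sum>a\<in>(UNIV::'m set). sqrt (1 / c)))"
      by (rule bounded_cball)
    show "?F \<subseteq> K \<times> cball 0 (\<Sum>a\<in>(UNIV::'m set). sqrt (1 / c))"
    proof
      fix y assume y: "y \<in> ?F"
      have "norm (snd y $ a) \<le> sqrt (1 / c)" for a
      proof (cases "a \<in> \<kappa> ` {..<l}")
        case True
        then obtain i where i: "i < l" "a = \<kappa> i" by auto
        have "c * (norm (snd y $ a))\<^sup>2 \<le> 1"
          using c(2)[of "fst y" "snd y $ a"] y i by (auto simp: ortho_frame_def)
        then show ?thesis
          using c(1) by (intro real_le_rsqrt) (simp add: pos_le_divide_eq mult.commute)
      next
        case False
        then show ?thesis
          using y c(1) by simp
      qed
      then have "norm (snd y) \<le> (\<Sum>a\<in>(UNIV::'m set). sqrt (1 / c))"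
        unfolding norm_vec_def[of "snd y"] by (intro order_trans[OF L2_set_le_sum] sum_mono) simp_all
      then show "y \<in> K \<times> cball 0 (\<Sum>a\<in>(UNIV::'m set). sqrt (1 / c))"
        using y by (cases y) auto
    qed
  qed
  ultimately show ?thesis
    by (simp add: compact_eq_bounded_closed)
qed

section \<open>Existence of a maximizing frame\<close>

definition admissible :: "nat \<Rightarrow> 'a \<Rightarrow> ('a, 'm) chart \<Rightarrow> ('b, 'n) chart \<Rightarrow> (nat \<Rightarrow> complex^'m) \<Rightarrow> bool" where
  "admissible l x c d E \<longleftrightarrow> c \<in> \<A> \<and> d \<in> \<B> \<and> x \<in> fst c \<and> f x \<in> fst d \<and> ortho_frame (source_form g c x) l E"

lemma exists_ortho_frame:
  fixes G :: "complex^'m^'m"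
  assumes "hermitian_posdef G" "l \<le> CARD('m)"
  obtains E where "ortho_frame G l E"
proof -
  have "hermitian_mat G"
    using assms(1) by (rule hermitian_posdef_imp_hermitian_mat)
  then show thesis
    by (rule exists_span_frame[OF assms(1) _ assms(2)]) (erule that)
qed

text \<open>Over a closed coordinate ball the unitary frames form a compact set. The maximizer
  \<open>x0\<close> may lie on the boundary of the ball and outside \<open>U\<close>; it suffices
  that its frame is admissible. \<open>\<Phi>_cong\<close> says that only the \<open>l\<close> by
  \<open>l\<close> block matters, so the stored frame may differ from the given one beyond
  \<open>l\<close>.\<close>

lemma local_maximum:
  fixes \<Phi> :: "(nat \<Rightarrow> nat \<Rightarrow> complex) \<Rightarrow> real"
  assumes l: "l \<le> CARD('m)" and \<Phi>: "continuous_on UNIV \<Phi>"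
    and \<Phi>_cong: "\<And>A A'. (\<And>i j. i < l \<Longrightarrow> j < l \<Longrightarrow> A i j = A' i j) \<Longrightarrow> \<Phi> A = \<Phi> A'"
    and cd: "c \<in> \<A>" "d \<in> \<B>" "p \<in> fst c" "f p \<in> fst d"
  obtains U x0 E0 where "open U" "p \<in> U" "admissible l x0 c d E0"
    "\<And>x E. x \<in> U \<Longrightarrow> x \<in> fst c \<and> f x \<in> fst d"
    "\<And>x E. x \<in> U \<Longrightarrow> admissible l x c d E \<Longrightarrow>
       \<Phi> (gram (target_form h c d f x) E) \<le> \<Phi> (gram (target_form h c d f x0) E0)"
proof -
  let ?V = "snd c ` (fst c \<inter> f -` fst d)"
  define F where "F = local_rep c d f"
  have ch: "is_chart c" "is_chart d"
    using M N cd unfolding hermitian_manifold_def complex_manifold_def by blast+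
  have F: "mholomorphic_on F ?V"
    using f cd unfolding F_def holomorphic_map_def by blast
  have V: "open ?V" "snd c p \<in> ?V"
    using chart_domain_open cd by auto
  obtain r where r: "r > 0" "cball (snd c p) r \<subseteq> ?V"
    using V open_contains_cball by blast
  let ?K = "cball (snd c p) r"
  have inv: "snd c (chart_inv c z) = z" "chart_inv c z \<in> fst c" "f (chart_inv c z) \<in> fst d" if "z \<in> ?V" for z
    using that ch(1) by (auto simp: chart_inv_apply)
  have contF: "continuous_on ?V F"
    using mholomorphic_on_has_derivative[OF F]
    by (intro continuous_at_imp_continuous_on ballI) (rule has_derivative_continuous)
  have contg: "continuous_on (snd c ` fst c) (g c)" "continuous_on (snd d ` fst d) (h d)"
  proof -
    have "smooth_on (g c) (snd c ` fst c)" "smooth_on (h d) (snd d ` fst d)"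
      using M N cd unfolding hermitian_manifold_def hermitian_metric_def by blast+
    then show "continuous_on (snd c ` fst c) (g c)" "continuous_on (snd d ` fst d) (h d)"
      by (simp_all add: smooth_on_imp_continuous_on)
  qed
  have posg: "hermitian_posdef (g c z)" if "z \<in> ?V" for z
    using M cd that unfolding hermitian_manifold_def hermitian_metric_def by blast
  have gK: "continuous_on ?K (g c)"
    using contg(1) by (rule continuous_on_subset) (use r in auto)
  have hK: "continuous_on ?K (\<lambda>z. h d (F z))"
    by (rule continuous_on_compose2[OF contg(2) continuous_on_subset[OF contF r(2)]])
       (use local_rep_in_chart[OF cd(1), where d = d] r(2) in \<open>unfold F_def, blast\<close>)
  have JK: "continuous_on ?K (jacobian F)"
    by (rule continuous_on_subset[OF jacobian_continuous_on[OF V(1) F] r(2)])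
  obtain \<kappa> where \<kappa>: "bij_betw \<kappa> {..<CARD('m)} (UNIV :: 'm set)"
    using exists_index bij_betw_inv by metis
  have inj: "inj_on \<kappa> {..<l}"
    using \<kappa> l by (auto simp: bij_betw_def inj_on_def)
  let ?Fr = "{y :: (complex^'m) \<times> ((complex^'m)^'m). fst y \<in> ?K \<and> ortho_frame (g c (fst y)) l (\<lambda>i. snd y $ \<kappa> i) \<and>
    (\<forall>a. a \<notin> \<kappa> ` {..<l} \<longrightarrow> snd y $ a = 0)}"
  let ?\<Psi> = "\<lambda>y :: (complex^'m) \<times> ((complex^'m)^'m). \<Phi> (\<lambda>i j. herm (h d (F (fst y))) (jacobian F (fst y) *v (snd y $ \<kappa> i)) (jacobian F (fst y) *v (snd y $ \<kappa> j)))"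
  have Fr: "compact ?Fr"
    by (rule compact_unitary_frames[OF compact_cball gK]) (use posg r in blast)
  have mem: "(z, \<chi> a. if a \<in> \<kappa> ` {..<l} then E (the_inv_into {..<l} \<kappa> a) else 0) \<in> ?Fr"
    if "z \<in> ?K" "ortho_frame (g c z) l E" for z E
    using that by (auto simp: ortho_frame_def the_inv_into_f_f[OF inj])
  have \<Psi>: "?\<Psi> (z, \<chi> a. if a \<in> \<kappa> ` {..<l} then E (the_inv_into {..<l} \<kappa> a) else 0) =
      \<Phi> (gram (pullback_form (jacobian F z) (h d (F z))) E)" for z E
    by (rule \<Phi>_cong) (simp add: the_inv_into_f_f[OF inj] herm_pullback_form)
  have "?Fr \<noteq> {}"
  proof -
    obtain E where "ortho_frame (g c (snd c p)) l E"
      using exists_ortho_frame[OF posg[OF V(2)] l] .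
    then show ?thesis
      using mem[of "snd c p" E] r(1) by (metis centre_in_cball empty_iff less_imp_le)
  qed
  moreover have "continuous_on ?Fr ?\<Psi>"
  \<comment> \<open>Functions of two indices carry the product topology, so continuity of the Gram
    matrix is continuity of each entry.\<close>
  proof (rule continuous_on_compose2[OF \<Phi> _ subset_UNIV], rule continuous_on_coordinatewise_then_product, rule continuous_on_coordinatewise_then_product)
    fix i j
    have mv: "continuous_on ?Fr (\<lambda>y. jacobian F (fst y) *v (snd y $ \<kappa> k))" for k
      unfolding matrix_vector_mult_def
      by (intro continuous_intros continuous_on_vec_lambda continuous_on_compose2[OF JK]) auto
    show "continuous_on ?Fr (\<lambda>y. herm (h d (F (fst y))) (jacobian F (fst y) *v (snd y $ \<kappa> i)) (jacobian F (fst y) *v (snd y $ \<kappa> j)))"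
      by (intro continuous_on_herm mv continuous_on_compose2[OF hK] continuous_intros) auto
  qed
  ultimately obtain y where y: "y \<in> ?Fr" and max: "\<forall>y'\<in>?Fr. ?\<Psi> y' \<le> ?\<Psi> y"
    using continuous_attains_sup[OF Fr] by blast
  define x0 where "x0 = chart_inv c (fst y)"
  have x0: "snd c x0 = fst y" "x0 \<in> fst c" "f x0 \<in> fst d"
    using inv[of "fst y"] y r(2) by (auto simp: x0_def)
  have tf: "target_form h c d f x = pullback_form (jacobian F (snd c x)) (h d (F (snd c x)))" if "x \<in> fst c" for x
    using that ch(1) by (simp add: tangent_map_def F_def local_rep_def chart_inv_apply)
  show thesis
  proof
    have "open (fst c)" "continuous_on (fst c) (snd c)"
      using ch(1) unfolding is_chart_def homeomorphism_def by blast+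
    then show "open (fst c \<inter> snd c -` ball (snd c p) r)"
      by (intro continuous_open_preimage) auto
    show "p \<in> fst c \<inter> snd c -` ball (snd c p) r"
      using cd r(1) by simp
    show "admissible l x0 c d (\<lambda>i. snd y $ \<kappa> i)"
      using cd x0 y by (simp add: admissible_def)
    fix x assume x: "x \<in> fst c \<inter> snd c -` ball (snd c p) r"
    then have "snd c x \<in> ?V"
      using r(2) ball_subset_cball by blast
    then show "x \<in> fst c \<and> f x \<in> fst d"
      using x inv[of "snd c x"] ch(1) by (simp add: chart_inv_apply)
    fix E assume E: "admissible l x c d E"
    have "(snd c x, \<chi> a. if a \<in> \<kappa> ` {..<l} then E (the_inv_into {..<l} \<kappa> a) else 0) \<in> ?Fr"
      using x E by (intro mem) (auto simp: admissible_def)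
    from bspec[OF max this] show "\<Phi> (gram (target_form h c d f x) E) \<le> \<Phi> (gram (target_form h c d f x0) (\<lambda>i. snd y $ \<kappa> i))"
      unfolding \<Psi> using x x0 by (simp add: tf herm_pullback_form)
  qed
qed

text \<open>Finitely many of the sets \<open>U\<close> cover the compact space, and the largest of
  the corresponding local maxima is itself attained. Chart invariance lets each local bound apply to
  frames given in any charts, so that no topology on the frame bundle has to be set up.\<close>

lemma global_maximum:
  fixes \<Phi> :: "(nat \<Rightarrow> nat \<Rightarrow> complex) \<Rightarrow> real"
  assumes compact: "compact (UNIV :: 'a set)"
    and l: "l \<le> CARD('m)" and \<Phi>: "continuous_on UNIV \<Phi>"
    and \<Phi>_cong: "\<And>A A'. (\<And>i j. i < l \<Longrightarrow> j < l \<Longrightarrow> A i j = A' i j) \<Longrightarrow> \<Phi> A = \<Phi> A'"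
  obtains x0 c0 d0 E0 where "admissible l x0 c0 d0 E0"
    "\<And>x c d E. admissible l x c d E \<Longrightarrow>
       \<Phi> (gram (target_form h c d f x) E) \<le> \<Phi> (gram (target_form h c0 d0 f x0) E0)"
proof -
  define Vals where "Vals = {\<Phi> (gram (target_form h c d f x) E) | x c d E. admissible l x c d E}"
  have loc: "\<exists>U v. open U \<and> p \<in> U \<and> v \<in> Vals \<and>
      (\<forall>x\<in>U. \<forall>c d E. admissible l x c d E \<longrightarrow> \<Phi> (gram (target_form h c d f x) E) \<le> v)" for p
  proof -
    obtain c where c: "c \<in> \<A>" "p \<in> fst c"
      using M unfolding hermitian_manifold_def complex_manifold_def by blast
    obtain d where d: "d \<in> \<B>" "f p \<in> fst d"
      using N unfolding hermitian_manifold_def complex_manifold_def by blast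
    obtain U x0 E0 where U: "open U" "p \<in> U" "admissible l x0 c d E0"
        "\<And>x E. x \<in> U \<Longrightarrow> x \<in> fst c \<and> f x \<in> fst d"
        "\<And>x E. x \<in> U \<Longrightarrow> admissible l x c d E \<Longrightarrow>
          \<Phi> (gram (target_form h c d f x) E) \<le> \<Phi> (gram (target_form h c d f x0) E0)"
      by (rule local_maximum[OF l \<Phi> \<Phi>_cong c(1) d(1) c(2) d(2)]) blast+
    have "\<Phi> (gram (target_form h c' d' f x) E) \<le> \<Phi> (gram (target_form h c d f x0) E0)"
      if x: "x \<in> U" and E: "admissible l x c' d' E" for x c' d' E
    proof -
      let ?T = "tangent_map c' c id x"
      have "gram (target_form h c' d' f x) E = gram (target_form h c d f x) (\<lambda>i. ?T *v E i)"
        using E U(4)[OF x] c d by (intro ext target_change) (auto simp: admissible_def)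
      moreover have "admissible l x c d (\<lambda>i. ?T *v E i)"
        using E U(4)[OF x] c d source_change[of c' c x, symmetric] by (auto simp: admissible_def ortho_frame_def)
      ultimately show ?thesis
        using U(5)[OF x] by simp
    qed
    then show ?thesis
      using U(1-3) unfolding Vals_def by blast
  qed
  obtain U v where Uv: "\<And>p. open (U p)" "\<And>p. p \<in> U p" "\<And>p. v p \<in> Vals"
      "\<And>p x c d E. x \<in> U p \<Longrightarrow> admissible l x c d E \<Longrightarrow> \<Phi> (gram (target_form h c d f x) E) \<le> v p"
    using loc by metis
  obtain P where P: "finite P" "UNIV \<subseteq> (\<Union>p\<in>P. U p)"
    by (rule compactE_image[OF compact, of UNIV U]) (use Uv in auto)
  have "P \<noteq> {}"
    using P(2) by auto
  then have "Max (v ` P) \<in> v ` P"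
    using P(1) by (intro Max_in) auto
  then have "Max (v ` P) \<in> Vals"
    using Uv(3) by auto
  then obtain x0 c0 d0 E0 where 0: "admissible l x0 c0 d0 E0" "Max (v ` P) = \<Phi> (gram (target_form h c0 d0 f x0) E0)"
    unfolding Vals_def by blast
  show thesis
  proof (rule that[OF 0(1)])
    fix x c d E assume E: "admissible l x c d E"
    obtain p where p: "p \<in> P" "x \<in> U p"
      using P(2) by blast
    have "\<Phi> (gram (target_form h c d f x) E) \<le> v p"
      by (rule Uv(4)[OF p(2) E])
    also have "\<dots> \<le> Max (v ` P)"
      using P(1) p(1) by (intro Max_ge) auto
    finally show "\<Phi> (gram (target_form h c d f x) E) \<le> \<Phi> (gram (target_form h c0 d0 f x0) E0)"
      by (simp only: 0(2))
  qed
qed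

section \<open>The estimates at a maximizing frame\<close>

lemma source_posdef:
  assumes "c \<in> \<A>" "x \<in> fst c"
  shows "hermitian_posdef (source_form g c x)"
  using M assms unfolding hermitian_manifold_def hermitian_metric_def by blast

lemma target_posdef:
  assumes "d \<in> \<B>" "y \<in> fst d"
  shows "hermitian_posdef (h d (snd d y))"
  using N assms unfolding hermitian_manifold_def hermitian_metric_def by blast

lemma hermitian_target_form:
  assumes "d \<in> \<B>" "f x \<in> fst d"
  shows "hermitian_mat (target_form h c d f x)"
  by (intro hermitian_mat_pullback_form hermitian_posdef_imp_hermitian_mat target_posdef assms)

text \<open>Collects the hypotheses of the second variation lemmas for one pair of charts. The last
  clause identifies the coordinate data near the point with those of actual points, to which
  maximality applies.\<close>

lemma chart_data:
  assumes cd: "c \<in> \<A>" "d \<in> \<B>" "x \<in> fst c" "f x \<in> fst d"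
  defines "S \<equiv> snd c ` (fst c \<inter> f -` fst d)" and "T \<equiv> snd d ` fst d" and "F \<equiv> local_rep c d f"
  shows "open S" "snd c x \<in> S" "mholomorphic_on F S" "smooth_on (g c) S"
    "\<And>w. w \<in> S \<Longrightarrow> hermitian_posdef (g c w)"
    "open T" "F (snd c x) \<in> T" "smooth_on (h d) T" "\<And>w. w \<in> T \<Longrightarrow> hermitian_posdef (h d w)"
    "F (snd c x) = snd d (f x)" "jacobian F (snd c x) = tangent_map c d f x"
    "\<And>w. w \<in> S \<Longrightarrow> \<exists>y. y \<in> fst c \<and> f y \<in> fst d \<and> g c w = source_form g c y \<and>
       pullback_form (jacobian F w) (h d (F w)) = target_form h c d f y"
proof -
  have ch: "is_chart c" "is_chart d"
    using M N cd unfolding hermitian_manifold_def complex_manifold_def by blast+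
  have Fx: "F (snd c y) = snd d (f y)" if "y \<in> fst c" for y
    using that ch(1) by (simp add: F_def local_rep_def chart_inv_apply)
  show "open S"
    unfolding S_def by (rule chart_domain_open[OF cd(1,2)])
  show "snd c x \<in> S"
    using cd by (auto simp: S_def)
  show "mholomorphic_on F S"
    using f cd unfolding F_def S_def holomorphic_map_def by blast
  have "smooth_on (g c) (snd c ` fst c)"
    using M cd unfolding hermitian_manifold_def hermitian_metric_def by blast
  then show "smooth_on (g c) S"
    by (rule smooth_on_subset) (auto simp: S_def)
  show "open T"
    using ch(2) unfolding T_def is_chart_def by blast
  show "F (snd c x) \<in> T"
    using cd by (auto simp: T_def Fx)
  show "smooth_on (h d) T"
    using N cd unfolding T_def hermitian_manifold_def hermitian_metric_def by blast
  show "hermitian_posdef (h d w)" if "w \<in> T" for w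
    using that target_posdef[OF cd(2)] by (auto simp: T_def)
  show "F (snd c x) = snd d (f x)"
    by (rule Fx[OF cd(3)])
  show "jacobian F (snd c x) = tangent_map c d f x"
    by (simp add: tangent_map_def F_def)
  show "hermitian_posdef (g c w)" if "w \<in> S" for w
    using that source_posdef[OF cd(1)] by (auto simp: S_def)
  show "\<exists>y. y \<in> fst c \<and> f y \<in> fst d \<and> g c w = source_form g c y \<and>
       pullback_form (jacobian F w) (h d (F w)) = target_form h c d f y" if w: "w \<in> S" for w
  proof -
    obtain y where y: "y \<in> fst c" "f y \<in> fst d" "w = snd c y"
      using w by (auto simp: S_def)
    then show ?thesis
      using Fx[OF y(1)] by (intro exI[of _ y]) (simp add: tangent_map_def F_def)
  qed
qed

lemma continuous_on_entry: "continuous_on UNIV (\<lambda>A :: nat \<Rightarrow> nat \<Rightarrow> complex. A i j)"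
  by (rule continuous_on_product_then_coordinatewise[where f = "\<lambda>A. A i"],
      rule continuous_on_product_then_coordinatewise[where f = "\<lambda>A. A"], rule continuous_on_id)

text \<open>The curvature condition on the source is stated for frames so that it can come from the
  Chern scalar curvature when \<open>l\<close> is the dimension and from the \<open>l\<close>-scalar
  curvature otherwise.\<close>

lemma ndet_bound:
  assumes compact: "compact (UNIV :: 'a set)" and l: "1 \<le> l" "l \<le> CARD('m)" and "K \<ge> 0" "\<kappa> > 0"
    and scal: "\<And>c z E. c \<in> \<A> \<Longrightarrow> z \<in> snd c ` fst c \<Longrightarrow> ortho_frame (g c z) l E \<Longrightarrow> l_scalar (g c) z l E \<ge> - K"
    and ric: "ric1_le \<B> h l (- \<kappa>)"
    and adm: "admissible l x c d E"
  shows "Re (ndet l (gram (target_form h c d f x) E)) \<le> (K / (real l * \<kappa>)) ^ l"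
proof -
  have cont: "continuous_on UNIV (\<lambda>A. Re (ndet l A))"
    unfolding ndet_def by (intro continuous_intros continuous_on_entry)
  have cong: "Re (ndet l A) = Re (ndet l A')" if "\<And>i j. i < l \<Longrightarrow> j < l \<Longrightarrow> A i j = A' i j" for A A'
    using ndet_cong[of l A A'] that by simp
  obtain x0 c0 d0 E0 where adm0: "admissible l x0 c0 d0 E0"
    and max0: "\<And>x c d E. admissible l x c d E \<Longrightarrow>
      Re (ndet l (gram (target_form h c d f x) E)) \<le> Re (ndet l (gram (target_form h c0 d0 f x0) E0))"
    by (rule global_maximum[where \<Phi> = "\<lambda>A. Re (ndet l A)", OF compact l(2) cont cong]) (assumption, rule that)
  have cd: "c0 \<in> \<A>" "d0 \<in> \<B>" "x0 \<in> fst c0" "f x0 \<in> fst d0" and E0: "ortho_frame (source_form g c0 x0) l E0"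
    using adm0 by (auto simp: admissible_def)
  define B where "B = target_form h c0 d0 f x0"
  define z where "z = snd c0 x0"
  have G: "hermitian_posdef (g c0 z)"
    unfolding z_def by (rule source_posdef[OF cd(1,3)])
  have B: "hermitian_mat B"
    unfolding B_def by (rule hermitian_target_form[OF cd(2,4)])
  obtain F where F: "ortho_frame (g c0 z) l F" "vec.span (F ` {..<l}) = vec.span (E0 ` {..<l})"
      and diag: "\<And>i j. i < l \<Longrightarrow> j < l \<Longrightarrow> i \<noteq> j \<Longrightarrow> herm B (F i) (F j) = 0"
    by (rule diagonal_frame[OF G B vec.subspace_span ortho_frame_dim[OF E0]]) (rule that)
  define \<mu> where "\<mu> i = Re (herm B (F i) (F i))" for i
  have \<mu>: "herm B (F i) (F i) = of_real (\<mu> i)" for i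
    unfolding \<mu>_def by (rule herm_self_real[OF B])
  have \<mu>0: "\<mu> i \<ge> 0" for i
    unfolding \<mu>_def B_def herm_pullback_form by (rule herm_self_nonneg[OF target_posdef[OF cd(2,4)]])
  define \<Lambda> where "\<Lambda> = (\<Prod>i<l. \<mu> i)"
  have "ndet l (gram B E0) = ndet l (gram B F)"
    by (rule ndet_gram_same_span[OF G E0[folded z_def] F(1) F(2)[symmetric]])
  also have "\<dots> = of_real \<Lambda>"
    unfolding \<Lambda>_def of_real_prod by (subst ndet_diag) (use diag \<mu> in auto)
  finally have max: "Re (ndet l (gram (target_form h c d f x) E)) \<le> \<Lambda>" if "admissible l x c d E" for x c d E
    using max0[OF that] by (simp add: B_def)
  have "\<Lambda> \<le> (K / (real l * \<kappa>)) ^ l"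
  proof (cases "\<forall>i<l. \<mu> i > 0")
    \<comment> \<open>The maximum is then 0 and the bound is trivial; otherwise all
      \<open>\<mu> i\<close> are positive, as division by them requires.\<close>
    case False
    then obtain i where "i < l" "\<mu> i = 0"
      using \<mu>0 by (metis less_eq_real_def)
    then have "\<Lambda> = 0"
      unfolding \<Lambda>_def by auto
    then show ?thesis
      using \<open>K \<ge> 0\<close> \<open>\<kappa> > 0\<close> by simp
  next
    case True
    define J where "J = tangent_map c0 d0 f x0"
    define w where "w = snd d0 (f x0)"
    note loc = chart_data[OF cd]
    have hB: "herm B u v = herm (h d0 w) (J *v u) (J *v v)" for u v
      by (simp add: B_def herm_pullback_form J_def w_def)
    have Bz: "pullback_form (jacobian (local_rep c0 d0 f) (snd c0 x0)) (h d0 (local_rep c0 d0 f (snd c0 x0))) = B"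
      by (simp add: loc(10,11) B_def)
    \<comment> \<open>Any tuple is a combination of a unitary frame at the same point, and the
      factor \<open>C\<close> that this costs is the Gram determinant of the tuple in the
      source.\<close>
    have maxV: "Re (ndet l (gram (pullback_form (jacobian (local_rep c0 d0 f) y) (h d0 (local_rep c0 d0 f y))) V))
        \<le> \<Lambda> * Re (ndet l (gram (g c0 y) V))" if y: "y \<in> snd c0 ` (fst c0 \<inter> f -` fst d0)" for y V
    proof -
      obtain x' where x': "x' \<in> fst c0" "f x' \<in> fst d0" "g c0 y = source_form g c0 x'"
          "pullback_form (jacobian (local_rep c0 d0 f) y) (h d0 (local_rep c0 d0 f y)) = target_form h c0 d0 f x'"
        using loc(12)[OF y] by blast
      obtain E' where E': "ortho_frame (source_form g c0 x') l E'" "\<And>i. i < l \<Longrightarrow> V i \<in> vec.span (E' ` {..<l})"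
        by (rule exists_span_frame[OF source_posdef[OF cd(1) x'(1)] hermitian_target_form[OF cd(2) x'(2)] l(2), of V]) (rule that)
      define C where "C = (cmod (ndet l (\<lambda>i a. herm (source_form g c0 x') (V i) (E' a))))\<^sup>2"
      have "ndet l (gram A V) = of_real C * ndet l (gram A E')" for A
        unfolding C_def by (rule gram_combination_ortho[OF E'])
      moreover have "Re (ndet l (gram (target_form h c0 d0 f x') E')) \<le> \<Lambda>"
        using cd(1,2) x' E'(1) by (intro max) (simp add: admissible_def)
      moreover have "C \<ge> 0"
        by (simp add: C_def)
      ultimately show ?thesis
        unfolding x'(3,4) by (simp add: ndet_gram_ortho[OF E'(1)] mult.commute mult_left_mono)
    qed
    have var: "(\<Sum>i<l. Re (chern_R (g c0) z v v (F i) (F i)))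
        \<le> (\<Sum>i<l. Re (chern_R (h d0) w (J *v v) (J *v v) (J *v F i) (J *v F i)) / \<mu> i)" for v
    proof -
      have pos: "0 < Re (herm B (F i) (F i))" if "i < l" for i
        using True that by (simp add: \<mu>_def)
      note det_second_variation[OF loc(1-9), of l F v, unfolded Bz, folded z_def,
          OF _ _ F(1) diag pos maxV[unfolded \<Lambda>_def \<mu>_def]]
      then show ?thesis
        unfolding w_def J_def \<mu>_def loc(10,11)[folded z_def] by simp
    qed
    define e where "e i = of_real (1 / sqrt (\<mu> i)) *s (J *v F i)" for i
    have e: "ortho_frame (h d0 w) l e"
      unfolding ortho_frame_def
    proof (intro allI impI)
      fix i j assume "i < l" "j < l"
      then show "herm (h d0 w) (e i) (e j) = (if i = j then 1 else 0)"
        using diag[of i j] \<mu>[of i] True unfolding e_def herm_scale_left herm_scale_right hB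
        by (auto simp flip: of_real_mult of_real_divide)
    qed
    \<comment> \<open>Dividing by \<open>\<mu> i\<close> normalizes \<open>J *v F i\<close> to
      \<open>e i\<close>, so the sum is the first Ricci curvature of the image subspace in the
      direction \<open>J *v F k\<close>, a vector of squared length \<open>\<mu> k\<close>.\<close>
    have ricF: "(\<Sum>i<l. Re (chern_R (h d0) w (J *v F k) (J *v F k) (J *v F i) (J *v F i)) / \<mu> i) \<le> - \<kappa> * \<mu> k"
      if k: "k < l" for k
    proof -
      have "Re (chern_R (h d0) w (J *v F k) (J *v F k) (e i) (e i)) =
          Re (chern_R (h d0) w (J *v F k) (J *v F k) (J *v F i) (J *v F i)) / \<mu> i" if "i < l" for i
        using chern_R_scale[of "h d0" w 1 "J *v F k" "of_real (1 / sqrt (\<mu> i))" "J *v F i"] True that \<mu>0[of i]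
        by (simp add: e_def norm_divide power_divide)
      then have "(\<Sum>i<l. Re (chern_R (h d0) w (J *v F k) (J *v F k) (J *v F i) (J *v F i)) / \<mu> i) =
          ric1 (h d0) w l e (J *v F k)"
        by (simp add: ric1_def)
      also have "\<dots> \<le> - \<kappa> * (herm_norm (h d0 w) (J *v F k))\<^sup>2"
      proof -
        have "J *v F k = of_real (sqrt (\<mu> k)) *s e k"
          using True[rule_format, OF k] by (simp add: e_def vec.scale_scale flip: of_real_mult of_real_divide)
        then have "J *v F k \<in> vec.span (e ` {..<l})"
          using k by (simp add: vec.span_scale vec.span_base)
        moreover have "unitary_basis (h d0 w) l (vec.span (e ` {..<l})) e"
          using e by (simp add: unitary_basis_def ortho_frame_def)
        moreover have "w \<in> snd d0 ` fst d0"
          using cd by (simp add: w_def)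
        ultimately show ?thesis
          using ric cd(2) ortho_frame_dim[OF e] vec.subspace_span unfolding ric1_le_def by blast
      qed
      also have "(herm_norm (h d0 w) (J *v F k))\<^sup>2 = \<mu> k"
        using target_posdef[OF cd(2,4)] by (simp add: herm_norm_power2 w_def \<mu>_def hB)
      finally show ?thesis .
    qed
    \<comment> \<open>Summing the variation inequality over the directions \<open>v = F k\<close>
      produces the \<open>l\<close>-scalar curvature on the source side.\<close>
    have "- K \<le> l_scalar (g c0) z l F"
      using cd F(1) by (intro scal) (auto simp: z_def)
    also have "\<dots> = (\<Sum>k<l. \<Sum>i<l. Re (chern_R (g c0) z (F k) (F k) (F i) (F i)))"
      by (simp add: l_scalar_def)
    also have "\<dots> \<le> (\<Sum>k<l. - \<kappa> * \<mu> k)"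
    proof (rule sum_mono)
      fix k assume "k \<in> {..<l}"
      then show "(\<Sum>i<l. Re (chern_R (g c0) z (F k) (F k) (F i) (F i))) \<le> - \<kappa> * \<mu> k"
        by (intro order_trans[OF var ricF]) simp
    qed
    also have "\<dots> = - \<kappa> * (\<Sum>k<l. \<mu> k)"
      by (simp add: sum_distrib_left)
    finally have "(\<Sum>k<l. \<mu> k) \<le> K / \<kappa>"
      using \<open>\<kappa> > 0\<close> by (simp add: field_simps)
    then have "((\<Sum>k<l. \<mu> k) / real l) ^ l \<le> (K / \<kappa> / real l) ^ l"
      using \<mu>0 by (intro power_mono divide_right_mono divide_nonneg_nonneg sum_nonneg) auto
    moreover have "\<Lambda> \<le> ((\<Sum>k<l. \<mu> k) / real l) ^ l"
      unfolding \<Lambda>_def using l(1) \<mu>0 by (intro prod_le_mean_power) auto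
    ultimately show ?thesis
      by (simp add: mult.commute)
  qed
  with max[OF adm] show ?thesis
    by (rule order_trans)
qed

text \<open>At the maximum \<open>\<kappa> * q \<le> K * \<sigma>\<close> with \<open>q\<close> the
  sum of the squares of the \<open>\<mu> i\<close>, and Cauchy-Schwarz gives
  \<open>\<sigma>\<^sup>2 \<le> l * q\<close>. The squares arise because the weights in the real
  bisectional curvature are the \<open>\<mu> i\<close>, and it divides by the sum of their
  squares.\<close>

lemma trace_bound:
  assumes compact: "compact (UNIV :: 'a set)" and l: "l \<le> CARD('m)" "CARD('m) \<le> CARD('n)" and "K \<ge> 0" "\<kappa> > 0"
    and ric: "\<And>c z E i. c \<in> \<A> \<Longrightarrow> z \<in> snd c ` fst c \<Longrightarrow> ortho_frame (g c z) l E \<Longrightarrow> i < l \<Longrightarrow> ric2 (g c) z l E (E i) \<ge> - K"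
    and bis: "real_bisectional_le \<B> h (- \<kappa>)"
    and adm: "admissible l x c d E"
  shows "(\<Sum>i<l. Re (herm (target_form h c d f x) (E i) (E i))) \<le> real l * K / \<kappa>"
proof -
  let ?\<Phi> = "\<lambda>A :: nat \<Rightarrow> nat \<Rightarrow> complex. \<Sum>i<l. Re (A i i)"
  have cont: "continuous_on UNIV ?\<Phi>"
    by (intro continuous_intros continuous_on_entry)

  obtain x0 c0 d0 E0 where adm0: "admissible l x0 c0 d0 E0"
    and max0: "\<And>x c d E. admissible l x c d E \<Longrightarrow>
      ?\<Phi> (gram (target_form h c d f x) E) \<le> ?\<Phi> (gram (target_form h c0 d0 f x0) E0)"
    by (rule global_maximum[where l = l and \<Phi> = ?\<Phi>, OF compact l(1) cont])
      (intro sum.cong refl, simp, rule that)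
  have cd: "c0 \<in> \<A>" "d0 \<in> \<B>" "x0 \<in> fst c0" "f x0 \<in> fst d0" and E0: "ortho_frame (source_form g c0 x0) l E0"
    using adm0 by (auto simp: admissible_def)
  define B where "B = target_form h c0 d0 f x0"
  define z where "z = snd c0 x0"
  have G: "hermitian_posdef (g c0 z)"
    unfolding z_def by (rule source_posdef[OF cd(1,3)])
  have B: "hermitian_mat B"
    unfolding B_def by (rule hermitian_target_form[OF cd(2,4)])
  obtain F where F: "ortho_frame (g c0 z) l F" "vec.span (F ` {..<l}) = vec.span (E0 ` {..<l})"
      and diag: "\<And>i j. i < l \<Longrightarrow> j < l \<Longrightarrow> i \<noteq> j \<Longrightarrow> herm B (F i) (F j) = 0"
      and decr: "\<And>i j. i \<le> j \<Longrightarrow> j < l \<Longrightarrow> Re (herm B (F j) (F j)) \<le> Re (herm B (F i) (F i))"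
    by (rule diagonal_frame[OF G B vec.subspace_span ortho_frame_dim[OF E0]]) (rule that)
  define \<mu> where "\<mu> i = Re (herm B (F i) (F i))" for i
  have \<mu>: "herm B (F i) (F i) = of_real (\<mu> i)" for i
    unfolding \<mu>_def by (rule herm_self_real[OF B])
  have \<mu>0: "\<mu> i \<ge> 0" for i
    unfolding \<mu>_def B_def herm_pullback_form by (rule herm_self_nonneg[OF target_posdef[OF cd(2,4)]])
  define \<sigma> where "\<sigma> = (\<Sum>i<l. \<mu> i)"
  have "(\<Sum>i<l. herm B (E0 i) (E0 i)) = (\<Sum>i<l. herm B (F i) (F i))"
    by (rule trace_gram_same_span[OF G E0[folded z_def] F(1) F(2)[symmetric]])
  then have "?\<Phi> (gram B E0) = \<sigma>"
    unfolding \<sigma>_def \<mu>_def Re_sum[symmetric] by simp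
  then have max: "?\<Phi> (gram (target_form h c d f x) E) \<le> \<sigma>" if "admissible l x c d E" for x c d E
    using max0[OF that] by (simp add: B_def)
  define J where "J = tangent_map c0 d0 f x0"
  define w where "w = snd d0 (f x0)"
  note loc = chart_data[OF cd]
  have hB: "herm B u v = herm (h d0 w) (J *v u) (J *v v)" for u v
    by (simp add: B_def herm_pullback_form J_def w_def)
  have Bz: "pullback_form (jacobian (local_rep c0 d0 f) (snd c0 x0)) (h d0 (local_rep c0 d0 f (snd c0 x0))) = B"
    by (simp add: loc(10,11) B_def)
  have maxV: "Re ((\<Sum>i<l. 2 * herm (pullback_form (jacobian (local_rep c0 d0 f) y) (h d0 (local_rep c0 d0 f y))) (V i) (V i)) -
      (\<Sum>i<l. \<Sum>j<l. herm (g c0 y) (V i) (V j) * herm (pullback_form (jacobian (local_rep c0 d0 f) y) (h d0 (local_rep c0 d0 f y))) (V j) (V i)))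
      \<le> \<sigma>" if y: "y \<in> snd c0 ` (fst c0 \<inter> f -` fst d0)" for y V
  proof -
    obtain x' where x': "x' \<in> fst c0" "f x' \<in> fst d0" "g c0 y = source_form g c0 x'"
        "pullback_form (jacobian (local_rep c0 d0 f) y) (h d0 (local_rep c0 d0 f y)) = target_form h c0 d0 f x'"
      using loc(12)[OF y] by blast
    have psd: "Re (herm (target_form h c0 d0 f x') v v) \<ge> 0" for v
      unfolding herm_pullback_form by (rule herm_self_nonneg[OF target_posdef[OF cd(2) x'(2)]])
    obtain E' where E': "ortho_frame (source_form g c0 x') l E'"
      "Re ((\<Sum>i<l. 2 * herm (target_form h c0 d0 f x') (V i) (V i)) -
        (\<Sum>i<l. \<Sum>j<l. herm (source_form g c0 x') (V i) (V j) * herm (target_form h c0 d0 f x') (V j) (V i)))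
       \<le> (\<Sum>a<l. Re (herm (target_form h c0 d0 f x') (E' a) (E' a)))"
      by (rule trace_le_ortho_frame[OF source_posdef[OF cd(1) x'(1)] psd l(1), of V]) (rule that)
    have "(\<Sum>a<l. Re (herm (target_form h c0 d0 f x') (E' a) (E' a))) \<le> \<sigma>"
      using cd(1,2) x' E'(1) by (intro max) (simp add: admissible_def)
    with E'(2) show ?thesis
      unfolding x'(3,4) by (rule order_trans)
  qed
  have var: "(\<Sum>i<l. \<mu> i * Re (chern_R (g c0) z v v (F i) (F i)))
      \<le> (\<Sum>i<l. Re (chern_R (h d0) w (J *v v) (J *v v) (J *v F i) (J *v F i)))" for v
  proof -
    note trace_second_variation[OF loc(1-9), of l F v, unfolded Bz, folded z_def,
        OF _ _ F(1) diag maxV[unfolded \<sigma>_def \<mu>_def]]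
    then show ?thesis
      unfolding w_def J_def \<mu>_def loc(10,11)[folded z_def] by simp
  qed
  have posH: "hermitian_posdef (h d0 w)"
    unfolding w_def by (rule target_posdef[OF cd(2,4)])
  \<comment> \<open>The rank on the frame: entries decrease, so those before the first zero are
    positive and all later ones up to \<open>l\<close> vanish. The alternative \<open>n = l\<close>
    makes the minimum exist.\<close>
  define r where "r = (LEAST n. n = l \<or> n < l \<and> \<mu> n = 0)"
  have r: "r = l \<or> r < l \<and> \<mu> r = 0"
    unfolding r_def by (rule LeastI[of _ l]) simp
  have r_pos: "\<mu> i > 0" if "i < r" for i
    using not_less_Least[OF that[unfolded r_def]] that r \<mu>0[of i] by auto
  have r_zero: "\<mu> i = 0" if "r \<le> i" "i < l" for i
    using decr[OF that] r that \<mu>0[of i] by (auto simp: \<mu>_def)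
  have "r \<le> CARD('n)"
    using r l by auto
  define e where "e i = of_real (1 / sqrt (\<mu> i)) *s (J *v F i)" for i
  have "ortho_frame (h d0 w) r e"
    unfolding ortho_frame_def
  proof (intro allI impI)
    fix i j assume "i < r" "j < r"
    moreover then have "i < l" "j < l"
      using r by auto
    ultimately show "herm (h d0 w) (e i) (e j) = (if i = j then 1 else 0)"
      using diag[of i j] \<mu>[of i] r_pos[of i] unfolding e_def herm_scale_left herm_scale_right hB
      by (auto simp flip: of_real_mult of_real_divide)
  qed
  then obtain E' where E': "ortho_frame (h d0 w) CARD('n) E'" "\<And>i. i < r \<Longrightarrow> E' i = e i"
    by (rule ortho_frame_extend[OF posH _ \<open>r \<le> CARD('n)\<close>]) (rule that)
  \<comment> \<open>Outside \<open>{..<l}\<close> the numbers \<open>\<mu> i\<close> are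
    uncontrolled; as weights for a full frame of the target they are replaced by 0.\<close>
  define b where "b i = (if i < r then \<mu> i else 0)" for i
  have b: "b i = \<mu> i" if "i < l" for i
    using r_zero[of i] that by (auto simp: b_def)
  have W: "J *v F i = of_real (sqrt (b i)) *s E' i" if "i < l" for i
  proof (cases "i < r")
    case True
    then show ?thesis
      using r_pos[of i] by (simp add: b_def E' e_def flip: of_real_mult of_real_divide)
  next
    case False
    then have "Re (herm (h d0 w) (J *v F i) (J *v F i)) = 0"
      using r_zero[of i] that by (simp add: \<mu>_def hB)
    then have "J *v F i = 0"
      using herm_self_pos[OF posH, of "J *v F i"] by auto
    then show ?thesis
      using False by (simp add: b_def)
  qed
  have b0: "b i \<ge> 0" for i
    using \<mu>0 by (simp add: b_def)
  have RW: "Re (chern_R (h d0) w (J *v F k) (J *v F k) (J *v F i) (J *v F i)) = b k * b i * Re (chern_R (h d0) w (E' k) (E' k) (E' i) (E' i))"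
    if "k < l" "i < l" for k i
    unfolding W[OF that(1)] W[OF that(2)] chern_R_scale using b0 by simp
  obtain \<iota> :: "'n \<Rightarrow> nat" where \<iota>: "bij_betw \<iota> UNIV {..<CARD('n)}"
    by (rule exists_index)
  have \<iota>': "\<iota> i < CARD('n)" "\<iota> i = \<iota> j \<longleftrightarrow> i = j" for i j
    using \<iota> bij_betwE[OF \<iota>] by (auto simp: bij_betw_def inj_def)
  have sum_restrict: "(\<Sum>i\<in>UNIV. q (\<iota> i)) = (\<Sum>i<l. q i)" if "\<And>i. b i = 0 \<Longrightarrow> q i = 0" for q :: "nat \<Rightarrow> real"
  proof -
    have "(\<Sum>i\<in>UNIV. q (\<iota> i)) = (\<Sum>i<CARD('n). q i)"
      by (rule sum.reindex_bij_betw[OF \<iota>])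
    also have "\<dots> = (\<Sum>i<l. q i)"
      using l r that by (intro sum.mono_neutral_right) (auto simp: b_def)
    finally show ?thesis .
  qed
  have "\<sigma> \<le> real l * K / \<kappa>"
  proof (cases "\<sigma> > 0")
    case False
    then have "\<sigma> \<le> 0"
      by simp
    also have "0 \<le> real l * K / \<kappa>"
      using \<open>K \<ge> 0\<close> \<open>\<kappa> > 0\<close> by simp
    finally show ?thesis .
  next
    case True
    define q where "q = (\<Sum>i<l. (\<mu> i)\<^sup>2)"
    \<comment> \<open>Cauchy-Schwarz; it also shows \<open>q > 0\<close>, the nonvanishing of the
      weights that the curvature condition demands.\<close>
    have cs: "\<sigma>\<^sup>2 \<le> q * real l"
      using sum_squared_le_sum_of_squares[of \<mu> "{..<l}"] by (simp add: \<sigma>_def q_def)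
    then have "0 < q * real l"
      using zero_less_power[OF True, of 2] by linarith
    then have "q > 0"
      by (simp add: zero_less_mult_iff)
    have q: "(\<Sum>i\<in>UNIV. (b (\<iota> i))\<^sup>2) = q"
      unfolding q_def by (subst sum_restrict) (simp_all add: b)
    have "real_bisectional (h d0) w (\<lambda>i. E' (\<iota> i)) (\<lambda>i. b (\<iota> i)) \<le> - \<kappa>"
    proof -
      have 1: "\<forall>i j. herm (h d0 w) (E' (\<iota> i)) (E' (\<iota> j)) = (if i = j then 1 else 0)"
        using ortho_frameD[OF E'(1)] \<iota>' by simp
      have 2: "\<forall>i. b (\<iota> i) \<ge> 0"
        using b0 by blast
      have 3: "(\<Sum>i\<in>UNIV. (b (\<iota> i))\<^sup>2) > 0"
        using q \<open>q > 0\<close> by (simp only:)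
      have w: "w \<in> snd d0 ` fst d0"
        using cd by (simp add: w_def)
      show ?thesis
        by (rule bis[unfolded real_bisectional_le_def, THEN bspec, OF cd(2), THEN bspec, OF w, THEN spec, THEN spec, THEN mp])
          (intro conjI 1 2 3)
    qed
    also have "real_bisectional (h d0) w (\<lambda>i. E' (\<iota> i)) (\<lambda>i. b (\<iota> i)) =
        1 / q * (\<Sum>k\<in>UNIV. \<Sum>i\<in>UNIV. b (\<iota> k) * b (\<iota> i) * Re (chern_R (h d0) w (E' (\<iota> k)) (E' (\<iota> k)) (E' (\<iota> i)) (E' (\<iota> i))))"
      unfolding real_bisectional_def q by (simp add: mult_ac)
    also have "(\<Sum>k\<in>UNIV. \<Sum>i\<in>UNIV. b (\<iota> k) * b (\<iota> i) * Re (chern_R (h d0) w (E' (\<iota> k)) (E' (\<iota> k)) (E' (\<iota> i)) (E' (\<iota> i)))) =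
        (\<Sum>k<l. \<Sum>i<l. Re (chern_R (h d0) w (J *v F k) (J *v F k) (J *v F i) (J *v F i)))"
    proof -
      have "(\<Sum>k\<in>UNIV. \<Sum>i\<in>UNIV. b (\<iota> k) * b (\<iota> i) * Re (chern_R (h d0) w (E' (\<iota> k)) (E' (\<iota> k)) (E' (\<iota> i)) (E' (\<iota> i)))) =
          (\<Sum>k\<in>UNIV. \<Sum>i<l. b (\<iota> k) * b i * Re (chern_R (h d0) w (E' (\<iota> k)) (E' (\<iota> k)) (E' i) (E' i)))"
        by (rule sum.cong[OF refl], rule sum_restrict) simp
      also have "\<dots> = (\<Sum>k<l. \<Sum>i<l. b k * b i * Re (chern_R (h d0) w (E' k) (E' k) (E' i) (E' i)))"
        by (rule sum_restrict) simp
      finally show ?thesis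
        by (simp add: RW)
    qed
    finally have "(\<Sum>k<l. \<Sum>i<l. Re (chern_R (h d0) w (J *v F k) (J *v F k) (J *v F i) (J *v F i))) \<le> - \<kappa> * q"
      using \<open>q > 0\<close> by (simp add: field_simps)
    moreover have "(\<Sum>k<l. \<Sum>i<l. \<mu> i * Re (chern_R (g c0) z (F k) (F k) (F i) (F i)))
        \<le> (\<Sum>k<l. \<Sum>i<l. Re (chern_R (h d0) w (J *v F k) (J *v F k) (J *v F i) (J *v F i)))"
      by (rule sum_mono) (rule var)
    \<comment> \<open>Exchanging the sums puts the weight \<open>\<mu> i\<close> outside and leaves
      the second Ricci curvature of the span in the direction \<open>F i\<close>.\<close>
    moreover have "- K * \<sigma> \<le> (\<Sum>k<l. \<Sum>i<l. \<mu> i * Re (chern_R (g c0) z (F k) (F k) (F i) (F i)))"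
    proof -
      have "- K * \<sigma> = (\<Sum>i<l. \<mu> i * - K)"
        by (simp add: \<sigma>_def sum_distrib_left mult.commute sum_negf)
      also have "\<dots> \<le> (\<Sum>i<l. \<mu> i * ric2 (g c0) z l F (F i))"
        using ric[OF cd(1) _ F(1)] cd \<mu>0 by (intro sum_mono mult_left_mono) (auto simp: z_def)
      also have "\<dots> = (\<Sum>k<l. \<Sum>i<l. \<mu> i * Re (chern_R (g c0) z (F k) (F k) (F i) (F i)))"
        by (subst sum.swap) (simp add: ric2_def sum_distrib_left)
      finally show ?thesis .
    qed
    ultimately have "\<kappa> * q \<le> K * \<sigma>"
      by simp
    then have "\<kappa> * q * real l \<le> K * \<sigma> * real l"
      by (rule mult_right_mono) simp
    moreover have "\<kappa> * \<sigma>\<^sup>2 \<le> \<kappa> * (q * real l)"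
      using cs \<open>\<kappa> > 0\<close> by (intro mult_left_mono) auto
    ultimately have "\<sigma> * (\<kappa> * \<sigma>) \<le> \<sigma> * (K * real l)"
      by (simp add: power2_eq_square algebra_simps)
    then have "\<kappa> * \<sigma> \<le> K * real l"
      using True by simp
    then show ?thesis
      using \<open>\<kappa> > 0\<close> by (simp add: pos_le_divide_eq mult.commute)
  qed
  with max[OF adm] show ?thesis
    by (rule order_trans)
qed

end

section \<open>Reduction of the three inequalities to the frame estimates\<close>

lemma ortho_frame_unitary_basis:
  "ortho_frame G l E \<Longrightarrow> vec.subspace (vec.span (E ` {..<l})) \<and> vec.dim (vec.span (E ` {..<l})) = l \<and>
     unitary_basis G l (vec.span (E ` {..<l})) E"
  by (simp only: vec.subspace_span ortho_frame_dim unitary_basis_def) (simp add: ortho_frame_def)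

theorem theorem1p4:
  fixes \<A> :: "('a::{t2_space,second_countable_topology}, 'm::finite) chart set"
    and \<B> :: "('b::{t2_space,second_countable_topology}, 'n::finite) chart set"
    and g :: "('a, 'm) metric" and h :: "('b, 'n) metric"
    and f :: "'a \<Rightarrow> 'b" and l :: nat and K \<kappa> :: real
  assumes "hermitian_manifold \<A> g" and "hermitian_manifold \<B> h"
    and "holomorphic_map \<A> \<B> f"
    and "compact (UNIV :: 'a set)"
    and "CARD('m) \<le> CARD('n)"
    and "1 \<le> l" and "l \<le> CARD('m)"
    and "K \<ge> 0" and "\<kappa> > 0"
  shows "
    (chern_scalar_ge \<A> g (- K) \<and> ric1_le \<B> h CARD('m) (- \<kappa>) \<longrightarrow>
       (\<forall>x. \<forall>c\<in>\<A>. \<forall>d\<in>\<B>. x \<in> fst c \<and> f x \<in> fst d \<longrightarrow>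
          volume_ratio (g c (snd c x)) (h d (snd d (f x))) (tangent_map c d f x)
            \<le> (K / (real CARD('m) * \<kappa>)) ^ CARD('m))) \<and>
    (kaehler \<A> g \<and> l < CARD('m) \<and> l_scalar_ge \<A> g l (- K) \<and> ric1_le \<B> h l (- \<kappa>) \<longrightarrow>
       (\<forall>x. \<forall>c\<in>\<A>. \<forall>d\<in>\<B>. x \<in> fst c \<and> f x \<in> fst d \<longrightarrow>
          (wedge_comass l (g c (snd c x)) (h d (snd d (f x))) (tangent_map c d f x))\<^sup>2
            \<le> (K / (real l * \<kappa>)) ^ l)) \<and>
    (ric2_ge \<A> g l (- K) \<and> real_bisectional_le \<B> h (- \<kappa>) \<longrightarrow>
       (\<forall>x. \<forall>c\<in>\<A>. \<forall>d\<in>\<B>. x \<in> fst c \<and> f x \<in> fst d \<longrightarrow>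
          sigma_l l (g c (snd c x)) (h d (snd d (f x))) (tangent_map c d f x)
            \<le> real l * K / \<kappa>))"
proof (intro conjI impI allI ballI)
  note M = assms(1-3)
  note adm = admissible_def[OF M]
  {
    fix x c d
    assume *: "chern_scalar_ge \<A> g (- K) \<and> ric1_le \<B> h CARD('m) (- \<kappa>)"
      and cd: "c \<in> \<A>" "d \<in> \<B>" "x \<in> fst c \<and> f x \<in> fst d"
    have scal: "- K \<le> l_scalar (g c) z CARD('m) E"
      if "c \<in> \<A>" "z \<in> snd c ` fst c" "ortho_frame (g c z) CARD('m) E" for c z E
    proof -
      have "- K \<le> chern_scalar (g c) z"
        using * that(1,2) unfolding chern_scalar_ge_def by blast
      then show ?thesis
        by (simp only: chern_scalar_eq_l_scalar[where G = "g c", OF that(3)])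
    qed
    have pos: "hermitian_posdef (g c (snd c x))" "hermitian_posdef (h d (snd d (f x)))"
      using source_posdef[OF M] target_posdef[OF M] cd by blast+
    obtain E where E: "ortho_frame (source_form g c x) CARD('m) E"
        "volume_ratio (g c (snd c x)) (h d (snd d (f x))) (tangent_map c d f x) =
           Re (ndet CARD('m) (gram (target_form h c d f x) E))"
      by (rule volume_ratio_eq[OF pos, of "tangent_map c d f x"]) (rule that)
    have "1 \<le> CARD('m)"
      by (simp add: Suc_le_eq)
    then have "Re (ndet CARD('m) (gram (target_form h c d f x) E)) \<le> (K / (real CARD('m) * \<kappa>)) ^ CARD('m)"
      using * cd E(1) assms(4,8,9) scal by (intro ndet_bound[OF M]) (auto simp: adm)
    then show "volume_ratio (g c (snd c x)) (h d (snd d (f x))) (tangent_map c d f x) \<le> (K / (real CARD('m) * \<kappa>)) ^ CARD('m)"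
      by (simp only: E(2))
  next
    fix x c d
    assume *: "kaehler \<A> g \<and> l < CARD('m) \<and> l_scalar_ge \<A> g l (- K) \<and> ric1_le \<B> h l (- \<kappa>)"
      and cd: "c \<in> \<A>" "d \<in> \<B>" "x \<in> fst c \<and> f x \<in> fst d"
    have scal: "- K \<le> l_scalar (g c) z l E"
      if "c \<in> \<A>" "z \<in> snd c ` fst c" "ortho_frame (g c z) l E" for c z E
      using * that ortho_frame_unitary_basis[OF that(3)] unfolding l_scalar_ge_def by blast
    show "(wedge_comass l (g c (snd c x)) (h d (snd d (f x))) (tangent_map c d f x))\<^sup>2 \<le> (K / (real l * \<kappa>)) ^ l"
    proof (rule wedge_comass_le)
      show "hermitian_posdef (g c (snd c x))" "hermitian_posdef (h d (snd d (f x)))"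
        using source_posdef[OF M] target_posdef[OF M] cd by blast+
      show "l \<le> CARD('m)"
        by (rule assms(7))
      fix E assume "ortho_frame (g c (snd c x)) l E"
      then show "Re (ndet l (gram (target_form h c d f x) E)) \<le> (K / (real l * \<kappa>)) ^ l"
        using * cd assms scal by (intro ndet_bound[OF M]) (auto simp: adm)
    qed
  next
    fix x c d
    assume *: "ric2_ge \<A> g l (- K) \<and> real_bisectional_le \<B> h (- \<kappa>)"
      and cd: "c \<in> \<A>" "d \<in> \<B>" "x \<in> fst c \<and> f x \<in> fst d"
    \<comment> \<open>Only vectors of the unitary frame itself are inserted, so the factor
      \<open>(herm_norm (g c z) (E i))\<^sup>2\<close> in the curvature bound is 1.\<close>
    have ric: "- K \<le> ric2 (g c) z l E (E i)"
      if "c \<in> \<A>" "z \<in> snd c ` fst c" "ortho_frame (g c z) l E" "i < l" for c z E i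
    proof -
      have "hermitian_posdef (g c z)"
        using source_posdef[OF M that(1)] that(2) by blast
      then have "(herm_norm (g c z) (E i))\<^sup>2 = 1"
        using ortho_frameD[OF that(3,4,4)] by (simp add: herm_norm_power2)
      moreover have "E i \<in> vec.span (E ` {..<l})"
        using that(4) by (intro vec.span_base) simp
      ultimately show ?thesis
        using * that ortho_frame_unitary_basis[OF that(3)] unfolding ric2_ge_def by (metis mult.right_neutral)
    qed
    have pos: "hermitian_posdef (g c (snd c x))" "hermitian_posdef (h d (snd d (f x)))"
      using source_posdef[OF M] target_posdef[OF M] cd by blast+
    obtain E where E: "ortho_frame (source_form g c x) l E"
        "sigma_l l (g c (snd c x)) (h d (snd d (f x))) (tangent_map c d f x) =
           (\<Sum>i<l. Re (herm (target_form h c d f x) (E i) (E i)))"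
      by (rule sigma_l_eq[OF pos assms(7), of "tangent_map c d f x"]) (rule that)
    have "(\<Sum>i<l. Re (herm (target_form h c d f x) (E i) (E i))) \<le> real l * K / \<kappa>"
      using * cd E(1) assms ric by (intro trace_bound[OF M]) (auto simp: adm)
    then show "sigma_l l (g c (snd c x)) (h d (snd d (f x))) (tangent_map c d f x) \<le> real l * K / \<kappa>"
      by (simp only: E(2))
  }
qed

end
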